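(* Let $\mathcal{Q}_p=[0,1]^p\subset\mathbb{R}^p$. For every $s>p$ the limit $$\sigma_{s,p}:=\lim_{N\to\infty}\frac{\mathcal{P}_s(\mathcal{Q}_p;N)}{N^{s/p}}$$ exists and is positive and finite. More generally, let $d\le p$ be positive integers, $s>d$, and let $A$ be a compact subset of a $d$-dimensional $C^1$ manifold in $\mathbb{R}^p$ whose boundary relative to the manifold has $\mathcal{H}_d$-measure zero. Then $$\lim_{N\to\infty}\frac{\mathcal{P}_s(A;N)}{N^{s/d}}=\frac{\sigma_{s,d}}{\mathcal{H}_d(A)^{s/d}}.$$ Furthermore, if $\mathcal{H}_d(A)>0$, then for every asymptotically $s$-optimal sequence $\{\omega_N\}_{N\ge1}$ of $N$-point configurations in $A$, $$\nu(\omega_N)\xrightarrow{\ast}\frac{1}{\mathcal{H}_d(A)}\,\mathcal{H}_d\big|_A\quad\text{as }N\to\infty$$ (weak-star convergence of measures).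
   Context: An $N$-point configuration $\omega_N=\{x_1,\dots,x_N\}\subset A$ is a multiset of $N$ points of $A$ (repetitions allowed). For $s>0$, $P_s(A;\omega_N):=\inf_{y\in A}\sum_{j=1}^N |y-x_j|^{-s}$ and $\mathcal{P}_s(A;N):=\sup_{\omega_N\subset A}P_s(A;\omega_N)$ (supremum over all $N$-point configurations in $A$). A sequence $\{\omega_N\}_{N\ge1}$, $\omega_N$ an $N$-point configuration in $A$, is asymptotically $s$-optimal if $\lim_{N\to\infty}P_s(A;\omega_N)/\mathcal{P}_s(A;N)=1$. $\nu(\omega_N):=\frac1N\sum_{x\in\omega_N}\delta_x$ is the normalized counting measure (counted with multiplicity). $\mathcal{H}_d$ denotes $d$-dimensional Hausdorff measure on $\mathbb{R}^p$ normalized so that a $d$-dimensional unit cube embedded in $\mathbb{R}^p$ has measure $1$. *)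

theory Defs
  imports "HOL-Analysis.Analysis"
begin

text \<open>Volume of the unit ball in dimension d (extended to real d via Gamma);
  with this constant the d-dimensional Hausdorff measure gives a d-dimensional
  unit cube measure 1.\<close>
definition unit_ball_vol :: "real \<Rightarrow> real" where
  "unit_ball_vol d = pi powr (d / 2) / Gamma (d / 2 + 1)"

definition hausdorff_pre :: "real \<Rightarrow> real \<Rightarrow> 'a::euclidean_space set \<Rightarrow> ennreal" where
  "hausdorff_pre d \<delta> E =
     (INF C \<in> {C :: nat \<Rightarrow> 'a set. E \<subseteq> (\<Union>n. C n) \<and> (\<forall>n. bounded (C n) \<and> diameter (C n) \<le> \<delta>)}.
        (\<Sum>n. ennreal (unit_ball_vol d * (diameter (C n) / 2) powr d)))"

definition hausdorff_outer :: "real \<Rightarrow> 'a::euclidean_space set \<Rightarrow> ennreal" where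
  "hausdorff_outer d E = (SUP \<delta> \<in> {0<..}. hausdorff_pre d \<delta> E)"

definition hausdorff_measure :: "real \<Rightarrow> 'a::euclidean_space measure" where
  "hausdorff_measure d = measure_of UNIV (sets borel) (hausdorff_outer d)"

definition C1_manifold :: "'d::euclidean_space itself \<Rightarrow> 'p::euclidean_space set \<Rightarrow> bool" where
  "C1_manifold _ M \<longleftrightarrow>
     (\<forall>x\<in>M. \<exists>U (V :: 'd set) (\<phi> :: 'd \<Rightarrow> 'p) \<psi> (\<phi>' :: 'd \<Rightarrow> ('d \<Rightarrow>\<^sub>L 'p)).
        open U \<and> x \<in> U \<and> open V \<and> homeomorphism V (M \<inter> U) \<phi> \<psi> \<and>
        (\<forall>v\<in>V. (\<phi> has_derivative blinfun_apply (\<phi>' v)) (at v)) \<and>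
        continuous_on V \<phi>' \<and>
        (\<forall>v\<in>V. inj (blinfun_apply (\<phi>' v))))"

definition riesz_pot :: "real \<Rightarrow> nat \<Rightarrow> (nat \<Rightarrow> 'a::metric_space) \<Rightarrow> 'a \<Rightarrow> ennreal" where
  "riesz_pot s N x y = (\<Sum>j<N. if y = x j then top else ennreal (dist y (x j) powr (- s)))"

definition polar_config :: "real \<Rightarrow> 'a::metric_space set \<Rightarrow> nat \<Rightarrow> (nat \<Rightarrow> 'a) \<Rightarrow> ennreal" where
  "polar_config s A N x = (INF y\<in>A. riesz_pot s N x y)"

text \<open>N-point configurations in A (only the values at 0..N-1 matter).\<close>
definition configs :: "'a set \<Rightarrow> nat \<Rightarrow> (nat \<Rightarrow> 'a) set" where
  "configs A N = {x. \<forall>j<N. x j \<in> A}"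

definition polar_max :: "real \<Rightarrow> 'a::metric_space set \<Rightarrow> nat \<Rightarrow> ennreal" where
  "polar_max s A N = (SUP x\<in>configs A N. polar_config s A N x)"

definition asymp_optimal :: "real \<Rightarrow> 'a::metric_space set \<Rightarrow> (nat \<Rightarrow> nat \<Rightarrow> 'a) \<Rightarrow> bool" where
  "asymp_optimal s A \<omega> \<longleftrightarrow>
     (\<forall>N. \<omega> N \<in> configs A N) \<and>
     ((\<lambda>N. polar_config s A N (\<omega> N) / polar_max s A N) \<longlongrightarrow> 1) sequentially"

end

(* For the unit cube Q of R^d, subdividing Q shows that polar_max s Q N / N^(s/d) converges to its supremum
   sigma, and averaging the potential outside small balls around the points shows that sigma is finite.

   Now let A be a compact subset of a d-dimensional C^1 manifold with H_d-null relative boundary. Charts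
   whose derivative at one point is an isometry are bi-Lipschitz with constants close to 1 on small cubes.
   Images of finitely many disjoint cubes (the cells) fill A up to small H_d-measure, and the rest is covered by
   images of cubes of small total volume. If the cubes have sides c_i, then distributing points over them in
   proportion to c_i^d gives liminf polar_max s A N / N^(s/d) >= sigma (sum c_i^d)^(-s/d). Conversely, in any
   configuration some cell contains at most its share of the points, and on a slightly smaller cube the
   points of other cells contribute only O(N) = o(N^(s/d)); this gives the matching upper bound. The same
   estimate for a single cell shows that an asymptotically optimal configuration places at least the
   fraction c_i^d / H_d(A) of its points in it, and as these fractions add up to almost 1, the counting
   measures converge weakly to normalized H_d.

   That sums of c_i^d approximate H_d(A) uses that H_d is Lebesgue measure on R^d. One inequality follows
   from Vitali's covering theorem by balls, the other one from the isodiametric inequality, which is deduced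
   from the Brunn-Minkowski inequality for finite unions of boxes. *)
theory Submission
  imports Defs
begin

subsection \<open>Brunn--Minkowski for box families and the isodiametric inequality\<close>

text \<open>The two bounds ask different things of A. A lower bound must make the potential large at
  every point of A, so its pieces have to cover A completely: even a remainder of tiny measure, to
  which the relative boundary belongs, needs points of its own. An upper bound needs only one good
  point of A, so its cells may omit a small set. The remainder can therefore be treated with
  distorted constants, as it enters only through its small total volume.

  In the upper bound the configuration is arbitrary, so the number of points in a cell is not under
  control; hence the bound by \<sigma> has to hold for every n and not only in the limit.

  The definition of H_d admits arbitrary covering sets. To compare it with Lebesgue measure without
  losing a constant, one must know that no set has more volume than a ball of the same diameter;
  this is the role of the isodiametric inequality. Brunn-Minkowski is applied to a set and its
  reflection, two sets of equal volume, where the geometric-mean form has full strength.\<close>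

lemma measure_disjoint_Un:
  assumes "A \<in> fmeasurable M" "B \<in> fmeasurable M" "A \<inter> B = {}"
  shows "measure M (A \<union> B) = measure M A + measure M B"
  using assms by (intro measure_Union) (auto simp: fmeasurable_def)

lemma measure_split_hyperplane:
  fixes S :: "'a::euclidean_space set"
  assumes S: "open S" "bounded S" and k: "k \<in> Basis"
  shows "measure lborel S = measure lborel (S \<inter> {x. x \<bullet> k < c}) + measure lborel (S \<inter> {x. x \<bullet> k > c})"
proof -
  have o: "open {x::'a. x \<bullet> k < c}" "open {x::'a. x \<bullet> k > c}"
    by (auto intro!: open_Collect_less continuous_intros)
  have e: "emeasure lborel S < \<infinity>" by (rule emeasure_bounded_finite[OF S(2)])
  have fin: "S \<in> fmeasurable lborel"
    using S(1) e by (auto simp: fmeasurable_def)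
  have 1: "S \<inter> {x. x \<bullet> k < c} \<in> fmeasurable lborel" "S \<inter> {x. x \<bullet> k > c} \<in> fmeasurable lborel"
    by (rule fmeasurableI2[OF fin]; use S(1) o in \<open>auto\<close>)+
  have neg: "negligible {x::'a. x \<bullet> k = c}"
    using negligible_standard_hyperplane[OF k] by simp
  have z: "emeasure lborel {x::'a. x \<bullet> k = c} = 0"
  proof -
    have "closed {x::'a. x \<bullet> k = c}" by (intro closed_Collect_eq continuous_intros)
    then have "{x::'a. x \<bullet> k = c} \<in> sets lborel" by auto
    then show ?thesis
      using neg null_sets_completion_iff unfolding negligible_iff_null_sets by blast
  qed
  have "measure lborel S = measure lborel (S \<inter> {x. x \<bullet> k < c} \<union> S \<inter> {x. x \<bullet> k > c})"
  proof (rule measure_eq_AE)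
    have "{x::'a. x \<bullet> k = c} \<in> null_sets lborel"
      using z by (auto simp: null_sets_def)
    then have "AE x in lborel. x \<notin> {x::'a. x \<bullet> k = c}" by (rule AE_not_in)
    then show "AE x in lborel. x \<in> S \<longleftrightarrow> x \<in> S \<inter> {x. x \<bullet> k < c} \<union> S \<inter> {x. x \<bullet> k > c}"
      by eventually_elim auto
  qed (use S(1) o in auto)
  also have "\<dots> = measure lborel (S \<inter> {x. x \<bullet> k < c}) + measure lborel (S \<inter> {x. x \<bullet> k > c})"
    by (rule measure_disjoint_Un[OF 1]) auto
  finally show ?thesis .
qed

text \<open>Open boxes keep unions and sum sets open, hence measurable. They are required to be
  nonempty so that each has positive volume and a box lost in a cut lowers the cardinality.\<close>

definition boxfam :: "'a::euclidean_space set set \<Rightarrow> bool" where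
  "boxfam D \<longleftrightarrow> finite D \<and> (\<forall>K\<in>D. K \<noteq> {} \<and> (\<exists>a b. K = box a b)) \<and> disjoint D"

lemma boxfam_open: "boxfam D \<Longrightarrow> open (\<Union>D)"
  by (auto simp: boxfam_def intro!: open_Union)

lemma boxfam_bounded: "boxfam D \<Longrightarrow> bounded (\<Union>D)"
  unfolding boxfam_def by (metis bounded_Union bounded_box)

text \<open>Empty traces are dropped, so a half space that misses a box leaves strictly fewer boxes.
  The induction over the number of boxes rests on this decrease.\<close>

definition hcut :: "'a set \<Rightarrow> 'a set set \<Rightarrow> 'a set set" where
  "hcut H D = (\<lambda>K. K \<inter> H) ` D - {{}}"

lemma Union_hcut: "\<Union>(hcut H D) = \<Union>D \<inter> H"
  by (auto simp: hcut_def)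

lemma card_hcut: "finite D \<Longrightarrow> card (hcut H D) \<le> card D"
  unfolding hcut_def
  by (meson card_Diff1_le card_image_le finite_imageI le_trans)

lemma card_hcut_less:
  assumes "finite D" "K \<in> D" "K \<inter> H = {}" shows "card (hcut H D) < card D"
proof -
  have "hcut H D \<subseteq> (\<lambda>K. K \<inter> H) ` (D - {K})" using assms by (auto simp: hcut_def)
  then have "card (hcut H D) \<le> card (D - {K})"
    by (meson assms(1) card_image_le card_mono finite_Diff finite_imageI le_trans)
  also have "\<dots> < card D" using assms by (simp only: card_Diff1_less)
  finally show ?thesis .
qed

lemma box_Int_halfspace:
  assumes "k \<in> Basis"
  shows "\<exists>a' b'. box a b \<inter> {x::'a::euclidean_space. x \<bullet> k < c} = box a' b'"
        "\<exists>a' b'. box a b \<inter> {x::'a::euclidean_space. x \<bullet> k > c} = box a' b'"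
proof -
  have "box a b \<inter> {x::'a. x \<bullet> k < c} = box a (\<Sum>i\<in>Basis. (if i = k then min (b \<bullet> k) c else b \<bullet> i) *\<^sub>R i)"
    using assms by (auto simp: mem_box split: if_splits)
  then show "\<exists>a' b'. box a b \<inter> {x::'a. x \<bullet> k < c} = box a' b'" by blast
  have "box a b \<inter> {x::'a. x \<bullet> k > c} = box (\<Sum>i\<in>Basis. (if i = k then max (a \<bullet> k) c else a \<bullet> i) *\<^sub>R i) b"
    using assms by (auto simp: mem_box split: if_splits)
  then show "\<exists>a' b'. box a b \<inter> {x::'a. x \<bullet> k > c} = box a' b'" by blast
qed

lemma boxfam_hcut:
  assumes D: "boxfam D" and H: "\<And>a b. \<exists>a' b'. box a b \<inter> H = box a' b'"
  shows "boxfam (hcut H D)"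
proof -
  have "disjoint (hcut H D)"
    unfolding hcut_def
  proof (rule disjointI)
    fix A B assume "A \<in> (\<lambda>K. K \<inter> H) ` D - {{}}" "B \<in> (\<lambda>K. K \<inter> H) ` D - {{}}" "A \<noteq> B"
    then obtain K L where KL: "K \<in> D" "L \<in> D" "A = K \<inter> H" "B = L \<inter> H" "K \<noteq> L" by auto
    then have "K \<inter> L = {}" using D by (auto simp: boxfam_def disjoint_def)
    then show "A \<inter> B = {}" using KL by auto
  qed
  moreover have "K \<noteq> {} \<and> (\<exists>a b. K = box a b)" if "K \<in> hcut H D" for K
  proof -
    have "K \<in> (\<lambda>K. K \<inter> H) ` D" "K \<noteq> {}" using that by (auto simp: hcut_def)
    then obtain L where L: "L \<in> D" "K = L \<inter> H" "K \<noteq> {}" by blast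
    then show ?thesis using D H unfolding boxfam_def by metis
  qed
  ultimately show ?thesis using D by (auto simp: boxfam_def hcut_def)
qed

definition sumset :: "'a::real_normed_vector set \<Rightarrow> 'a set \<Rightarrow> 'a set" where
  "sumset S T = (\<Union>x\<in>S. \<Union>y\<in>T. {x + y})"

lemma sumset_commute: "sumset S T = sumset T S"
  unfolding sumset_def by (force simp: add.commute)

text \<open>The sum set contains the box whose sides are the sums of the sides, and the
  arithmetic-geometric mean inequality is applied to each pair of sides.\<close>

lemma sumset_base:
  fixes a b c d :: "'a::euclidean_space"
  assumes ne: "box a b \<noteq> {}" "box c d \<noteq> {}"
  shows "2 ^ DIM('a) * sqrt (measure lborel (box a b) * measure lborel (box c d))
     \<le> measure lborel (sumset (box a b) (box c d))"
proof -
  have ab: "\<And>i. i \<in> Basis \<Longrightarrow> a \<bullet> i < b \<bullet> i" and cd: "\<And>i. i \<in> Basis \<Longrightarrow> c \<bullet> i < d \<bullet> i"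
    using ne by (auto simp: box_ne_empty)
  have sub: "box (a + c) (b + d) \<subseteq> sumset (box a b) (box c d)"
  proof
    fix z assume z: "z \<in> box (a + c) (b + d)"
    \<comment> \<open>The point \<open>z\<close> is split at the same relative position
      \<open>t i\<close> in both boxes.\<close>
    define t where "t i = (z \<bullet> i - a \<bullet> i - c \<bullet> i) / (b \<bullet> i + d \<bullet> i - a \<bullet> i - c \<bullet> i)" for i
    have t: "0 < t i" "t i < 1" if "i \<in> Basis" for i
      using ab[OF that] cd[OF that] z that
      by (auto simp: t_def mem_box inner_add_left divide_simps)
    define x where "x = (\<Sum>i\<in>Basis. (a \<bullet> i + t i * (b \<bullet> i - a \<bullet> i)) *\<^sub>R i)"
    define y where "y = (\<Sum>i\<in>Basis. (c \<bullet> i + t i * (d \<bullet> i - c \<bullet> i)) *\<^sub>R i)"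
    have lin: "u < u + s * (v - u) \<and> u + s * (v - u) < v" if "u < v" "0 < s" "s < 1" for u v s :: real
    proof -
      have "0 < s * (v - u)" using that by simp
      moreover have "s * (v - u) < 1 * (v - u)" using that by (intro mult_strict_right_mono) auto
      ultimately show ?thesis by simp
    qed
    have "x \<in> box a b" "y \<in> box c d"
      using t ab cd lin by (auto simp: mem_box x_def y_def)
    moreover have "z = x + y"
    proof (rule euclidean_eqI)
      fix i :: 'a assume i: "i \<in> Basis"
      have "t i * (b \<bullet> i + d \<bullet> i - a \<bullet> i - c \<bullet> i) = z \<bullet> i - a \<bullet> i - c \<bullet> i"
        using ab[OF i] cd[OF i] by (simp add: t_def)
      then show "z \<bullet> i = (x + y) \<bullet> i"
        using i by (simp add: x_def y_def inner_add_left) (simp add: algebra_simps)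
    qed
    ultimately show "z \<in> sumset (box a b) (box c d)" by (auto simp: sumset_def)
  qed
  have "2 ^ DIM('a) * sqrt (measure lborel (box a b) * measure lborel (box c d))
     = (\<Prod>i\<in>Basis. 2 * sqrt ((b \<bullet> i - a \<bullet> i) * (d \<bullet> i - c \<bullet> i)))"
  proof -
    have p: "sqrt (\<Prod>i\<in>F. f i) = (\<Prod>i\<in>F. sqrt (f i))" if "finite F" for F :: "'a set" and f :: "'a \<Rightarrow> real"
      using that by induction (auto simp: real_sqrt_mult)
    show ?thesis
      using ab cd by (simp add: measure_lborel_box_eq less_imp_le prod.distrib[symmetric] p inner_diff_left
        flip: real_sqrt_mult) (simp add: prod.distrib)
  qed
  also have "\<dots> \<le> (\<Prod>i\<in>Basis. (b \<bullet> i + d \<bullet> i - a \<bullet> i - c \<bullet> i))"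
  proof (intro prod_mono conjI)
    fix i :: 'a assume i: "i \<in> Basis"
    have "sqrt ((b \<bullet> i - a \<bullet> i) * (d \<bullet> i - c \<bullet> i)) \<le> ((b \<bullet> i - a \<bullet> i) + (d \<bullet> i - c \<bullet> i)) / 2"
      using ab[OF i] cd[OF i] by (intro arith_geo_mean_sqrt) auto
    then show "2 * sqrt ((b \<bullet> i - a \<bullet> i) * (d \<bullet> i - c \<bullet> i)) \<le> b \<bullet> i + d \<bullet> i - a \<bullet> i - c \<bullet> i" by simp
    show "0 \<le> 2 * sqrt ((b \<bullet> i - a \<bullet> i) * (d \<bullet> i - c \<bullet> i))" using ab[OF i] cd[OF i] by simp
  qed
  also have "\<dots> = measure lborel (box (a + c) (b + d))"
    using ab cd by (simp add: measure_lborel_box_eq inner_add_left inner_diff_left add_mono less_imp_le algebra_simps)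
  also have "\<dots> \<le> measure lborel (sumset (box a b) (box c d))"
  proof (rule measure_mono_fmeasurable[OF sub])
    have "bounded (sumset (box a b) (box c d))" unfolding sumset_def by (intro bounded_sums bounded_box)
    moreover have "open (sumset (box a b) (box c d))" unfolding sumset_def by (intro open_sums) auto
    ultimately show "sumset (box a b) (box c d) \<in> fmeasurable lborel"
      using emeasure_bounded_finite by (auto simp: fmeasurable_def)
  qed auto
  finally show ?thesis .
qed

text \<open>The volume on one side of the hyperplane is a Lipschitz function of its position, the
  constant \<open>L\<close> being the cross-section of a bounding box; hence it takes every
  intermediate value.\<close>

lemma halfspace_measure_ivt:
  fixes S :: "'a::euclidean_space set"
  assumes S: "open S" "bounded S" and k: "k \<in> Basis" and l: "0 < l" "l < 1"
  shows "\<exists>c. measure lborel (S \<inter> {x. x \<bullet> k < c}) = l * measure lborel S"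
proof -
  obtain a where a: "S \<subseteq> cbox (-a) a" using bounded_subset_cbox_symmetric[OF S(2)] by blast
  define f where "f c = measure lborel (S \<inter> {x. x \<bullet> k < c})" for c
  have o: "open {x::'a. x \<bullet> k < c}" for c
    by (auto intro!: open_Collect_less continuous_intros)
  have fm: "S \<inter> {x. x \<bullet> k < c} \<in> fmeasurable lborel" for c
    using emeasure_bounded_finite[of "S \<inter> {x. x \<bullet> k < c}"] S o by (auto simp: fmeasurable_def bounded_Int)
  define L where "L = (\<Prod>i\<in>Basis-{k}. \<bar>2 * (a \<bullet> i)\<bar>)"
  have L0: "L \<ge> 0" unfolding L_def by (intro prod_nonneg) auto
  have mono: "f c \<le> f c'" if "c \<le> c'" for c c'
    unfolding f_def by (rule measure_mono_fmeasurable) (use that fm S o in auto)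
  have lip: "f c' \<le> f c + L * (c' - c)" if "c \<le> c'" for c c'
  proof -
    define u where "u = (\<Sum>i\<in>Basis. (if i = k then c else - (a \<bullet> i)) *\<^sub>R i)"
    define v where "v = (\<Sum>i\<in>Basis. (if i = k then c' else a \<bullet> i) *\<^sub>R i)"
    have sub: "S \<inter> {x. x \<bullet> k < c'} \<subseteq> (S \<inter> {x. x \<bullet> k < c}) \<union> cbox u v"
    proof
      fix x assume x: "x \<in> S \<inter> {x. x \<bullet> k < c'}"
      then have "\<forall>i\<in>Basis. - (a \<bullet> i) \<le> x \<bullet> i \<and> x \<bullet> i \<le> a \<bullet> i" using a by (auto simp: mem_box)
      then show "x \<in> (S \<inter> {x. x \<bullet> k < c}) \<union> cbox u v"
        using x by (auto simp: u_def v_def mem_box)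
    qed
    have "f c' \<le> measure lborel ((S \<inter> {x. x \<bullet> k < c}) \<union> cbox u v)"
      unfolding f_def by (rule measure_mono_fmeasurable[OF sub]) (use fm fmeasurableD[OF fm] in \<open>auto intro!: fmeasurable.Un\<close>)
    also have "\<dots> \<le> f c + measure lborel (cbox u v)"
      unfolding f_def by (rule measure_Un_le) (use fmeasurableD[OF fm] in auto)
    also have "measure lborel (cbox u v) \<le> (\<Prod>i\<in>Basis. \<bar>(v - u) \<bullet> i\<bar>)"
      by (auto simp: measure_lborel_cbox_eq intro!: prod_nonneg prod_mono) (simp add: inner_diff_left)
    also have "\<dots> = (c' - c) * (\<Prod>i\<in>Basis-{k}. \<bar>(v - u) \<bullet> i\<bar>)"
      using k that by (subst prod.remove[of _ k]) (auto simp: u_def v_def inner_diff_left)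
    also have "(\<Prod>i\<in>Basis-{k}. \<bar>(v - u) \<bullet> i\<bar>) = L"
      unfolding L_def by (rule prod.cong) (auto simp: u_def v_def inner_diff_left)
    finally show ?thesis by (simp add: algebra_simps)
  qed
  have "L-lipschitz_on UNIV f"
  proof (rule lipschitz_onI)
    fix x y :: real
    show "dist (f x) (f y) \<le> L * dist x y"
      using mono[of x y] mono[of y x] lip[of x y] lip[of y x]
      by (cases "x \<le> y") (auto simp: dist_real_def abs_if algebra_simps)
  qed (use L0 in auto)
  then have "continuous_on UNIV f" by (rule lipschitz_on_continuous_on)
  then have cont: "continuous_on {- a \<bullet> k..a \<bullet> k + 1} f" by (rule continuous_on_subset) auto
  have z: "f (- a \<bullet> k) = 0"
  proof -
    have "S \<inter> {x. x \<bullet> k < - a \<bullet> k} = {}" using a k by (force simp: mem_box)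
    then show ?thesis by (simp add: f_def)
  qed
  have w: "f (a \<bullet> k + 1) = measure lborel S"
  proof -
    have "S \<inter> {x. x \<bullet> k < a \<bullet> k + 1} = S" using a k by (force simp: mem_box)
    then show ?thesis by (simp add: f_def)
  qed
  show ?thesis
  proof (cases "S = {}")
    case True then show ?thesis by simp
  next
    case False
    then have "- a \<bullet> k \<le> a \<bullet> k" using a k by (force simp: mem_box)
    moreover have "l * measure lborel S \<le> measure lborel S"
      using l by (simp add: mult_left_le_one_le)
    ultimately obtain c where "f c = l * measure lborel S"
      using IVT'[of f "- a \<bullet> k" "l * measure lborel S" "a \<bullet> k + 1", OF _ _ _ cont] z w l by auto
    then show ?thesis unfolding f_def by blast
  qed
qed

lemma boxfam_measure_pos:
  assumes "boxfam D" "K \<in> D" "K \<subseteq> S" "S \<in> fmeasurable lborel"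
  shows "0 < measure lborel S"
proof -
  obtain a b where K: "K = box a b" "box a b \<noteq> {}" using assms unfolding boxfam_def by metis
  then have "0 < measure lborel K"
    by (auto simp: measure_lborel_box_eq box_ne_empty less_imp_le inner_diff_left intro!: prod_pos)
  also have "\<dots> \<le> measure lborel S"
    by (rule measure_mono_fmeasurable) (use assms K in auto)
  finally show ?thesis .
qed

lemma fmeasurable_open_bounded:
  fixes S :: "'a::euclidean_space set"
  shows "open S \<Longrightarrow> bounded S \<Longrightarrow> S \<in> fmeasurable lborel"
  using emeasure_bounded_finite by (auto simp: fmeasurable_def)

text \<open>The induction step of Hadwiger and Ohmann: a hyperplane separates two boxes of \<open>D\<close>, and a
  parallel one cuts \<open>E\<close> in the same volume ratio; the sum sets of corresponding halves are disjoint.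
  For the multiplicative form of the inequality the two halves simply add up.\<close>

lemma sumset_step:
  fixes D E :: "'a::euclidean_space set set"
  assumes IH: "\<And>D' E' :: 'a set set. boxfam D' \<Longrightarrow> boxfam E' \<Longrightarrow> card D' + card E' < card D + card E \<Longrightarrow>
      2 ^ DIM('a) * sqrt (measure lborel (\<Union>D') * measure lborel (\<Union>E')) \<le> measure lborel (sumset (\<Union>D') (\<Union>E'))"
    and D: "boxfam D" and E: "boxfam E" and cD: "card D \<ge> 2"
  shows "2 ^ DIM('a) * sqrt (measure lborel (\<Union>D) * measure lborel (\<Union>E)) \<le> measure lborel (sumset (\<Union>D) (\<Union>E))"
proof (cases "measure lborel (\<Union>E) = 0")
  case True then show ?thesis by simp
next
  case E0: False
  obtain K L where KL: "K \<in> D" "L \<in> D" "K \<noteq> L"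
    using cD by (metis One_nat_def Suc_1 card_le_Suc0_iff_eq D boxfam_def not_less_eq_eq)
  obtain a b a' b' where ab: "K = box a b" "L = box a' b'" "box a b \<noteq> {}" "box a' b' \<noteq> {}"
    using KL D unfolding boxfam_def by metis
  have "box a b \<inter> box a' b' = {}" using KL D ab by (auto simp: boxfam_def disjoint_def)
  then obtain k where k: "k \<in> Basis" "b \<bullet> k \<le> a' \<bullet> k \<or> b' \<bullet> k \<le> a \<bullet> k"
    using ab(3,4) unfolding disjoint_interval box_ne_empty by (smt (verit))
  have "\<exists>c. \<exists>K\<in>D. \<exists>L\<in>D. K \<subseteq> {x. x \<bullet> k < c} \<and> L \<subseteq> {x. x \<bullet> k > c}"
    using k(2)
  proof
    assume "b \<bullet> k \<le> a' \<bullet> k"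
    then have "K \<subseteq> {x. x \<bullet> k < b \<bullet> k}" "L \<subseteq> {x. x \<bullet> k > b \<bullet> k}"
      using ab k(1) by (force simp: mem_box)+
    then show ?thesis using KL by blast
  next
    assume "b' \<bullet> k \<le> a \<bullet> k"
    then have "L \<subseteq> {x. x \<bullet> k < b' \<bullet> k}" "K \<subseteq> {x. x \<bullet> k > b' \<bullet> k}"
      using ab k(1) by (force simp: mem_box)+
    then show ?thesis using KL by blast
  qed
  then obtain c K L where c: "K \<in> D" "L \<in> D" "K \<subseteq> {x. x \<bullet> k < c}" "L \<subseteq> {x. x \<bullet> k > c}" by blast
  let ?m = "measure (lborel :: 'a measure)"
  let ?lt = "\<lambda>c. {x::'a. x \<bullet> k < c}" let ?gt = "\<lambda>c. {x::'a. x \<bullet> k > c}"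
  have o: "open (?lt c)" "open (?gt c)" for c
    by (auto intro!: open_Collect_less continuous_intros)
  have oD: "open (\<Union>D)" "bounded (\<Union>D)" and oE: "open (\<Union>E)" "bounded (\<Union>E)"
    using D E boxfam_open boxfam_bounded by auto
  have fm: "\<Union>D \<inter> ?lt c \<in> fmeasurable lborel" "\<Union>D \<inter> ?gt c \<in> fmeasurable lborel" for c
    using oD o by (auto intro!: fmeasurable_open_bounded bounded_Int)
  have sub: "K \<subseteq> \<Union>D \<inter> ?lt c" "L \<subseteq> \<Union>D \<inter> ?gt c" using c by (blast, blast)
  have pos1: "0 < ?m (\<Union>D \<inter> ?lt c)" by (rule boxfam_measure_pos[OF D c(1) sub(1) fm(1)])
  have pos2: "0 < ?m (\<Union>D \<inter> ?gt c)" by (rule boxfam_measure_pos[OF D c(2) sub(2) fm(2)])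
  note pos = pos1 pos2
  have spD: "?m (\<Union>D) = ?m (\<Union>D \<inter> ?lt c) + ?m (\<Union>D \<inter> ?gt c)"
    by (rule measure_split_hyperplane[OF oD k(1)])
  define l where "l = ?m (\<Union>D \<inter> ?lt c) / ?m (\<Union>D)"
  have l: "0 < l" "l < 1" using pos spD by (auto simp: l_def divide_simps)
  have lD: "?m (\<Union>D \<inter> ?lt c) = l * ?m (\<Union>D)" "?m (\<Union>D \<inter> ?gt c) = (1 - l) * ?m (\<Union>D)"
    using pos spD by (auto simp: l_def field_simps)
  obtain e where e: "?m (\<Union>E \<inter> ?lt e) = l * ?m (\<Union>E)"
    using halfspace_measure_ivt[OF oE k(1) l] by blast
  have spE: "?m (\<Union>E) = ?m (\<Union>E \<inter> ?lt e) + ?m (\<Union>E \<inter> ?gt e)"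
    by (rule measure_split_hyperplane[OF oE k(1)])
  then have e': "?m (\<Union>E \<inter> ?gt e) = (1 - l) * ?m (\<Union>E)" using e by (simp add: algebra_simps)
  have fin: "finite D" "finite E" using D E by (auto simp: boxfam_def)
  have bf: "boxfam (hcut (?lt c) D)" "boxfam (hcut (?gt c) D)" "boxfam (hcut (?lt e) E)" "boxfam (hcut (?gt e) E)"
    using D E box_Int_halfspace[OF k(1)] by (auto intro!: boxfam_hcut)
  \<comment> \<open>Each half of \<open>D\<close> misses one of the two separated boxes and so has
    fewer members, while a cut of \<open>E\<close> has at most as many as \<open>E\<close>. The
    total number of boxes therefore drops in both halves.\<close>
  have neK: "K \<inter> ?gt c = {}" "L \<inter> ?lt c = {}" using c by auto
  have 1: "2 ^ DIM('a) * sqrt (?m (\<Union>D \<inter> ?lt c) * ?m (\<Union>E \<inter> ?lt e)) \<le> ?m (sumset (\<Union>D \<inter> ?lt c) (\<Union>E \<inter> ?lt e))"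
    using IH[OF bf(1,3)] card_hcut_less[OF fin(1) c(2) neK(2)] card_hcut[OF fin(2), of "?lt e"]
    by (simp add: Union_hcut)
  have 2: "2 ^ DIM('a) * sqrt (?m (\<Union>D \<inter> ?gt c) * ?m (\<Union>E \<inter> ?gt e)) \<le> ?m (sumset (\<Union>D \<inter> ?gt c) (\<Union>E \<inter> ?gt e))"
    using IH[OF bf(2,4)] card_hcut_less[OF fin(1) c(1) neK(1)] card_hcut[OF fin(2), of "?gt e"]
    by (simp add: Union_hcut)
  have ss: "sumset S T \<in> fmeasurable lborel" if "open S" "bounded S" "open T" "bounded T" for S T :: "'a set"
    using that by (auto simp: sumset_def intro!: fmeasurable_open_bounded open_sums bounded_sums)
  have fs: "sumset (\<Union>D \<inter> ?lt c) (\<Union>E \<inter> ?lt e) \<in> fmeasurable lborel"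
     "sumset (\<Union>D \<inter> ?gt c) (\<Union>E \<inter> ?gt e) \<in> fmeasurable lborel" "sumset (\<Union>D) (\<Union>E) \<in> fmeasurable lborel"
    using oD oE o by (auto intro!: ss bounded_Int)
  have s1: "sqrt (?m (\<Union>D \<inter> ?lt c) * ?m (\<Union>E \<inter> ?lt e)) = l * sqrt (?m (\<Union>D) * ?m (\<Union>E))"
  proof -
    have "?m (\<Union>D \<inter> ?lt c) * ?m (\<Union>E \<inter> ?lt e) = l\<^sup>2 * (?m (\<Union>D) * ?m (\<Union>E))"
      by (simp add: lD e power2_eq_square)
    then show ?thesis using l by (simp add: real_sqrt_mult)
  qed
  have s2: "sqrt (?m (\<Union>D \<inter> ?gt c) * ?m (\<Union>E \<inter> ?gt e)) = (1 - l) * sqrt (?m (\<Union>D) * ?m (\<Union>E))"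
  proof -
    have "?m (\<Union>D \<inter> ?gt c) * ?m (\<Union>E \<inter> ?gt e) = (1-l)\<^sup>2 * (?m (\<Union>D) * ?m (\<Union>E))"
      by (simp add: lD e' power2_eq_square)
    then show ?thesis using l by (simp add: real_sqrt_mult)
  qed
  have "2 ^ DIM('a) * sqrt (?m (\<Union>D) * ?m (\<Union>E)) \<le>
      ?m (sumset (\<Union>D \<inter> ?lt c) (\<Union>E \<inter> ?lt e)) + ?m (sumset (\<Union>D \<inter> ?gt c) (\<Union>E \<inter> ?gt e))"
    using 1 2 unfolding s1 s2 by (simp add: algebra_simps)
  also have "\<dots> = ?m (sumset (\<Union>D \<inter> ?lt c) (\<Union>E \<inter> ?lt e) \<union> sumset (\<Union>D \<inter> ?gt c) (\<Union>E \<inter> ?gt e))"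
  proof (rule measure_disjoint_Un[OF fs(1,2), symmetric])
    have "sumset (\<Union>D \<inter> ?lt c) (\<Union>E \<inter> ?lt e) \<subseteq> ?lt (c + e)" "sumset (\<Union>D \<inter> ?gt c) (\<Union>E \<inter> ?gt e) \<subseteq> ?gt (c + e)"
      by (auto simp: sumset_def inner_add_left)
    then show "sumset (\<Union>D \<inter> ?lt c) (\<Union>E \<inter> ?lt e) \<inter> sumset (\<Union>D \<inter> ?gt c) (\<Union>E \<inter> ?gt e) = {}"
      by fastforce
  qed
  also have "\<dots> \<le> ?m (sumset (\<Union>D) (\<Union>E))"
  proof (rule measure_mono_fmeasurable[OF _ _ fs(3)])
    show "sumset (\<Union>D \<inter> ?lt c) (\<Union>E \<inter> ?lt e) \<union> sumset (\<Union>D \<inter> ?gt c) (\<Union>E \<inter> ?gt e) \<in> sets lborel"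
      using fs(1,2)[THEN fmeasurableD] by blast
  qed (auto simp: sumset_def)
  finally show ?thesis .
qed

text \<open>Induction over the total number of boxes. The statement is symmetric, so whichever
  family has at least two boxes can play the part of \<open>D\<close> in \<open>sumset_step\<close>;
  two single boxes are the base case.\<close>

lemma brunn_minkowski_boxfam:
  fixes D E :: "'a::euclidean_space set set"
  assumes "boxfam D" "boxfam E"
  shows "2 ^ DIM('a) * sqrt (measure lborel (\<Union>D) * measure lborel (\<Union>E)) \<le> measure lborel (sumset (\<Union>D) (\<Union>E))"
  using assms
proof (induction "card D + card E" arbitrary: D E rule: less_induct)
  case less
  have fin: "finite D" "finite E" using less.prems by (auto simp: boxfam_def)
  consider "card D \<ge> 2" | "card E \<ge> 2" | "card D = 0 \<or> card E = 0" | "card D = 1" "card E = 1" by linarith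
  then show ?case
  proof cases
    case 1
    then show ?thesis using sumset_step less by blast
  next
    case 2
    have "2 ^ DIM('a) * sqrt (measure lborel (\<Union>E) * measure lborel (\<Union>D)) \<le> measure lborel (sumset (\<Union>E) (\<Union>D))"
    proof (rule sumset_step[OF _ less.prems(2,1) 2])
      fix D' E' :: "'a set set" assume "boxfam D'" "boxfam E'" "card D' + card E' < card E + card D"
      then show "2 ^ DIM('a) * sqrt (measure lborel (\<Union>D') * measure lborel (\<Union>E')) \<le> measure lborel (sumset (\<Union>D') (\<Union>E'))"
        by (intro less.hyps) auto
    qed
    then show ?thesis by (simp add: mult.commute sumset_commute)
  next
    case 3 then show ?thesis using fin by auto
  next
    case 4
    then obtain K L where "D = {K}" "E = {L}" by (meson card_1_singletonE)
    then show ?thesis using less.prems sumset_base unfolding boxfam_def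
      by (metis cSup_singleton singletonI)
  qed
qed

lemma measure_Union_boxfam:
  assumes "boxfam D" shows "measure lborel (\<Union>D) = (\<Sum>K\<in>D. measure lborel K)"
  using assms unfolding boxfam_def
  by (intro measure_Union') (auto simp: fmeasurable_def emeasure_lborel_box_eq)

lemma unit_ball_vol_eq: "unit_ball_vol = Ball_Volume.unit_ball_vol"
  by (rule ext) (simp add: unit_ball_vol_def Ball_Volume.unit_ball_vol_def)

text \<open>Reflection preserves the volume, so the geometric mean is the volume of the union
  itself. The sum with the reflection is a set of differences, which lies in the ball of radius
  \<open>d\<close>; the factor \<open>2 ^ DIM('a)\<close> halves this radius.\<close>

lemma isodiametric_boxfam:
  fixes D :: "'a::euclidean_space set set"
  assumes D: "boxfam D" and d: "\<And>x y. x \<in> \<Union>D \<Longrightarrow> y \<in> \<Union>D \<Longrightarrow> dist x y \<le> d" and d0: "d \<ge> 0"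
  shows "measure lborel (\<Union>D) \<le> unit_ball_vol DIM('a) * (d / 2) ^ DIM('a)"
proof -
  define E where "E = (\<lambda>K. uminus ` K) ` D"
  have im: "uminus ` box a b = box (- b) (- a)" for a b :: 'a
    by (force simp: mem_box image_iff intro!: bexI[of _ "- _"])
  have inj: "inj_on (\<lambda>K :: 'a set. uminus ` K) D"
    by (rule inj_onI) (simp add: inj_image_eq_iff)
  have "disjoint E"
    unfolding E_def
  proof (rule disjointI)
    fix A B assume "A \<in> (\<lambda>K. uminus ` K) ` D" "B \<in> (\<lambda>K. uminus ` K) ` D" "A \<noteq> B"
    then obtain K L where KL: "K \<in> D" "L \<in> D" "A = uminus ` K" "B = uminus ` L" "K \<noteq> L" by auto
    then have "K \<inter> L = {}" using D by (auto simp: boxfam_def disjoint_def)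
    then show "A \<inter> B = {}" using KL by auto
  qed
  moreover have "K \<noteq> {} \<and> (\<exists>a b. K = box a b)" if K: "K \<in> E" for K
  proof -
    obtain L where "L \<in> D" "K = uminus ` L" using K by (auto simp: E_def)
    moreover obtain a b where "L = box a b" "L \<noteq> {}" using D \<open>L \<in> D\<close> unfolding boxfam_def by metis
    ultimately show ?thesis using im by blast
  qed
  ultimately have E: "boxfam E" using D by (auto simp: boxfam_def E_def)
  have "measure lborel (\<Union>E) = (\<Sum>K\<in>D. measure lborel (uminus ` K))"
    unfolding measure_Union_boxfam[OF E] unfolding E_def using inj by (simp add: sum.reindex)
  also have "\<dots> = (\<Sum>K\<in>D. measure lborel K)"
  proof (rule sum.cong)
    fix K assume "K \<in> D"
    then obtain a b where "K = box a b" "K \<noteq> {}" using D unfolding boxfam_def by metis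
    then show "measure lborel (uminus ` K) = measure lborel K"
      by (simp add: im measure_lborel_box_eq algebra_simps)
  qed simp
  finally have mE: "measure lborel (\<Union>E) = measure lborel (\<Union>D)" by (simp add: measure_Union_boxfam[OF D])
  have "2 ^ DIM('a) * measure lborel (\<Union>D) = 2 ^ DIM('a) * sqrt (measure lborel (\<Union>D) * measure lborel (\<Union>E))"
    by (simp add: mE)
  also have "\<dots> \<le> measure lborel (sumset (\<Union>D) (\<Union>E))" by (rule brunn_minkowski_boxfam[OF D E])
  also have "\<dots> \<le> measure lborel (cball (0::'a) d)"
  proof (rule measure_mono_fmeasurable)
    show "cball (0::'a) d \<in> fmeasurable lborel"
      using emeasure_bounded_finite[of "cball (0::'a) d"] by (auto simp: fmeasurable_def)
    show "sumset (\<Union>D) (\<Union>E) \<subseteq> cball 0 d"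
    proof
      fix z assume "z \<in> sumset (\<Union>D) (\<Union>E)"
      then obtain x y where "x \<in> \<Union>D" "y \<in> \<Union>D" "z = x - y" by (auto simp: sumset_def E_def)
      then show "z \<in> cball 0 d" using d by (simp add: dist_norm)
    qed
    show "sumset (\<Union>D) (\<Union>E) \<in> sets lborel"
      using open_sums[of "\<Union>D" "\<Union>E"] boxfam_open[OF D] by (simp add: sumset_def)
  qed
  also have "\<dots> = unit_ball_vol DIM('a) * d ^ DIM('a)"
    by (simp add: content_cball d0 unit_ball_vol_eq)
  finally show ?thesis by (simp add: field_simps)
qed

text \<open>A pair \<open>(c, l)\<close> stands for the cube with lower corner \<open>c\<close> and side \<open>l\<close>.\<close>

definition ocube :: "'a::euclidean_space \<times> real \<Rightarrow> 'a set" where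
  "ocube p = box (fst p) (fst p + snd p *\<^sub>R One)"

definition ccube :: "'a::euclidean_space \<times> real \<Rightarrow> 'a set" where
  "ccube p = cbox (fst p) (fst p + snd p *\<^sub>R One)"

section \<open>Cubes, and covers of bounded sets by nonoverlapping cubes\<close>

lemma ocube_subset_ccube: "ocube p \<subseteq> ccube p"
  unfolding ocube_def ccube_def by (rule box_subset_cbox)

lemma open_ocube [simp]: "open (ocube p)"
  by (simp add: ocube_def open_box)

lemma compact_ccube [simp]: "compact (ccube p)"
  by (simp add: ccube_def compact_cbox)

lemma cube_borel [measurable, simp]: "ocube p \<in> sets borel" "ccube p \<in> sets borel"
  by (simp_all add: ocube_def ccube_def)

lemma ccube_image: "l \<ge> 0 \<Longrightarrow> ccube (c, l) = (\<lambda>u. c + l *\<^sub>R u) ` cbox 0 One"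
  unfolding ccube_def
  by (auto simp: cbox_translation[symmetric] image_image[symmetric, of "\<lambda>u. c + u" "\<lambda>u. l *\<^sub>R u"] image_smult_cbox box_ne_empty)

lemma emeasure_cube:
  fixes p :: "'a::euclidean_space \<times> real"
  assumes "snd p \<ge> 0"
  shows "emeasure lborel (ocube p) = ennreal (snd p ^ DIM('a))"
    "emeasure lborel (ccube p) = ennreal (snd p ^ DIM('a))"
  using assms by (simp_all add: ocube_def ccube_def emeasure_lborel_box_eq emeasure_lborel_cbox_eq inner_add_left)

lemma ccube_nonempty: "snd p > 0 \<Longrightarrow> ccube p \<noteq> {}"
  by (simp add: ccube_def box_ne_empty inner_add_left)

lemma ocube_nonempty: "snd p > 0 \<Longrightarrow> ocube p \<noteq> {}"
  by (simp add: ocube_def box_ne_empty inner_add_left)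

lemma inj_ccube:
  fixes p p' :: "'a::euclidean_space \<times> real"
  assumes "snd p > 0" "snd p' > 0" "ccube p = ccube p'" shows "p = p'"
proof -
  have "fst p = fst p'" "fst p + snd p *\<^sub>R (One::'a) = fst p' + snd p' *\<^sub>R One"
    using assms(3) ccube_nonempty[OF assms(1)] unfolding ccube_def eq_cbox by auto
  then have "snd p *\<^sub>R (One::'a) = snd p' *\<^sub>R One" by simp
  moreover have "(One::'a) \<noteq> 0" by (metis One_non_0)
  ultimately show ?thesis using \<open>fst p = fst p'\<close> by (simp add: prod_eq_iff)
qed

text \<open>Repeated halving of a large cube, stopped as soon as a subcube is small compared with
  \<open>\<rho>\<close> at one of its points in \<open>S\<close>. Suitable choices of
  \<open>\<rho>\<close> force the cubes into an open set or make them small.\<close>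

lemma cube_partition_gauge:
  fixes S :: "'a::euclidean_space set" and \<rho> :: "'a \<Rightarrow> real"
  assumes S: "bounded S" and \<rho>: "\<And>x. x \<in> S \<Longrightarrow> \<rho> x > 0"
  shows "\<exists>\<C> :: ('a \<times> real) set. countable \<C> \<and> (\<forall>p\<in>\<C>. snd p > 0 \<and> (\<exists>x\<in>S. ccube p \<subseteq> ball x (\<rho> x))) \<and>
     disjoint_family_on ocube \<C> \<and> S \<subseteq> (\<Union>p\<in>\<C>. ccube p)"
proof -
  obtain b where b: "S \<subseteq> ball 0 b" "b > 0" using bounded_subset_ballD[OF S, of 0] by blast
  \<comment> \<open>The covering lemma only halves the box it starts from. A cube as starting box
    makes all sides of a member equal.\<close>
  let ?u = "(- b) *\<^sub>R One :: 'a" and ?v = "b *\<^sub>R One :: 'a"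
  have Sb: "S \<subseteq> cbox ?u ?v"
  proof
    fix x assume "x \<in> S"
    then have "norm x \<le> b" using b by auto
    then have "\<bar>x \<bullet> i\<bar> \<le> b" if "i \<in> Basis" for i using Basis_le_norm[OF that, of x] by linarith
    then show "x \<in> cbox ?u ?v" by (auto simp: mem_box abs_le_iff) (smt (verit))
  qed
  have ne: "box ?u ?v \<noteq> {}" using b by (simp add: box_ne_empty)
  \<comment> \<open>A gauge needs a ball at every point. The radius 1 outside \<open>S\<close> is a
    dummy, since the tags lie in \<open>S\<close>.\<close>
  define g where "g x = ball x (if x \<in> S then \<rho> x else 1)" for x
  have g: "gauge g" using \<rho> by (auto simp: gauge_def g_def)
  obtain \<D> where \<D>: "countable \<D>"
      "\<And>K. K \<in> \<D> \<Longrightarrow> interior K \<noteq> {} \<and> (\<exists>c d. K = cbox c d)"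
      "pairwise (\<lambda>A B. interior A \<inter> interior B = {}) \<D>"
      "\<And>K. K \<in> \<D> \<Longrightarrow> \<exists>x \<in> S \<inter> K. K \<subseteq> g x"
      "\<And>u v. cbox u v \<in> \<D> \<Longrightarrow> \<exists>n. \<forall>i \<in> Basis. v \<bullet> i - u \<bullet> i = (?v \<bullet> i - ?u \<bullet> i) / 2^n"
      "S \<subseteq> \<Union>\<D>"
    using covering_lemma[OF Sb ne g] by metis
  define \<C> where "\<C> = {p. snd p > 0 \<and> ccube p \<in> \<D>}"
  have inj: "inj_on ccube \<C>" 
  proof (rule inj_onI)
    fix p p' assume "p \<in> \<C>" "p' \<in> \<C>" "ccube p = ccube p'"
    then show "p = p'" by (intro inj_ccube) (simp_all add: \<C>_def)
  qed
  have "countable \<C>"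
  proof (rule countable_image_inj_on[OF _ inj])
    show "countable (ccube ` \<C>)" by (rule countable_subset[OF _ \<D>(1)]) (auto simp: \<C>_def)
  qed
  moreover have "snd p > 0 \<and> (\<exists>x\<in>S. ccube p \<subseteq> ball x (\<rho> x))" if "p \<in> \<C>" for p
    using that \<D>(4)[of "ccube p"] by (auto simp: \<C>_def g_def split: if_splits)
  moreover have "disjoint_family_on ocube \<C>"
    unfolding disjoint_family_on_def
  proof (intro ballI impI)
    fix p p' assume 1: "p \<in> \<C>" "p' \<in> \<C>" "p \<noteq> p'"
    then have "ccube p \<noteq> ccube p'" using inj by (meson inj_onD)
    moreover have "ccube p \<in> \<D>" "ccube p' \<in> \<D>" using 1 by (simp_all add: \<C>_def)
    ultimately have "interior (ccube p) \<inter> interior (ccube p') = {}" using \<D>(3) unfolding pairwise_def by blast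
    then show "ocube p \<inter> ocube p' = {}" by (simp add: interior_cbox ocube_def ccube_def)
  qed
  moreover have "S \<subseteq> (\<Union>p\<in>\<C>. ccube p)"
  proof
    fix x assume "x \<in> S"
    then obtain K where K: "K \<in> \<D>" "x \<in> K" using \<D>(6) by blast
    then obtain c d where cd: "K = cbox c d" using \<D>(2) by blast
    then obtain n where n: "\<And>i. i \<in> Basis \<Longrightarrow> d \<bullet> i - c \<bullet> i = 2 * b / 2 ^ n" using \<D>(5)[of c d] K by auto
    have "d = c + (2 * b / 2 ^ n) *\<^sub>R One"
    proof (rule euclidean_eqI)
      fix i :: 'a assume "i \<in> Basis"
      then show "d \<bullet> i = (c + (2 * b / 2 ^ n) *\<^sub>R One) \<bullet> i" using n[of i] by (simp add: inner_add_left)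
    qed
    then have "K = ccube (c, 2 * b / 2 ^ n)" by (simp add: ccube_def cd)
    then have "(c, 2 * b / 2 ^ n) \<in> \<C>" "x \<in> ccube (c, 2 * b / 2 ^ n)" using K b by (auto simp: \<C>_def)
    then show "x \<in> (\<Union>p\<in>\<C>. ccube p)" by blast
  qed
  ultimately show ?thesis by (intro exI[of _ \<C>]) auto
qed

text \<open>Cover by small disjoint cubes and apply Brunn--Minkowski to their union \<open>D\<close> and \<open>- D\<close>:
  the sum set lies in a ball whose radius is the diameter.\<close>

lemma isodiametric:
  fixes S :: "'a::euclidean_space set"
  assumes S: "compact S"
  shows "measure lborel S \<le> unit_ball_vol DIM('a) * (diameter S / 2) ^ DIM('a)"
proof -
  have bS: "bounded S" using S compact_imp_bounded by blast
  \<comment> \<open>Cubes within distance \<open>e\<close> of \<open>S\<close> raise the diameter by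
    at most \<open>2 * e\<close>; at the end \<open>e\<close> tends to 0.\<close>
  have main: "measure lborel S \<le> unit_ball_vol DIM('a) * ((diameter S + 2 * e) / 2) ^ DIM('a)" if e: "e > 0" for e
  proof -
    define B where "B = unit_ball_vol DIM('a) * ((diameter S + 2 * e) / 2) ^ DIM('a)"
    obtain \<C> :: "('a \<times> real) set" where \<C>': "countable \<C> \<and> (\<forall>p\<in>\<C>. snd p > 0 \<and> (\<exists>x\<in>S. ccube p \<subseteq> ball x e)) \<and>
       disjoint_family_on ocube \<C> \<and> S \<subseteq> (\<Union>p\<in>\<C>. ccube p)"
      by (rule exE[OF cube_partition_gauge[OF bS, of "\<lambda>_. e", OF e]])
    then have \<C>: "countable \<C>" "\<And>p. p \<in> \<C> \<Longrightarrow> snd p > 0 \<and> (\<exists>x\<in>S. ccube p \<subseteq> ball x e)"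
       "disjoint_family_on ocube \<C>" "S \<subseteq> (\<Union>p\<in>\<C>. ccube p)"
      by simp_all
    have fin: "measure lborel (\<Union>p\<in>F. ccube p) \<le> B" if F: "finite F" "F \<subseteq> \<C>" for F
    proof -
      have dj: "disjoint_family_on ocube F" using \<C>(3) F(2) by (rule disjoint_family_on_mono[rotated])
      have emf: "emeasure lborel (ocube p) \<noteq> \<infinity>" for p :: "'a \<times> real"
        by (simp add: ocube_def emeasure_lborel_box_eq)
      have bf: "boxfam (ocube ` F)"
        unfolding boxfam_def
      proof (intro conjI ballI)
        show "disjoint (ocube ` F)" by (rule disjoint_family_on_disjoint_image[OF dj])
        show "K \<noteq> {}" if "K \<in> ocube ` F" for K using that F(2) \<C>(2) ocube_nonempty by blast
        show "\<exists>a b. K = box a b" if "K \<in> ocube ` F" for K using that by (auto simp: ocube_def)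
      qed (use F in simp)
      have "measure lborel (\<Union>p\<in>F. ccube p) \<le> (\<Sum>p\<in>F. measure lborel (ccube p))"
        by (rule measure_UNION_le) (use F in auto)
      also have "\<dots> = (\<Sum>p\<in>F. measure lborel (ocube p))"
        by (simp add: ccube_def ocube_def measure_lborel_cbox_eq measure_lborel_box_eq)
      also have "\<dots> = measure lborel (\<Union>p\<in>F. ocube p)"
        by (rule measure_finite_Union[symmetric]) (use F dj emf in auto)
      also have "\<dots> \<le> B"
        unfolding B_def
      proof (rule isodiametric_boxfam[OF bf])
        fix x y assume xy: "x \<in> \<Union>(ocube ` F)" "y \<in> \<Union>(ocube ` F)"
        have "\<exists>p\<in>S. dist p z < e" if z: "z \<in> \<Union>(ocube ` F)" for z
        proof -
          obtain q where q: "q \<in> F" "z \<in> ccube q" using z ocube_subset_ccube by blast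
          then obtain p where "p \<in> S" "ccube q \<subseteq> ball p e" using \<C>(2) F(2) by blast
          then show ?thesis using q(2) by (meson mem_ball subsetD)
        qed
        then obtain p q where pq: "p \<in> S" "dist p x < e" "q \<in> S" "dist q y < e" using xy by meson
        have "dist p q \<le> diameter S" by (rule diameter_bounded_bound[OF bS pq(1,3)])
        moreover have "dist x y \<le> dist p x + dist p q + dist q y"
          using dist_triangle[of x y p] dist_triangle[of p y q] by (simp add: dist_commute)
        ultimately show "dist x y \<le> diameter S + 2 * e" using pq by linarith
      qed (use e diameter_ge_0[OF bS] in simp)
      finally show ?thesis .
    qed
    show ?thesis
    proof (cases "\<C> = {}")
      case True
      then show ?thesis using \<C>(4) fin[of "{}"] by (simp add: B_def)
    next
      case False
      let ?f = "\<lambda>n. ccube (from_nat_into \<C> n)"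
      have fm: "?f n \<in> fmeasurable lborel" for n by (simp add: ccube_def)
      have b: "measure lborel (\<Union>i\<le>n. ?f i) \<le> B" for n
        using fin[of "from_nat_into \<C> ` {..n}"] from_nat_into[OF False] by auto
      have "measure lborel S \<le> measure lborel (\<Union>n. ?f n)"
      proof (rule measure_mono_fmeasurable)
        have "(\<Union>n. ?f n) = (\<Union>p\<in>range (from_nat_into \<C>). ccube p)" by simp
        then show "S \<subseteq> (\<Union>n. ?f n)" using \<C>(4) by (simp only: range_from_nat_into[OF False \<C>(1)])
        show "S \<in> sets lborel" using S by (simp add: borel_compact)
        show "(\<Union>n. ?f n) \<in> fmeasurable lborel" by (rule fmeasurable_countable_Union[OF fm b])
      qed
      also have "\<dots> \<le> B" by (rule measure_countable_Union_le[OF fm b])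
      finally show ?thesis by (simp add: B_def)
    qed
  qed
  have "((\<lambda>e. unit_ball_vol DIM('a) * ((diameter S + 2 * e) / 2) ^ DIM('a)) \<longlongrightarrow>
      unit_ball_vol DIM('a) * ((diameter S + 2 * 0) / 2) ^ DIM('a)) (at_right 0)"
    by (intro tendsto_mult tendsto_power tendsto_divide tendsto_add tendsto_const tendsto_ident_at) simp
  moreover have "eventually (\<lambda>e. measure lborel S \<le> unit_ball_vol DIM('a) * ((diameter S + 2 * e) / 2) ^ DIM('a)) (at_right 0)"
    unfolding eventually_at_right_field using main by (intro exI[of _ 1]) auto
  ultimately show ?thesis
    using tendsto_lowerbound[of _ _ "at_right (0::real)" "measure lborel S"] by auto
qed

subsection \<open>Hausdorff measure\<close>

text \<open>The summand of \<open>hausdorff_pre\<close>: in dimension \<open>d\<close> it is the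
  volume of a ball with the diameter of \<open>C\<close>. Since \<open>0 powr d\<close> is 0, empty
  sets cost nothing and can pad a sequence.\<close>

definition hgauge :: "real \<Rightarrow> 'a::euclidean_space set \<Rightarrow> ennreal" where
  "hgauge d C = ennreal (unit_ball_vol d * (diameter C / 2) powr d)"

lemma unit_ball_vol_nonneg: "d \<ge> 0 \<Longrightarrow> unit_ball_vol d \<ge> 0"
  by (simp add: unit_ball_vol_eq)

lemma hgauge_empty [simp]: "hgauge d {} = 0"
  by (simp add: hgauge_def)

lemma hausdorff_pre_le:
  assumes "E \<subseteq> (\<Union>n. C n)" "\<And>n. bounded (C n)" "\<And>n. diameter (C n) \<le> \<delta>"
  shows "hausdorff_pre d \<delta> E \<le> (\<Sum>n. hgauge d (C n))"
  unfolding hausdorff_pre_def hgauge_def by (rule INF_lower) (use assms in auto)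

lemma hausdorff_pre_ge:
  assumes "\<And>C. E \<subseteq> (\<Union>n. C n) \<Longrightarrow> (\<And>n. bounded (C n)) \<Longrightarrow> (\<And>n. diameter (C n) \<le> \<delta>) \<Longrightarrow> X \<le> (\<Sum>n. hgauge d (C n))"
  shows "X \<le> hausdorff_pre d \<delta> E"
  unfolding hausdorff_pre_def by (rule INF_greatest) (use assms in \<open>auto simp: hgauge_def\<close>)

lemma hausdorff_pre_mono: "E \<subseteq> F \<Longrightarrow> hausdorff_pre d \<delta> E \<le> hausdorff_pre d \<delta> F"
  by (rule hausdorff_pre_ge, rule hausdorff_pre_le) auto

lemma hausdorff_pre_antimono: "\<delta> \<le> \<delta>' \<Longrightarrow> hausdorff_pre d \<delta>' E \<le> hausdorff_pre d \<delta> E"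
  by (rule hausdorff_pre_ge, rule hausdorff_pre_le) (auto intro: order_trans)

lemma hausdorff_pre_le_outer: "\<delta> > 0 \<Longrightarrow> hausdorff_pre d \<delta> E \<le> hausdorff_outer d E"
  unfolding hausdorff_outer_def by (rule SUP_upper) auto

lemma hausdorff_outer_le: "(\<And>\<delta>. \<delta> > 0 \<Longrightarrow> hausdorff_pre d \<delta> E \<le> X) \<Longrightarrow> hausdorff_outer d E \<le> X"
  unfolding hausdorff_outer_def by (rule SUP_least) auto

lemma hausdorff_outer_mono: "E \<subseteq> F \<Longrightarrow> hausdorff_outer d E \<le> hausdorff_outer d F"
  by (rule hausdorff_outer_le) (meson hausdorff_pre_le_outer hausdorff_pre_mono order_trans)

lemma hausdorff_pre_subadditive:
  fixes E :: "nat \<Rightarrow> 'a::euclidean_space set"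
  shows "hausdorff_pre d \<delta> (\<Union>i. E i) \<le> (\<Sum>i. hausdorff_pre d \<delta> (E i))"
proof (rule ennreal_le_epsilon)
  fix e :: real assume e: "0 < e" and fin: "(\<Sum>i. hausdorff_pre d \<delta> (E i)) < top"
  \<comment> \<open>Each \<open>E i\<close> gets a cover within \<open>e / 2 ^ (i + 1)\<close> of
    the infimum; finiteness of the sum makes the inequality strict, so such a cover exists. The
    covers are then merged along a pairing function.\<close>
  have "\<exists>C. E i \<subseteq> (\<Union>n. C n) \<and> (\<forall>n. bounded (C n) \<and> diameter (C n) \<le> \<delta>) \<and>
      (\<Sum>n. hgauge d (C n)) \<le> hausdorff_pre d \<delta> (E i) + ennreal (e * (1/2) ^ Suc i)" for i
  proof -
    have "hausdorff_pre d \<delta> (E i) \<noteq> top"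
    proof -
      have "(\<Sum>j\<in>{i}. hausdorff_pre d \<delta> (E j)) \<le> (\<Sum>i. hausdorff_pre d \<delta> (E i))"
        by (rule sum_le_suminf) auto
      then show ?thesis using fin by auto
    qed
    then have "hausdorff_pre d \<delta> (E i) < hausdorff_pre d \<delta> (E i) + ennreal (e * (1/2) ^ Suc i)"
      using e ennreal_add_left_cancel_less[of "hausdorff_pre d \<delta> (E i)" 0 "ennreal (e * (1/2) ^ Suc i)"]
      by auto
    then have "\<exists>C\<in>{C :: nat \<Rightarrow> 'a set. E i \<subseteq> (\<Union>n. C n) \<and> (\<forall>n. bounded (C n) \<and> diameter (C n) \<le> \<delta>)}.
       (\<Sum>n. ennreal (unit_ball_vol d * (diameter (C n) / 2) powr d)) < hausdorff_pre d \<delta> (E i) + ennreal (e * (1/2) ^ Suc i)"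
      unfolding hausdorff_pre_def[of d \<delta> "E i"] by (simp only: INF_less_iff)
    then show ?thesis unfolding hgauge_def by (blast intro: less_imp_le)
  qed
  then obtain C where C: "\<And>i. E i \<subseteq> (\<Union>n. C i n)" "\<And>i n. bounded (C i n)" "\<And>i n. diameter (C i n) \<le> \<delta>"
    "\<And>i. (\<Sum>n. hgauge d (C i n)) \<le> hausdorff_pre d \<delta> (E i) + ennreal (e * (1/2) ^ Suc i)"
    by metis
  have "hausdorff_pre d \<delta> (\<Union>i. E i) \<le> (\<Sum>k. hgauge d (case prod_decode k of (i, n) \<Rightarrow> C i n))"
  proof (rule hausdorff_pre_le)
    show "(\<Union>i. E i) \<subseteq> (\<Union>k. case prod_decode k of (i, n) \<Rightarrow> C i n)"
    proof
      fix x assume "x \<in> (\<Union>i. E i)"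
      then obtain i n where "x \<in> C i n" using C(1) by blast
      then have "x \<in> (case prod_decode (prod_encode (i, n)) of (i, n) \<Rightarrow> C i n)" by simp
      then show "x \<in> (\<Union>k. case prod_decode k of (i, n) \<Rightarrow> C i n)" by (rule UN_I[OF UNIV_I])
    qed
  qed (use C(2,3) in \<open>auto split: prod.split\<close>)
  also have "\<dots> = (\<Sum>k. (\<lambda>(i, n). hgauge d (C i n)) (prod_decode k))"
    by (rule suminf_cong) (simp split: prod.split)
  also have "\<dots> = (\<Sum>i. \<Sum>n. hgauge d (C i n))"
    by (rule suminf_ennreal_2dimen) simp
  also have "\<dots> \<le> (\<Sum>i. hausdorff_pre d \<delta> (E i) + ennreal (e * (1/2) ^ Suc i))"
    by (rule suminf_le) (use C(4) e in \<open>auto simp: ennreal_mult'\<close>)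
  also have "\<dots> = (\<Sum>i. hausdorff_pre d \<delta> (E i)) + (\<Sum>i. ennreal (e * (1/2) ^ Suc i))"
    by (rule suminf_add[symmetric]) auto
  also have "(\<Sum>i. ennreal (e * (1/2) ^ Suc i)) = ennreal e"
  proof -
    have s: "(\<lambda>i. e * (1/2) ^ Suc i) sums (e * 1)" by (intro sums_mult power_half_series)
    show ?thesis using s e by (intro suminf_ennreal_eq) auto
  qed
  finally show "hausdorff_pre d \<delta> (\<Union>i. E i) \<le> (\<Sum>i. hausdorff_pre d \<delta> (E i)) + ennreal e" .
qed

lemma hausdorff_outer_subadditive:
  fixes E :: "nat \<Rightarrow> 'a::euclidean_space set"
  shows "hausdorff_outer d (\<Union>i. E i) \<le> (\<Sum>i. hausdorff_outer d (E i))"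
proof (rule hausdorff_outer_le)
  fix \<delta> :: real assume "\<delta> > 0"
  then show "hausdorff_pre d \<delta> (\<Union>i. E i) \<le> (\<Sum>i. hausdorff_outer d (E i))"
    by (intro order_trans[OF hausdorff_pre_subadditive] suminf_le hausdorff_pre_le_outer) auto
qed

lemma hausdorff_pre_empty: "\<delta> > 0 \<Longrightarrow> hausdorff_pre d \<delta> {} = 0"
  using hausdorff_pre_le[of "{}" "\<lambda>_. {}" \<delta> d] by simp

lemma hausdorff_outer_empty [simp]: "hausdorff_outer d {} = 0"
  using hausdorff_outer_le[of d "{}" 0] by (simp add: hausdorff_pre_empty)

lemma hausdorff_outer_Un: "hausdorff_outer d (A \<union> B) \<le> hausdorff_outer d A + hausdorff_outer d B"
proof -
  have "hausdorff_outer d (\<Union>i. binaryset A B i) \<le> (\<Sum>i. hausdorff_outer d (binaryset A B i))"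
    by (rule hausdorff_outer_subadditive)
  then show ?thesis by (simp add: UN_binaryset_eq suminf_binaryset_eq)
qed

section \<open>Borel sets are measurable for the Hausdorff outer measure\<close>

lemma hausdorff_outer_SUP: "hausdorff_outer d E = (SUP n. hausdorff_pre d (inverse (Suc n)) E)"
proof (rule antisym)
  show "hausdorff_outer d E \<le> (SUP n. hausdorff_pre d (inverse (Suc n)) E)"
  proof (rule hausdorff_outer_le)
    fix \<delta> :: real assume "\<delta> > 0"
    then obtain n where "inverse (Suc n) < \<delta>" using reals_Archimedean by blast
    then have "hausdorff_pre d \<delta> E \<le> hausdorff_pre d (inverse (Suc n)) E" by (intro hausdorff_pre_antimono) simp
    then show "hausdorff_pre d \<delta> E \<le> (SUP n. hausdorff_pre d (inverse (Suc n)) E)"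
      by (meson SUP_upper2 UNIV_I)
  qed
qed (intro SUP_least hausdorff_pre_le_outer, simp)

text \<open>A set of diameter below \<open>r\<close> cannot meet both \<open>A\<close> and
  \<open>B\<close>, so every fine cover of the union splits into a cover of each.\<close>

lemma hausdorff_outer_separated:
  assumes r: "r > 0" "\<And>a b. a \<in> A \<Longrightarrow> b \<in> B \<Longrightarrow> r \<le> dist a b"
  shows "hausdorff_outer d A + hausdorff_outer d B \<le> hausdorff_outer d (A \<union> B)"
proof -
  have pre: "hausdorff_pre d \<delta> A + hausdorff_pre d \<delta> B \<le> hausdorff_pre d \<delta> (A \<union> B)" if "0 < \<delta>" "\<delta> < r" for \<delta>
  proof (rule hausdorff_pre_ge)
    fix C :: "nat \<Rightarrow> 'a set"
    assume C: "A \<union> B \<subseteq> (\<Union>n. C n)" "\<And>n. bounded (C n)" "\<And>n. diameter (C n) \<le> \<delta>"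
    define CA where "CA n = (if C n \<inter> A = {} then {} else C n)" for n
    define CB where "CB n = (if C n \<inter> B = {} then {} else C n)" for n
    have CA: "hausdorff_pre d \<delta> A \<le> (\<Sum>n. hgauge d (CA n))"
    proof (rule hausdorff_pre_le)
      show "A \<subseteq> (\<Union>n. CA n)" using C(1) unfolding CA_def by fastforce
    qed (use C that in \<open>auto simp: CA_def\<close>)
    have CB: "hausdorff_pre d \<delta> B \<le> (\<Sum>n. hgauge d (CB n))"
    proof (rule hausdorff_pre_le)
      show "B \<subseteq> (\<Union>n. CB n)" using C(1) unfolding CB_def by fastforce
    qed (use C that in \<open>auto simp: CB_def\<close>)
    have le: "hgauge d (CA n) + hgauge d (CB n) \<le> hgauge d (C n)" for n
    proof -
      have "C n \<inter> A = {} \<or> C n \<inter> B = {}"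
      proof (rule ccontr)
        assume "\<not> ?thesis"
        then obtain a b where "a \<in> A" "b \<in> B" "a \<in> C n" "b \<in> C n" by blast
        then have "r \<le> \<delta>" using r(2) diameter_bounded_bound[OF C(2)] C(3) by (meson order_trans)
        then show False using that by simp
      qed
      then show ?thesis by (auto simp: CA_def CB_def)
    qed
    have "hausdorff_pre d \<delta> A + hausdorff_pre d \<delta> B \<le> (\<Sum>n. hgauge d (CA n)) + (\<Sum>n. hgauge d (CB n))"
      using CA CB by (rule add_mono)
    also have "\<dots> = (\<Sum>n. hgauge d (CA n) + hgauge d (CB n))" by (rule suminf_add) auto
    also have "\<dots> \<le> (\<Sum>n. hgauge d (C n))" by (rule suminf_le) (use le in auto)
    finally show "hausdorff_pre d \<delta> A + hausdorff_pre d \<delta> B \<le> (\<Sum>n. hgauge d (C n))" .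
  qed
  have inc: "incseq (\<lambda>n. hausdorff_pre d (inverse (Suc n)) E)" for E :: "'a set"
    by (intro incseq_SucI hausdorff_pre_antimono) (simp add: field_simps)
  have "hausdorff_outer d A + hausdorff_outer d B = (SUP n. hausdorff_pre d (inverse (Suc n)) A + hausdorff_pre d (inverse (Suc n)) B)"
    unfolding hausdorff_outer_SUP by (rule ennreal_SUP_add[OF inc inc, symmetric])
  also have "\<dots> \<le> hausdorff_outer d (A \<union> B)"
  proof (rule SUP_least)
    fix n
    let ?\<delta> = "min (inverse (Suc n)) (r / 2)"
    have "hausdorff_pre d (inverse (Suc n)) A + hausdorff_pre d (inverse (Suc n)) B \<le> hausdorff_pre d ?\<delta> A + hausdorff_pre d ?\<delta> B"
      by (intro add_mono hausdorff_pre_antimono) auto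
    also have "\<dots> \<le> hausdorff_pre d ?\<delta> (A \<union> B)" by (rule pre) (use r in auto)
    also have "\<dots> \<le> hausdorff_outer d (A \<union> B)" by (rule hausdorff_pre_le_outer) (use r in auto)
    finally show "hausdorff_pre d (inverse (Suc n)) A + hausdorff_pre d (inverse (Suc n)) B \<le> hausdorff_outer d (A \<union> B)" .
  qed
  finally show ?thesis .
qed

text \<open>Caratheodory's criterion for a metric outer measure: \<open>S - F\<close> is cut into the shells \<open>R k\<close> of
  points at distance about \<open>1 / k\<close> from \<open>F\<close>. Shells of equal parity are separated, so the measures of
  all shells have a finite sum, and the tail of the series can be made small.\<close>

lemma hausdorff_outer_caratheodory_closed:
  fixes F S :: "'a::euclidean_space set"
  assumes F: "closed F"
  shows "hausdorff_outer d (S \<inter> F) + hausdorff_outer d (S - F) \<le> hausdorff_outer d S"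
proof (cases "F = {} \<or> hausdorff_outer d S = top")
  case True then show ?thesis by auto
next
  case False
  let ?H = "hausdorff_outer d :: 'a set \<Rightarrow> ennreal"
  define u where "u k = 1 / (real k + 1)" for k
  have u0: "u k > 0" for k by (simp add: u_def)
  have umono: "j \<le> k \<Longrightarrow> u k \<le> u j" for j k by (simp add: u_def frac_le)
  have ustrict: "u (Suc k) < u k" for k by (simp add: u_def frac_less2)
  define R where "R k = {x \<in> S. u (Suc k) \<le> infdist x F \<and> infdist x F < u k}" for k
  define T where "T k = {x \<in> S. u k \<le> infdist x F}" for k
  have sep: "infdist x F - infdist y F \<le> dist x y" for x y
    using infdist_triangle[of x F y] by simp
  have fin: "?H S < top" using False by (simp add: less_top)
  have sub: "\<And>k. R k \<subseteq> S" "\<And>k. T k \<subseteq> S" by (auto simp: R_def T_def)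
  have alt: "(\<Sum>k<n. ?H (R (2 * k + p))) \<le> ?H (\<Union>k<n. R (2 * k + p))" for n p
  proof (induction n)
    case (Suc n)
    \<comment> \<open>Points of two shells of equal parity are at least the width of the skipped
      shell \<open>2 * n + p - 1\<close> apart.\<close>
    have s: "u (2 * n + p) - u (Suc (2 * n + p)) \<le> dist a b \<or> u (2 * n + p - 1) - u (2 * n + p) \<le> dist a b" 
      if a: "a \<in> (\<Union>k<n. R (2 * k + p))" and b: "b \<in> R (2 * n + p)" for a b
    proof -
      obtain k where k: "k < n" "a \<in> R (2 * k + p)" using a by blast
      have "u (2 * n + p - 1) \<le> u (Suc (2 * k + p))" using k by (intro umono) auto
      then have "u (2 * n + p - 1) \<le> infdist a F" "infdist b F < u (2 * n + p)" using k b by (auto simp: R_def)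
      then show ?thesis using sep[of a b] by linarith
    qed
    have "?H (\<Union>k<n. R (2 * k + p)) + ?H (R (2 * n + p)) \<le> ?H ((\<Union>k<n. R (2 * k + p)) \<union> R (2 * n + p))"
    \<comment> \<open>For \<open>n = 0\<close> the truncated index \<open>2 * n + p - 1\<close> may
      coincide with \<open>2 * n + p\<close>, and the gap would vanish. The union is empty
      then.\<close>
    proof (cases "n = 0")
      case False
      show ?thesis
      proof (rule hausdorff_outer_separated)
        have "Suc (2 * n + p - 1) = 2 * n + p" using False by simp
        then show "0 < min (u (2 * n + p) - u (Suc (2 * n + p))) (u (2 * n + p - 1) - u (2 * n + p))"
          using ustrict[of "2 * n + p"] ustrict[of "2 * n + p - 1"] by simp
      qed (use s in fastforce)
    qed simp
    moreover have "(\<Union>k<n. R (2 * k + p)) \<union> R (2 * n + p) = (\<Union>k<Suc n. R (2 * k + p))"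
      by (auto simp: less_Suc_eq)
    ultimately show ?case using Suc by (simp add: add_mono order_trans[OF add_right_mono])
  qed simp
  have "(\<Sum>j<2 * n. ?H (R j)) = (\<Sum>k<n. ?H (R (2 * k + 0))) + (\<Sum>k<n. ?H (R (2 * k + 1)))" for n
    by (induction n) (auto simp: algebra_simps)
  also have "\<dots> n \<le> ?H S + ?H S" for n
    by (intro add_mono order_trans[OF alt] hausdorff_outer_mono) (use sub in auto)
  finally have b: "(\<Sum>j<2 * n. ?H (R j)) \<le> ?H S + ?H S" for n .
  have "(\<Sum>j. ?H (R j)) \<le> ?H S + ?H S"
  proof (rule suminf_le_const)
    fix n
    have "(\<Sum>j<n. ?H (R j)) \<le> (\<Sum>j<2 * n. ?H (R j))" by (rule sum_mono2) auto
    then show "(\<Sum>j<n. ?H (R j)) \<le> ?H S + ?H S" using b[of n] by (rule order_trans)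
  qed auto
  also have "\<dots> < top" using fin by simp
  finally have sfin: "(\<Sum>j. ?H (R j)) < top" .
  have cov: "S - F \<subseteq> T n \<union> (\<Union>j. R (j + n))" for n
  proof
    fix x assume x: "x \<in> S - F"
    have pos: "infdist x F > 0" using x F False by (simp add: infdist_pos_not_in_closed)
    show "x \<in> T n \<union> (\<Union>j. R (j + n))"
    proof (cases "u n \<le> infdist x F")
      case True then show ?thesis using x by (auto simp: T_def)
    next
      case nle: False
      obtain m where m: "u m < infdist x F"
        using reals_Archimedean[OF pos] by (auto simp: u_def inverse_eq_divide add.commute)
      define k where "k = (LEAST k. u k \<le> infdist x F)"
      have k: "u k \<le> infdist x F" unfolding k_def by (rule LeastI[of _ m]) (use m in simp)
      have "n < k" using nle k umono by (meson not_le order_trans)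
      then obtain k' where k': "k = Suc k'" "n \<le> k'" by (metis Suc_leD Suc_le_mono gr0_implies_Suc less_Suc_eq_le not_less0 old.nat.exhaust)
      have "infdist x F < u k'" using not_less_Least[of k' "\<lambda>k. u k \<le> infdist x F"] k' by (simp add: k_def not_le)
      then have "x \<in> R k'" using x k k' by (simp add: R_def)
      then have "x \<in> R ((k' - n) + n)" using k' by simp
      then show ?thesis by blast
    qed
  qed
  \<comment> \<open>\<open>S - F\<close> lies in \<open>T n\<close> together with the shells from
    \<open>n\<close> on, and \<open>T n\<close> keeps distance \<open>u n\<close> from
    \<open>F\<close>. Adding the first \<open>n\<close> shells completes the tail to the whole
    series, which avoids a subtraction in \<open>ennreal\<close>.\<close>
  have step: "?H (S \<inter> F) + ?H (S - F) + (\<Sum>j<n. ?H (R j)) \<le> ?H S + (\<Sum>j. ?H (R j))" for n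
  proof -
    have "?H (S - F) \<le> ?H (T n) + (\<Sum>j. ?H (R (j + n)))"
      by (rule order_trans[OF hausdorff_outer_mono[OF cov[of n]]])
         (intro order_trans[OF hausdorff_outer_Un] add_mono order_refl hausdorff_outer_subadditive)
    then have "?H (S \<inter> F) + ?H (S - F) + (\<Sum>j<n. ?H (R j)) \<le> (?H (S \<inter> F) + ?H (T n)) + ((\<Sum>j. ?H (R (j + n))) + (\<Sum>j<n. ?H (R j)))"
      by (metis (no_types, lifting) add.assoc add_left_mono add_right_mono)
    also have "(\<Sum>j. ?H (R (j + n))) + (\<Sum>j<n. ?H (R j)) = (\<Sum>j. ?H (R j))"
      by (rule suminf_offset[symmetric]) auto
    also have "?H (S \<inter> F) + ?H (T n) \<le> ?H ((S \<inter> F) \<union> T n)"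
    proof (rule hausdorff_outer_separated[OF u0[of n]])
      fix a b assume "a \<in> S \<inter> F" "b \<in> T n"
      then show "u n \<le> dist a b" using infdist_le[of a F b] by (auto simp: T_def dist_commute)
    qed
    also have "\<dots> \<le> ?H S" by (rule hausdorff_outer_mono) (use sub in auto)
    finally show ?thesis by (simp add: add_right_mono)
  qed
  have "(\<lambda>n. ?H (S \<inter> F) + ?H (S - F) + (\<Sum>j<n. ?H (R j))) \<longlonglongrightarrow> ?H (S \<inter> F) + ?H (S - F) + (\<Sum>j. ?H (R j))"
    by (intro tendsto_add tendsto_const summable_LIMSEQ) auto
  then have "?H (S \<inter> F) + ?H (S - F) + (\<Sum>j. ?H (R j)) \<le> ?H S + (\<Sum>j. ?H (R j))"
    by (rule LIMSEQ_le_const2) (use step in auto)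
  then show ?thesis using sfin by (metis add.commute ennreal_add_left_cancel_le less_irrefl infinity_ennreal_def)
qed

text \<open>\<open>hausdorff_measure\<close> is built by \<open>measure_of\<close>, which returns
  the given set function only if it is a measure on the sigma-algebra. Closed sets satisfy the
  Caratheodory condition and generate the Borel sets.\<close>

lemma measure_space_hausdorff:
  "measure_space (UNIV :: 'a::euclidean_space set) (sets borel) (hausdorff_outer d)"
proof -
  let ?H = "hausdorff_outer d :: 'a set \<Rightarrow> ennreal"
  interpret sigma_algebra "UNIV :: 'a set" "Pow UNIV" by (rule sigma_algebra_Pow)
  have "outer_measure_space (Pow UNIV) ?H"
    unfolding outer_measure_space_def positive_def increasing_def countably_subadditive_def
    by (auto intro: hausdorff_outer_mono hausdorff_outer_subadditive)
  then have L: "measure_space UNIV (lambda_system UNIV (Pow UNIV) ?H) ?H"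
    by (rule caratheodory_lemma)
  have "closed F \<Longrightarrow> F \<in> lambda_system UNIV (Pow UNIV) ?H" for F
    unfolding lambda_system_eq
  proof safe
    fix S assume "closed F"
    show "?H (S \<inter> F) + ?H (S - F) = ?H S"
    proof (rule antisym)
      show "?H (S \<inter> F) + ?H (S - F) \<le> ?H S" by (rule hausdorff_outer_caratheodory_closed[OF \<open>closed F\<close>])
      show "?H S \<le> ?H (S \<inter> F) + ?H (S - F)"
        using hausdorff_outer_Un[of d "S \<inter> F" "S - F"] by (simp add: Int_Diff_Un)
    qed
  qed auto
  then have "sigma_sets UNIV (Collect closed) \<subseteq> lambda_system UNIV (Pow UNIV) ?H"
    using L by (intro sigma_algebra.sigma_sets_subset) (auto simp: measure_space_def)
  then have sub: "sets (borel :: 'a measure) \<subseteq> lambda_system UNIV (Pow UNIV) ?H"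
    by (simp add: borel_eq_closed)
  show ?thesis
    unfolding measure_space_def
  proof (intro conjI)
    show "sigma_algebra UNIV (sets (borel :: 'a measure))" using sets.sigma_algebra_axioms[of borel] by simp
    show "positive (sets borel) ?H" by (simp add: positive_def)
    show "countably_additive (sets borel) ?H"
      using L sub unfolding measure_space_def countably_additive_def by blast
  qed
qed

lemma sets_hausdorff_measure [simp, measurable_cong]: "sets (hausdorff_measure d) = sets borel"
  unfolding hausdorff_measure_def by (metis sets.sets_measure_of_eq space_borel)

lemma space_hausdorff_measure [simp]: "space (hausdorff_measure d) = UNIV"
  by (simp add: hausdorff_measure_def space_measure_of_conv)

lemma emeasure_hausdorff_measure: "S \<in> sets borel \<Longrightarrow> emeasure (hausdorff_measure d) S = hausdorff_outer d S"
  using measure_space_hausdorff[of d]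
  by (intro emeasure_measure_of[OF hausdorff_measure_def])
     (auto simp: measure_space_def)

section \<open>Lipschitz images, and equality of Hausdorff and Lebesgue measure in full
  dimension\<close>

lemma hausdorff_outer_lipschitz_image:
  fixes f :: "'a::euclidean_space \<Rightarrow> 'b::euclidean_space"
  assumes L: "L > 0" and d: "d > 0" and f: "\<And>x y. x \<in> E \<Longrightarrow> y \<in> E \<Longrightarrow> dist (f x) (f y) \<le> L * dist x y"
  shows "hausdorff_outer d (f ` E) \<le> ennreal (L powr d) * hausdorff_outer d E"
proof (rule hausdorff_outer_le)
  fix \<delta> :: real assume \<delta>: "\<delta> > 0"
  have "hausdorff_pre d \<delta> (f ` E) \<le> ennreal (L powr d) * (\<Sum>n. hgauge d (C n))"
    if C: "E \<subseteq> (\<Union>n. C n)" "\<And>n. bounded (C n)" "\<And>n. diameter (C n) \<le> \<delta> / L" for C :: "nat \<Rightarrow> 'a set"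
  proof -
    \<comment> \<open>The covering sets are cut down to \<open>E\<close>, because \<open>f\<close>
      is Lipschitz only there.\<close>
    have di: "bounded (f ` (C n \<inter> E)) \<and> diameter (f ` (C n \<inter> E)) \<le> L * diameter (C n)" for n
    proof -
      have *: "dist u v \<le> L * diameter (C n)" if "u \<in> f ` (C n \<inter> E)" "v \<in> f ` (C n \<inter> E)" for u v
        using that f diameter_bounded_bound[OF C(2)[of n]] L
        by (smt (verit) IntE imageE mult_left_mono)
      show ?thesis
      proof
        show "bounded (f ` (C n \<inter> E))" using * unfolding bounded_two_points by blast
        show "diameter (f ` (C n \<inter> E)) \<le> L * diameter (C n)"
          by (rule diameter_le) (use * L diameter_ge_0[OF C(2)] in \<open>auto simp: dist_norm\<close>)
      qed
    qed
    have "hausdorff_pre d \<delta> (f ` E) \<le> (\<Sum>n. hgauge d (f ` (C n \<inter> E)))"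
    proof (rule hausdorff_pre_le)
      show "f ` E \<subseteq> (\<Union>n. f ` (C n \<inter> E))" using C(1) by blast
      show "diameter (f ` (C n \<inter> E)) \<le> \<delta>" for n
        using di[of n] mult_left_mono[OF C(3)[of n], of L] L by simp
    qed (use di in auto)
    also have "\<dots> \<le> (\<Sum>n. ennreal (L powr d) * hgauge d (C n))"
    proof (rule suminf_le)
      fix n
      have "(diameter (f ` (C n \<inter> E)) / 2) powr d \<le> (L * diameter (C n) / 2) powr d"
        using di[of n] d diameter_ge_0[of "f ` (C n \<inter> E)"] by (intro powr_mono2) auto
      also have "\<dots> = L powr d * (diameter (C n) / 2) powr d"
        using L diameter_ge_0[OF C(2)] by (simp add: powr_mult flip: times_divide_eq_right)
      finally show "hgauge d (f ` (C n \<inter> E)) \<le> ennreal (L powr d) * hgauge d (C n)"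
        unfolding hgauge_def using unit_ball_vol_nonneg[of d] d
        by (subst ennreal_mult[symmetric]) (auto intro!: ennreal_leI simp: mult.left_commute[of "L powr d"] mult_left_mono)
    qed auto
    also have "\<dots> = ennreal (L powr d) * (\<Sum>n. hgauge d (C n))" by simp
    finally show ?thesis .
  qed note * = this
  have L0: "ennreal (L powr d) \<noteq> 0" "ennreal (L powr d) \<noteq> top" using L by auto
  have "hausdorff_pre d \<delta> (f ` E) / ennreal (L powr d) \<le> hausdorff_pre d (\<delta> / L) E"
  proof (rule hausdorff_pre_ge)
    fix C :: "nat \<Rightarrow> 'a set" assume "E \<subseteq> (\<Union>n. C n)" "\<And>n. bounded (C n)" "\<And>n. diameter (C n) \<le> \<delta> / L"
    then have "hausdorff_pre d \<delta> (f ` E) \<le> ennreal (L powr d) * (\<Sum>n. hgauge d (C n))" by (rule *)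
    then show "hausdorff_pre d \<delta> (f ` E) / ennreal (L powr d) \<le> (\<Sum>n. hgauge d (C n))"
      using L by (subst divide_le_posI_ennreal) (auto simp: mult.commute)
  qed
  also have "\<dots> \<le> hausdorff_outer d E" by (rule hausdorff_pre_le_outer) (use \<delta> L in auto)
  finally show "hausdorff_pre d \<delta> (f ` E) \<le> ennreal (L powr d) * hausdorff_outer d E"
  proof -
    assume le: "hausdorff_pre d \<delta> (f ` E) / ennreal (L powr d) \<le> hausdorff_outer d E"
    have "hausdorff_pre d \<delta> (f ` E) = ennreal (L powr d) * (hausdorff_pre d \<delta> (f ` E) / ennreal (L powr d))"
      unfolding ennreal_times_divide mult.commute[of "ennreal (L powr d)"]
      using L0 by (simp only: ennreal_mult_divide_eq not_False_eq_True)
    also have "\<dots> \<le> ennreal (L powr d) * hausdorff_outer d E" by (rule mult_left_mono[OF le]) simp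
    finally show ?thesis .
  qed
qed

lemma hausdorff_pre_le_countable:
  assumes \<C>: "countable \<C>" and E: "E \<subseteq> (\<Union>p\<in>\<C>. C p)" and \<delta>: "\<delta> \<ge> 0"
    and C: "\<And>p. p \<in> \<C> \<Longrightarrow> bounded (C p) \<and> diameter (C p) \<le> \<delta>"
    and X: "\<And>F. finite F \<Longrightarrow> F \<subseteq> \<C> \<Longrightarrow> (\<Sum>p\<in>F. hgauge d (C p)) \<le> X"
  shows "hausdorff_pre d \<delta> E \<le> X"
proof -
  define N where "N = to_nat_on \<C> ` \<C>"
  define f where "f n = (if n \<in> N then C (from_nat_into \<C> n) else {})" for n
  have N: "from_nat_into \<C> n \<in> \<C>" if "n \<in> N" for n using that \<C> by (auto simp: N_def)
  have "hausdorff_pre d \<delta> E \<le> (\<Sum>n. hgauge d (f n))"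
  proof (rule hausdorff_pre_le)
    show "E \<subseteq> (\<Union>n. f n)"
    proof
      fix x assume "x \<in> E"
      then obtain p where "p \<in> \<C>" "x \<in> C p" using E by blast
      then have "x \<in> f (to_nat_on \<C> p)" using \<C> by (simp add: f_def N_def)
      then show "x \<in> (\<Union>n. f n)" by blast
    qed
  qed (use C N \<delta> in \<open>auto simp: f_def\<close>)
  also have "\<dots> \<le> X"
  proof (rule suminf_le_const)
    fix k
    have inj: "inj_on (from_nat_into \<C>) ({..<k} \<inter> N)" using \<C> by (auto simp: inj_on_def N_def)
    have "(\<Sum>n<k. hgauge d (f n)) = (\<Sum>n\<in>{..<k} \<inter> N. hgauge d (C (from_nat_into \<C> n)))"
      by (rule sum.mono_neutral_cong_right) (auto simp: f_def)
    also have "\<dots> = (\<Sum>p\<in>from_nat_into \<C> ` ({..<k} \<inter> N). hgauge d (C p))"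
      by (simp add: sum.reindex[OF inj])
    also have "\<dots> \<le> X" by (rule X) (use N in auto)
    finally show "(\<Sum>n<k. hgauge d (f n)) \<le> X" .
  qed auto
  finally show ?thesis .
qed

text \<open>By the isodiametric inequality each covering set has volume at most its gauge; passing
  to the closure makes it compact without changing the diameter. The single scale
  \<open>\<delta> = 1\<close> already suffices. Off the Borel sets \<open>emeasure\<close> is
  0.\<close>

lemma emeasure_lborel_le_hausdorff:
  fixes S :: "'a::euclidean_space set"
  shows "emeasure lborel S \<le> hausdorff_outer DIM('a) S"
proof (cases "S \<in> sets borel")
  case False then show ?thesis by (simp add: emeasure_notin_sets)
next
  case True
  have "emeasure lborel S \<le> hausdorff_pre DIM('a) 1 S"
  proof (rule hausdorff_pre_ge)
    fix C :: "nat \<Rightarrow> 'a set"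
    assume C: "S \<subseteq> (\<Union>n. C n)" "\<And>n. bounded (C n)" "\<And>n. diameter (C n) \<le> 1"
    have "S \<subseteq> (\<Union>n. closure (C n))" using C(1) closure_subset by blast
    then have "emeasure lborel S \<le> emeasure lborel (\<Union>n. closure (C n))"
      by (rule emeasure_mono) auto
    also have "\<dots> \<le> (\<Sum>n. emeasure lborel (closure (C n)))"
      by (rule emeasure_subadditive_countably) auto
    also have "\<dots> \<le> (\<Sum>n. hgauge DIM('a) (C n))"
    proof (rule suminf_le)
      fix n
      have c: "compact (closure (C n))" using C(2) by simp
      have "emeasure lborel (closure (C n)) = ennreal (measure lborel (closure (C n)))"
        using emeasure_bounded_finite[OF compact_imp_bounded[OF c]] by (intro emeasure_eq_ennreal_measure) auto
      also have "measure lborel (closure (C n)) \<le> unit_ball_vol DIM('a) * (diameter (C n) / 2) ^ DIM('a)"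
        using isodiametric[OF c] diameter_closure[OF C(2)] by simp
      also have "(diameter (C n) / 2) ^ DIM('a) = (diameter (C n) / 2) powr DIM('a)"
        using diameter_ge_0[OF C(2)[of n]] by (cases "diameter (C n) = 0") (auto simp: powr_realpow)
      finally show "emeasure lborel (closure (C n)) \<le> hgauge DIM('a) (C n)"
        unfolding hgauge_def by (simp add: ennreal_leI)
    qed auto
    finally show "emeasure lborel S \<le> (\<Sum>n. hgauge DIM('a) (C n))" .
  qed
  also have "\<dots> \<le> hausdorff_outer DIM('a) S" by (rule hausdorff_pre_le_outer) simp
  finally show ?thesis .
qed

text \<open>A crude constant, fit for null sets, where any constant will do. The sharp comparison
  uses balls.\<close>

lemma hgauge_ccube_le:
  fixes p :: "'a::euclidean_space \<times> real"
  assumes l: "snd p \<ge> 0"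
  shows "hgauge DIM('a) (ccube p) \<le> ennreal (unit_ball_vol DIM('a) * DIM('a) ^ DIM('a)) * emeasure lborel (ocube p)"
proof -
  let ?l = "snd p"
  have d: "diameter (ccube p) \<le> DIM('a) * ?l"
  proof (rule diameter_le)
    fix x y assume xy: "x \<in> ccube p" "y \<in> ccube p"
    have "norm (x - y) \<le> (\<Sum>i\<in>Basis. \<bar>(x - y) \<bullet> i\<bar>)" by (rule norm_le_l1)
    also have "\<dots> \<le> (\<Sum>i\<in>(Basis::'a set). ?l)"
    proof (rule sum_mono)
      fix i :: 'a assume i: "i \<in> Basis"
      then have "fst p \<bullet> i \<le> x \<bullet> i" "x \<bullet> i \<le> fst p \<bullet> i + ?l" "fst p \<bullet> i \<le> y \<bullet> i" "y \<bullet> i \<le> fst p \<bullet> i + ?l"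
        using xy by (auto simp: ccube_def mem_box inner_add_left)
      then show "\<bar>(x - y) \<bullet> i\<bar> \<le> ?l" unfolding inner_diff_left by linarith
    qed
    finally show "norm (x - y) \<le> DIM('a) * ?l" by simp
  qed (use l in auto)
  have "(diameter (ccube p) / 2) powr DIM('a) \<le> (DIM('a) * ?l) powr DIM('a)"
    using d l diameter_ge_0[OF compact_imp_bounded[OF compact_ccube], of p] by (intro powr_mono2) auto
  also have "\<dots> = DIM('a) ^ DIM('a) * ?l ^ DIM('a)"
    using l by (cases "?l = 0") (auto simp: powr_realpow power_mult_distrib)
  finally have "unit_ball_vol DIM('a) * (diameter (ccube p) / 2) powr DIM('a) \<le> unit_ball_vol DIM('a) * DIM('a) ^ DIM('a) * ?l ^ DIM('a)"
    using unit_ball_vol_nonneg[of "DIM('a)"] by (simp add: mult_left_mono mult.assoc)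
  then show ?thesis
    unfolding hgauge_def emeasure_cube(1)[OF l]
    using unit_ball_vol_nonneg[of "DIM('a)"] l by (subst ennreal_mult[symmetric]) (auto intro: ennreal_leI)
qed

text \<open>Nonoverlapping cubes inside an open set of measure at most \<open>e\<close> have total
  gauge at most \<open>c * e\<close>. This disposes of the null set that Vitali's theorem leaves
  uncovered.\<close>

lemma hausdorff_outer_negligible_bounded:
  fixes N :: "'a::euclidean_space set"
  assumes N: "negligible N" "bounded N"
  shows "hausdorff_outer DIM('a) N = 0"
proof -
  define c where "c = unit_ball_vol DIM('a) * DIM('a) ^ DIM('a)"
  have c: "c > 0" by (simp add: c_def unit_ball_vol_eq)
  have main: "hausdorff_pre DIM('a) \<delta> N \<le> ennreal c * ennreal e" if \<delta>: "\<delta> > 0" and e: "e > 0" for \<delta> e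
  proof -
    have Nn: "N \<in> null_sets lebesgue" using N(1) by (simp add: negligible_iff_null_sets)
    obtain U where U: "open U" "N \<subseteq> U" "U - N \<in> lmeasurable" "emeasure lebesgue (U - N) < ennreal e"
      by (rule sets_lebesgue_outer_open[OF null_setsD2[OF Nn] e])
    have "emeasure lborel U = emeasure lebesgue U" using U(1) by (simp add: emeasure_completion)
    also have "\<dots> = emeasure lebesgue (U - N)"
      using U(1) by (intro emeasure_Diff_null_set[OF Nn, symmetric]) auto
    finally have eU: "emeasure lborel U \<le> ennreal e" using U(4) by simp
    have "\<exists>r>0. ball x r \<subseteq> U \<and> 2 * r \<le> \<delta>" if x: "x \<in> N" for x
    proof -
      obtain r where "r > 0" "ball x r \<subseteq> U" using U(1,2) x open_contains_ball by blast
      then show ?thesis using \<delta> by (intro exI[of _ "min r (\<delta> / 2)"]) (auto simp: subset_iff)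
    qed
    then obtain \<rho> where \<rho>: "\<And>x. x \<in> N \<Longrightarrow> \<rho> x > 0 \<and> ball x (\<rho> x) \<subseteq> U \<and> 2 * \<rho> x \<le> \<delta>" by metis
    obtain \<C> :: "('a \<times> real) set" where \<C>': "countable \<C> \<and> (\<forall>p\<in>\<C>. snd p > 0 \<and> (\<exists>x\<in>N. ccube p \<subseteq> ball x (\<rho> x))) \<and>
       disjoint_family_on ocube \<C> \<and> N \<subseteq> (\<Union>p\<in>\<C>. ccube p)"
      by (rule exE[OF cube_partition_gauge[OF N(2), of \<rho>, OF \<rho>[THEN conjunct1]]])
    then have \<C>: "countable \<C>" "\<And>p. p \<in> \<C> \<Longrightarrow> snd p > 0 \<and> (\<exists>x\<in>N. ccube p \<subseteq> ball x (\<rho> x))"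
       "disjoint_family_on ocube \<C>" "N \<subseteq> (\<Union>p\<in>\<C>. ccube p)"
      by simp_all
    have pU: "ccube p \<subseteq> U \<and> diameter (ccube p) \<le> \<delta>" if p: "p \<in> \<C>" for p
    proof -
      obtain x where x: "x \<in> N" "ccube p \<subseteq> ball x (\<rho> x)" using \<C>(2)[OF p] by blast
      have "diameter (ccube p) \<le> diameter (ball x (\<rho> x))" by (rule diameter_subset[OF x(2)]) simp
      moreover have "ccube p \<subseteq> U" using x \<rho>[OF x(1)] by blast
      ultimately show ?thesis using \<rho>[OF x(1)] by simp
    qed
    show ?thesis
    proof (rule hausdorff_pre_le_countable[OF \<C>(1,4)])
      fix F assume F: "finite F" "F \<subseteq> \<C>"
      have "(\<Sum>p\<in>F. hgauge DIM('a) (ccube p)) \<le> (\<Sum>p\<in>F. ennreal c * emeasure lborel (ocube p))"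
        unfolding c_def
      proof (intro sum_mono hgauge_ccube_le)
        fix p assume "p \<in> F"
        then have "p \<in> \<C>" using F(2) by blast
        from \<C>(2)[OF this] show "0 \<le> snd p" by simp
      qed
      also have "\<dots> = ennreal c * emeasure lborel (\<Union>p\<in>F. ocube p)"
        using F disjoint_family_on_mono[OF F(2) \<C>(3)]
        by (simp add: sum_distrib_left[symmetric] sum_emeasure image_subset_iff)
      also have "\<dots> \<le> ennreal c * emeasure lborel U"
        using F(2) pU ocube_subset_ccube U(1) by (intro mult_left_mono emeasure_mono) (blast, auto)
      also have "\<dots> \<le> ennreal c * ennreal e" by (rule mult_left_mono[OF eU]) simp
      finally show "(\<Sum>p\<in>F. hgauge DIM('a) (ccube p)) \<le> ennreal c * ennreal e" .
    qed (use \<delta> pU compact_imp_bounded[OF compact_ccube] in auto)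
  qed
  have "hausdorff_outer DIM('a) N \<le> 0"
  proof (rule hausdorff_outer_le, rule ennreal_le_epsilon)
    fix \<delta> e :: real assume "\<delta> > 0" "e > 0"
    moreover have "ennreal c * ennreal (e / c) = ennreal e"
      using c \<open>e > 0\<close> by (subst ennreal_mult[symmetric]) auto
    ultimately show "hausdorff_pre DIM('a) \<delta> N \<le> 0 + ennreal e"
      using main[of \<delta> "e / c"] c by simp
  qed
  then show ?thesis by simp
qed

lemma hausdorff_outer_negligible:
  fixes N :: "'a::euclidean_space set"
  assumes N: "negligible N"
  shows "hausdorff_outer DIM('a) N = 0"
proof -
  have "N = (\<Union>n. N \<inter> cball 0 (real n))"
    by (auto simp: real_arch_simple)
  then have "hausdorff_outer DIM('a) N \<le> (\<Sum>n. hausdorff_outer DIM('a) (N \<inter> cball 0 (real n)))"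
    using hausdorff_outer_subadditive[of "DIM('a)" "\<lambda>n. N \<inter> cball 0 (real n)"] by simp
  also have "\<dots> = 0"
    using N by (subst hausdorff_outer_negligible_bounded) (auto intro: negligible_subset bounded_Int)
  finally show ?thesis by simp
qed

text \<open>The gauge of a ball is exactly its volume, so disjoint balls in \<open>U\<close> have
  total gauge at most the volume of \<open>U\<close>. Small balls from Vitali's theorem fill
  \<open>U\<close> up to a null set.\<close>

lemma hausdorff_outer_open_le:
  fixes U :: "'a::euclidean_space set"
  assumes U: "open U"
  shows "hausdorff_outer DIM('a) U \<le> emeasure lborel U"
proof (rule hausdorff_outer_le)
  fix \<delta> :: real assume \<delta>: "\<delta> > 0"
  define I where "I = {(x, r). r > 0 \<and> ball x r \<subseteq> U \<and> 2 * r \<le> \<delta>}"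
  have V: "\<exists>i. i \<in> I \<and> x \<in> ball (fst i) (snd i) \<and> snd i < d" if x: "x \<in> U" "0 < d" for x d
  proof -
    obtain r where "r > 0" "ball x r \<subseteq> U" using U x(1) open_contains_ball by blast
    then show ?thesis using \<delta> x
      by (intro exI[of _ "(x, min (min r (\<delta> / 2)) (d / 2))"]) (auto simp: I_def subset_iff)
  qed
  obtain C where C: "countable C" "C \<subseteq> I"
     "pairwise (\<lambda>i j. disjnt (ball (fst i) (snd i)) (ball (fst j) (snd j))) C"
     "negligible(U - (\<Union>i \<in> C. ball (fst i) (snd i)))"
    by (rule Vitali_covering_theorem_balls[of U I fst snd, OF V])
  let ?b = "\<lambda>i. ball (fst i) (snd i)"
  let ?B = "\<Union>i\<in>C. ?b i"
  have b: "?b i \<subseteq> U \<and> diameter (?b i) \<le> \<delta> \<and> hgauge DIM('a) (?b i) = emeasure lborel (?b i)" if i: "i \<in> C" for i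
  proof -
    have "i \<in> I" using i C(2) by blast
    then have "snd i > 0 \<and> ?b i \<subseteq> U \<and> 2 * snd i \<le> \<delta>" by (simp add: I_def case_prod_beta)
    then show ?thesis by (simp add: diameter_ball hgauge_def emeasure_ball unit_ball_vol_eq powr_realpow)
  qed
  have "hausdorff_pre DIM('a) \<delta> U \<le> hausdorff_pre DIM('a) \<delta> (\<Union>i. binaryset ?B (U - ?B) i)"
    by (rule hausdorff_pre_mono) (auto simp: UN_binaryset_eq)
  also have "\<dots> \<le> hausdorff_pre DIM('a) \<delta> ?B + hausdorff_pre DIM('a) \<delta> (U - ?B)"
    using hausdorff_pre_subadditive[of "DIM('a)" \<delta> "binaryset ?B (U - ?B)"] \<delta>
    by (simp add: suminf_binaryset_eq hausdorff_pre_empty)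
  also have "hausdorff_pre DIM('a) \<delta> (U - ?B) = 0"
    using hausdorff_pre_le_outer[OF \<delta>, of "DIM('a)" "U - ?B"] hausdorff_outer_negligible[OF C(4)] by simp
  also have "hausdorff_pre DIM('a) \<delta> ?B \<le> emeasure lborel U"
  proof (rule hausdorff_pre_le_countable[where \<C> = C and C = ?b])
    fix F assume F: "finite F" "F \<subseteq> C"
    have "disjoint_family_on ?b F"
      unfolding disjoint_family_on_def
    proof (intro ballI impI)
      fix i j assume "i \<in> F" "j \<in> F" "i \<noteq> j"
      then have "disjnt (?b i) (?b j)" using C(3) F(2) unfolding pairwise_def by blast
      then show "?b i \<inter> ?b j = {}" by (simp add: disjnt_def)
    qed
    then have "(\<Sum>i\<in>F. emeasure lborel (?b i)) = emeasure lborel (\<Union>i\<in>F. ?b i)"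
      using F(1) by (intro sum_emeasure) auto
    also have "\<dots> \<le> emeasure lborel U" using b F(2) U by (intro emeasure_mono) (blast, auto)
    also have "(\<Sum>i\<in>F. emeasure lborel (?b i)) = (\<Sum>i\<in>F. hgauge DIM('a) (?b i))"
      by (rule sum.cong[OF refl]) (use b F(2) in \<open>metis subsetD\<close>)
    finally show "(\<Sum>i\<in>F. hgauge DIM('a) (?b i)) \<le> emeasure lborel U" .
  next
    fix i assume "i \<in> C"
    then show "bounded (?b i) \<and> diameter (?b i) \<le> \<delta>" using b[of i] by simp
  qed (use \<delta> C(1) in auto)
  finally show "hausdorff_pre DIM('a) \<delta> U \<le> emeasure lborel U" by (simp add: add_mono)
qed

lemma hausdorff_outer_eq_lborel:
  fixes S :: "'a::euclidean_space set"
  assumes S: "S \<in> sets borel"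
  shows "hausdorff_outer DIM('a) S = emeasure lborel S"
proof (rule antisym[OF _ emeasure_lborel_le_hausdorff])
  show "hausdorff_outer DIM('a) S \<le> emeasure lborel S"
  proof (rule ennreal_le_epsilon)
    fix e :: real assume e: "0 < e" and fin: "emeasure lborel S < top"
    have eq: "emeasure lebesgue T = emeasure lborel T" if "T \<in> sets borel" for T :: "'a set"
      using that by (simp add: emeasure_completion)
    have lm: "S \<in> lmeasurable" using S fin eq by (auto simp: fmeasurable_def)
    obtain U where U: "open U" "S \<subseteq> U" "U - S \<in> lmeasurable" "emeasure lebesgue (U - S) < ennreal e"
      by (rule sets_lebesgue_outer_open[OF fmeasurableD[OF lm] e])
    have "hausdorff_outer DIM('a) S \<le> hausdorff_outer DIM('a) U" by (rule hausdorff_outer_mono[OF U(2)])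
    also have "\<dots> \<le> emeasure lborel U" by (rule hausdorff_outer_open_le[OF U(1)])
    also have "\<dots> = emeasure lborel (S \<union> (U - S))" using U(2) by (simp add: Un_absorb1)
    also have "\<dots> \<le> emeasure lborel S + emeasure lborel (U - S)"
      by (rule emeasure_subadditive) (use S U(1) in auto)
    also have "\<dots> \<le> emeasure lborel S + ennreal e"
      using U(4) eq[of "U - S"] S U(1) by (intro add_left_mono) auto
    finally show "hausdorff_outer DIM('a) S \<le> emeasure lborel S + ennreal e" .
  qed
qed

subsection \<open>Polarization on the cube\<close>

text \<open>The kernel as a function of the distance. The value at 0 is set by hand because
  \<open>0 powr (- s)\<close> is 0.\<close>

definition kern :: "real \<Rightarrow> real \<Rightarrow> ennreal" where
  "kern s t = (if t = 0 then top else ennreal (t powr (- s)))"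

lemma riesz_pot_kern: "riesz_pot s N x y = (\<Sum>j<N. kern s (dist y (x j)))"
  unfolding riesz_pot_def kern_def by (intro sum.cong) auto

lemma kern_antimono:
  assumes "0 \<le> t" "t \<le> u" "s \<ge> 0" shows "kern s u \<le> kern s t"
proof (cases "t = 0")
  case False
  then have "u powr (- s) \<le> t powr (- s)" using assms by (intro powr_mono2') auto
  then show ?thesis using False assms by (auto simp: kern_def intro!: ennreal_leI)
qed (simp add: kern_def)

lemma kern_scale:
  assumes "c > 0" "t \<ge> 0" shows "kern s (c * t) = ennreal (c powr (- s)) * kern s t"
proof (cases "t = 0")
  case True
  then show ?thesis using assms by (simp add: kern_def ennreal_mult_top)
next
  case False
  then show ?thesis using assms by (simp add: kern_def powr_mult ennreal_mult')
qed

lemma riesz_pot_append: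
  "riesz_pot s (M + n) (\<lambda>j. if j < M then x j else x' (j - M)) y = riesz_pot s M x y + riesz_pot s n x' y"
proof -
  have split: "(\<Sum>j<M + n. f j) = (\<Sum>j<M. f j) + (\<Sum>j<n. f (M + j))" for f :: "nat \<Rightarrow> ennreal"
    by (induction n) (auto simp: add.assoc)
  show ?thesis unfolding riesz_pot_kern split by simp
qed

lemma polar_config_le_max: "x \<in> configs A N \<Longrightarrow> polar_config s A N x \<le> polar_max s A N"
  unfolding polar_max_def by (rule SUP_upper)

lemma polar_config_le_pot: "y \<in> A \<Longrightarrow> polar_config s A N x \<le> riesz_pot s N x y"
  unfolding polar_config_def by (rule INF_lower)

text \<open>\<open>E\<close> behaves from below like a part of a cube of side \<open>c\<close>: every configuration in the unit cube can be
  transplanted into \<open>A\<close> so that the potential on \<open>E\<close> is at least the polarization of a cube of side \<open>c\<close>.\<close>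

definition lower_piece :: "real \<Rightarrow> 'a::euclidean_space itself \<Rightarrow> 'b::metric_space set \<Rightarrow> 'b set \<Rightarrow> real \<Rightarrow> bool" where
  "lower_piece s T A E c \<longleftrightarrow> c > 0 \<and> (\<forall>n. \<forall>x\<in>configs (cbox (0::'a) One) n. \<exists>x'\<in>configs A n. \<forall>y\<in>E.
     ennreal (c powr (- s)) * polar_config s (cbox (0::'a) One) n x \<le> riesz_pot s n x' y)"

section \<open>Transplanting and superposing configurations\<close>

lemma configs_superpose:
  assumes "finite I" "\<And>i. i \<in> I \<Longrightarrow> x i \<in> configs A (n i)"
  shows "\<exists>x'\<in>configs A (\<Sum>i\<in>I. n i). \<forall>i\<in>I. \<forall>y. riesz_pot s (n i) (x i) y \<le> riesz_pot s (\<Sum>i\<in>I. n i) x' y"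
  using assms
proof (induction I rule: finite_induct)
  case empty then show ?case by (auto simp: configs_def)
next
  case (insert i I)
  obtain x' where x': "x' \<in> configs A (\<Sum>i\<in>I. n i)"
    "\<And>i y. i \<in> I \<Longrightarrow> riesz_pot s (n i) (x i) y \<le> riesz_pot s (\<Sum>i\<in>I. n i) x' y"
    using insert by (metis insertCI)
  define M where "M = (\<Sum>i\<in>I. n i)"
  define z where "z j = (if j < M then x' j else x i (j - M))" for j
  have N: "(\<Sum>i\<in>insert i I. n i) = M + n i" using insert by (simp add: M_def)
  have ap: "riesz_pot s (M + n i) z y = riesz_pot s M x' y + riesz_pot s (n i) (x i) y" for y
    unfolding z_def by (rule riesz_pot_append)
  have "z \<in> configs A (M + n i)"
    using x'(1) insert.prems[of i] by (auto simp: configs_def z_def M_def)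
  moreover have "riesz_pot s (n k) (x k) y \<le> riesz_pot s (M + n i) z y" if "k \<in> insert i I" for k y
    using that x'(2)[of k y] unfolding ap M_def[symmetric] by (auto intro: add_increasing2 add_increasing)
  ultimately show ?case unfolding N by blast
qed

text \<open>Surplus points, here copies of one point of \<open>A\<close>, only raise the potential.
  This absorbs the rounding of point counts.\<close>

lemma configs_pad:
  assumes "A \<noteq> {}" "M \<le> N" "x \<in> configs A M"
  shows "\<exists>x'\<in>configs A N. \<forall>y. riesz_pot s M x y \<le> riesz_pot s N x' y"
proof -
  obtain a where a: "a \<in> A" using assms by blast
  define z where "z j = (if j < M then x j else (\<lambda>_. a) (j - M))" for j
  have "riesz_pot s (M + (N - M)) z y = riesz_pot s M x y + riesz_pot s (N - M) (\<lambda>_. a) y" for y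
    unfolding z_def by (rule riesz_pot_append)
  then have "\<forall>y. riesz_pot s M x y \<le> riesz_pot s N z y" using assms(2) by simp
  moreover have "z \<in> configs A N" using assms a by (auto simp: configs_def z_def)
  ultimately show ?thesis by blast
qed

text \<open>A point of \<open>A\<close> lies in some \<open>E i\<close>, and the points assigned to
  that piece alone give it the required potential. Since suprema need not be attained, the argument
  is run for every \<open>T' < T\<close>.\<close>

lemma polar_max_superpose:
  fixes A :: "'b::metric_space set"
  assumes I: "finite I" and lp: "\<And>i. i \<in> I \<Longrightarrow> lower_piece s TYPE('a::euclidean_space) A (E i) (c i)"
    and cov: "A \<subseteq> (\<Union>i\<in>I. E i)" and ne: "A \<noteq> {}" and N: "(\<Sum>i\<in>I. n i) \<le> N"
    and T: "\<And>i. i \<in> I \<Longrightarrow> T \<le> ennreal (c i powr (- s)) * polar_max s (cbox (0::'a) One) (n i)"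
  shows "T \<le> polar_max s A N"
proof (rule dense_le)
  fix T' assume T': "T' < T"
  have "\<exists>x'\<in>configs A (n i). \<forall>y\<in>E i. T' \<le> riesz_pot s (n i) x' y" if i: "i \<in> I" for i
  proof -
    let ?k = "ennreal (c i powr (- s))"
    have "?k * polar_max s (cbox (0::'a) One) (n i) =
        (SUP x\<in>configs (cbox (0::'a) One) (n i). ?k * polar_config s (cbox (0::'a) One) (n i) x)"
      unfolding polar_max_def by (rule SUP_mult_left_ennreal)
    then have "T' < (SUP x\<in>configs (cbox (0::'a) One) (n i). ?k * polar_config s (cbox (0::'a) One) (n i) x)"
      using T' T[OF i] by simp
    then obtain x where x: "x \<in> configs (cbox (0::'a) One) (n i)" "T' < ?k * polar_config s (cbox (0::'a) One) (n i) x"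
      unfolding less_SUP_iff by blast
    obtain x' where x': "x' \<in> configs A (n i)" "\<forall>y\<in>E i. ?k * polar_config s (cbox (0::'a) One) (n i) x \<le> riesz_pot s (n i) x' y"
      using lp[OF i] x(1) unfolding lower_piece_def by blast
    show ?thesis
    proof (intro bexI[OF _ x'(1)] ballI)
      fix y assume "y \<in> E i"
      then show "T' \<le> riesz_pot s (n i) x' y" using x' x(2) by (meson less_imp_le order_trans)
    qed
  qed
  then obtain x where x: "\<And>i. i \<in> I \<Longrightarrow> x i \<in> configs A (n i)" "\<And>i y. i \<in> I \<Longrightarrow> y \<in> E i \<Longrightarrow> T' \<le> riesz_pot s (n i) (x i) y"
    by metis
  have "\<exists>x'\<in>configs A (\<Sum>i\<in>I. n i). \<forall>i\<in>I. \<forall>y. riesz_pot s (n i) (x i) y \<le> riesz_pot s (\<Sum>i\<in>I. n i) x' y"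
    by (rule configs_superpose[OF I]) (rule x(1))
  then obtain x1 where x1: "x1 \<in> configs A (\<Sum>i\<in>I. n i)" "\<And>i y. i \<in> I \<Longrightarrow> riesz_pot s (n i) (x i) y \<le> riesz_pot s (\<Sum>i\<in>I. n i) x1 y"
    by blast
  obtain x2 where x2: "x2 \<in> configs A N" "\<And>y. riesz_pot s (\<Sum>i\<in>I. n i) x1 y \<le> riesz_pot s N x2 y"
    using configs_pad[OF ne N x1(1), where s = s] by blast
  have "T' \<le> polar_config s A N x2"
    unfolding polar_config_def
  proof (rule INF_greatest)
    fix y assume "y \<in> A"
    then obtain i where i: "i \<in> I" "y \<in> E i" using cov by blast
    show "T' \<le> riesz_pot s N x2 y"
      using x(2)[OF i] x1(2)[OF i(1)] x2(2) by (meson order_trans)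
  qed
  also have "\<dots> \<le> polar_max s A N" by (rule polar_config_le_max[OF x2(1)])
  finally show "T' \<le> polar_max s A N" .
qed

lemma polar_max_mono:
  assumes "A \<noteq> {}" "M \<le> N" shows "polar_max s A M \<le> polar_max s A N"
  unfolding polar_max_def[of s A M]
proof (rule SUP_least)
  fix x assume x: "x \<in> configs A M"
  obtain x' where x': "x' \<in> configs A N" "\<And>y. riesz_pot s M x y \<le> riesz_pot s N x' y"
    using configs_pad[OF assms x, where s = s] by blast
  have "polar_config s A M x \<le> polar_config s A N x'"
    unfolding polar_config_def by (rule INF_mono) (use x' in blast)
  also have "\<dots> \<le> polar_max s A N" by (rule polar_config_le_max[OF x'(1)])
  finally show "polar_config s A M x \<le> polar_max s A N" .
qed

text \<open>Configurations are pushed forward by \<open>g\<close>. Distances grow at most by the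
  factor \<open>L\<close>, and homogeneity of the kernel turns this into
  \<open>L powr (- s)\<close>.\<close>

lemma lower_piece_lipschitz:
  fixes g :: "'a::euclidean_space \<Rightarrow> 'b::metric_space"
  assumes L: "L > 0" and s: "s \<ge> 0"
    and g: "\<And>u v. u \<in> cbox 0 One \<Longrightarrow> v \<in> cbox 0 One \<Longrightarrow> dist (g u) (g v) \<le> L * dist u v"
    and A: "\<And>u. u \<in> cbox 0 One \<Longrightarrow> g u \<in> A" and E: "E \<subseteq> g ` cbox 0 One"
  shows "lower_piece s TYPE('a) A E L"
  unfolding lower_piece_def
proof (intro conjI allI ballI L)
  fix n and x :: "nat \<Rightarrow> 'a" assume x: "x \<in> configs (cbox 0 One) n"
  show "\<exists>x'\<in>configs A n. \<forall>y\<in>E. ennreal (L powr (- s)) * polar_config s (cbox (0::'a) One) n x \<le> riesz_pot s n x' y"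
  proof (intro bexI[of _ "g \<circ> x"] ballI)
    show "g \<circ> x \<in> configs A n" using x A by (auto simp: configs_def)
    fix y assume "y \<in> E"
    then obtain u where u: "u \<in> cbox 0 One" "y = g u" using E by blast
    have "ennreal (L powr (- s)) * polar_config s (cbox (0::'a) One) n x \<le> ennreal (L powr (- s)) * riesz_pot s n x u"
      by (rule mult_left_mono[OF polar_config_le_pot[OF u(1)]]) simp
    also have "\<dots> = (\<Sum>j<n. kern s (L * dist u (x j)))"
      unfolding riesz_pot_kern sum_distrib_left by (intro sum.cong refl kern_scale[symmetric] L) simp
    also have "\<dots> \<le> (\<Sum>j<n. kern s (dist y ((g \<circ> x) j)))"
      by (intro sum_mono kern_antimono) (use g u x s in \<open>auto simp: configs_def\<close>)
    finally show "ennreal (L powr (- s)) * polar_config s (cbox (0::'a) One) n x \<le> riesz_pot s n (g \<circ> x) y"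
      by (simp add: riesz_pot_kern)
  qed
qed

text \<open>Points whose image leaves \<open>A\<close> are moved to the nearest point of
  \<open>A\<close>. For \<open>y\<close> in \<open>A\<close> the move is no longer than the distance
  to \<open>y\<close>, so distances to points of \<open>E\<close> at most double.\<close>

lemma lower_piece_lipschitz_proj:
  fixes g :: "'a::euclidean_space \<Rightarrow> 'b::euclidean_space"
  assumes L: "L > 0" and s: "s \<ge> 0"
    and g: "\<And>u v. u \<in> cbox 0 One \<Longrightarrow> v \<in> cbox 0 One \<Longrightarrow> dist (g u) (g v) \<le> L * dist u v"
    and A: "closed A" "A \<noteq> {}" and E: "E \<subseteq> g ` cbox 0 One" "E \<subseteq> A"
  shows "lower_piece s TYPE('a) A E (2 * L)"
  unfolding lower_piece_def
proof (intro conjI allI ballI)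
  show "0 < 2 * L" using L by simp
  fix n and x :: "nat \<Rightarrow> 'a" assume x: "x \<in> configs (cbox 0 One) n"
  define x' where "x' j = closest_point A (g (x j))" for j
  show "\<exists>x'\<in>configs A n. \<forall>y\<in>E. ennreal ((2 * L) powr (- s)) * polar_config s (cbox (0::'a) One) n x \<le> riesz_pot s n x' y"
  proof (intro bexI[of _ x'] ballI)
    show "x' \<in> configs A n" using A by (auto simp: configs_def x'_def closest_point_in_set)
    fix y assume "y \<in> E"
    then obtain u where u: "u \<in> cbox 0 One" "y = g u" "y \<in> A" using E by blast
    have le: "dist y (x' j) \<le> 2 * L * dist u (x j)" if "j < n" for j
    proof -
      have "dist (g (x j)) (x' j) \<le> dist (g (x j)) y"
        unfolding x'_def by (rule closest_point_le[OF A(1) u(3)])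
      then have "dist y (x' j) \<le> 2 * dist y (g (x j))" using dist_triangle[of y "x' j" "g (x j)"] by (simp add: dist_commute)
      also have "\<dots> \<le> 2 * (L * dist u (x j))" using g[of u "x j"] u x that by (simp add: configs_def)
      finally show ?thesis by simp
    qed
    have "ennreal ((2 * L) powr (- s)) * polar_config s (cbox (0::'a) One) n x \<le> ennreal ((2 * L) powr (- s)) * riesz_pot s n x u"
      by (rule mult_left_mono[OF polar_config_le_pot[OF u(1)]]) simp
    also have "\<dots> = (\<Sum>j<n. kern s (2 * L * dist u (x j)))"
      unfolding riesz_pot_kern sum_distrib_left by (intro sum.cong refl kern_scale[symmetric]) (use L in simp_all)
    also have "\<dots> \<le> (\<Sum>j<n. kern s (dist y (x' j)))"
      by (intro sum_mono kern_antimono) (use le s in auto)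
    finally show "ennreal ((2 * L) powr (- s)) * polar_config s (cbox (0::'a) One) n x \<le> riesz_pot s n x' y"
      by (simp add: riesz_pot_kern)
  qed
qed

text \<open>The cube is tiled by \<open>m ^ DIM('a)\<close> copies of itself scaled by
  \<open>1 / m\<close>, and each tile receives a scaled copy of one configuration.\<close>

lemma polar_max_cube_scaling:
  assumes m: "m \<ge> 1" and s: "s \<ge> 0"
  shows "ennreal (real m powr s) * polar_max s (cbox (0::'a::euclidean_space) One) n
     \<le> polar_max s (cbox (0::'a) One) (m ^ DIM('a) * n)"
proof -
  define I where "I = PiE (Basis :: 'a set) (\<lambda>_. {..<m})"
  define q where "q k = (\<Sum>i\<in>Basis. (real (k i) / m) *\<^sub>R i)" for k :: "'a \<Rightarrow> nat"
  define g where "g k u = q k + (1 / m) *\<^sub>R u" for k and u :: 'a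
  have qi: "q k \<bullet> i = real (k i) / m" if "i \<in> Basis" for k i using that by (simp add: q_def)
  have I: "finite I" "card I = m ^ DIM('a)" by (auto simp: I_def card_PiE finite_PiE)
  show ?thesis
  proof (rule polar_max_superpose[where I = I and E = "\<lambda>k. g k ` cbox 0 One" and c = "\<lambda>_. 1 / m" and n = "\<lambda>_. n"])
    show "finite I" by (rule I)
    show "(\<Sum>i\<in>I. n) \<le> m ^ DIM('a) * n" using I by simp
    show "cbox (0::'a) One \<noteq> {}" by (simp add: box_ne_empty)
    show "ennreal (real m powr s) * polar_max s (cbox (0::'a) One) n \<le> ennreal ((1 / real m) powr - s) * polar_max s (cbox (0::'a) One) n" for k
      using m by (simp add: powr_divide powr_minus_divide)
    show "lower_piece s TYPE('a) (cbox (0::'a) One) (g k ` cbox 0 One) (1 / real m)" if k: "k \<in> I" for k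
    proof (rule lower_piece_lipschitz)
      fix u v :: 'a
      show "dist (g k u) (g k v) \<le> 1 / real m * dist u v"
        by (simp add: g_def dist_norm flip: scaleR_diff_right)
    next
      fix u :: 'a assume u: "u \<in> cbox 0 One"
      show "g k u \<in> cbox 0 One"
        unfolding mem_box
      proof (intro ballI)
        fix i :: 'a assume i: "i \<in> Basis"
        have "k i + 1 \<le> m" using k i by (auto simp: I_def PiE_def Pi_def)
        then have "real (k i) + 1 \<le> m" by linarith
        then show "0 \<bullet> i \<le> g k u \<bullet> i \<and> g k u \<bullet> i \<le> One \<bullet> i"
          using u i m by (auto simp: g_def qi inner_add_left mem_box field_simps)
      qed
    qed (use m s in auto)
    show "cbox (0::'a) One \<subseteq> (\<Union>k\<in>I. g k ` cbox 0 One)"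
    proof
      fix y :: 'a assume y: "y \<in> cbox 0 One"
      \<comment> \<open>The cap at \<open>m - 1\<close> puts the face
        \<open>y \<bullet> i = 1\<close> into the last tile.\<close>
      define k where "k = (\<lambda>i\<in>Basis. min (m - 1) (nat \<lfloor>m * (y \<bullet> i)\<rfloor>))"
      have kI: "k \<in> I" using m by (auto simp: I_def k_def)
      have b: "0 \<le> m * (y \<bullet> i) - k i \<and> m * (y \<bullet> i) - k i \<le> 1" if i: "i \<in> Basis" for i
      proof -
        have y1: "0 \<le> y \<bullet> i" "y \<bullet> i \<le> 1" using y i by (auto simp: mem_box)
        define t where "t = m * (y \<bullet> i)"
        have t: "0 \<le> t" "t \<le> m" using y1 m by (auto simp: t_def mult_left_le)
        have "k i = min (m - 1) (nat \<lfloor>t\<rfloor>)" using i by (simp add: k_def t_def)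
        then have "k i = m - 1 \<and> real (m - 1) \<le> t \<or> k i = nat \<lfloor>t\<rfloor>" using t by (auto simp: min_def le_nat_iff) linarith
        moreover have "real (m - 1) = real m - 1" using m by (simp add: of_nat_diff)
        moreover have "real (nat \<lfloor>t\<rfloor>) \<le> t" "t \<le> real (nat \<lfloor>t\<rfloor>) + 1" using t by linarith+
        ultimately show ?thesis using t unfolding t_def[symmetric] by (smt (verit))
      qed
      define u where "u = m *\<^sub>R (y - q k)"
      have "u \<in> cbox 0 One"
        unfolding mem_box
      proof (intro ballI)
        fix i :: 'a assume i: "i \<in> Basis"
        have "u \<bullet> i = m * (y \<bullet> i) - k i" using i m by (simp add: u_def inner_diff_left qi right_diff_distrib)
        then show "0 \<bullet> i \<le> u \<bullet> i \<and> u \<bullet> i \<le> One \<bullet> i" using b[OF i] i by simp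
      qed
      moreover have "y = g k u" using m by (simp add: g_def u_def)
      ultimately show "y \<in> (\<Union>k\<in>I. g k ` cbox 0 One)" using kI by blast
    qed
  qed
qed

section \<open>Order of growth on the unit cube and existence of the constant\<close>

lemma dyadic_bracket: "1 \<le> (t::real) \<Longrightarrow> \<exists>k::nat. 2 ^ k \<le> t \<and> t < 2 ^ Suc k"
proof -
  assume t: "1 \<le> t"
  define n where "n = (LEAST n. t < 2 ^ n)"
  have "\<exists>n. t < 2 ^ n" using real_arch_pow[of 2 t] by auto
  then have n: "t < 2 ^ n" unfolding n_def by (rule LeastI_ex)
  then have "n \<noteq> 0" using t by (cases n) auto
  then obtain k where k: "n = Suc k" by (cases n) auto
  have "\<not> t < 2 ^ k" using not_less_Least[of k "\<lambda>n. t < 2 ^ n"] k by (simp add: n_def)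
  then show ?thesis using n k by (intro exI[of _ k]) auto
qed

text \<open>Away from \<open>x\<close> the kernel is dominated by a combination of indicators of
  balls with radii doubling from \<open>r\<close>. Its integral is then a geometric series of ball
  volumes.\<close>

lemma kern_le_dyadic:
  fixes x y :: "'a::euclidean_space"
  assumes r: "r > 0" "r \<le> dist y x" and s: "s \<ge> 0"
  shows "kern s (dist y x) \<le> (\<Sum>k. ennreal ((2 ^ k * r) powr (- s)) * indicator (cball x (2 ^ Suc k * r)) y)"
proof -
  obtain k where k: "2 ^ k \<le> dist y x / r" "dist y x / r < 2 ^ Suc k"
    using dyadic_bracket[of "dist y x / r"] r by auto
  define f where "f k = ennreal ((2 ^ k * r) powr (- s)) * indicator (cball x (2 ^ Suc k * r)) y" for k
  have "kern s (dist y x) \<le> kern s (2 ^ k * r)"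
    using k r s by (intro kern_antimono) (auto simp: field_simps)
  also have "\<dots> = f k"
    using k r by (auto simp: f_def kern_def dist_commute indicator_def field_simps)
  also have "f k \<le> (\<Sum>k. f k)"
    using sum_le_suminf[of f "{k}"] by simp
  finally show ?thesis by (simp add: f_def)
qed

text \<open>Averaging the potential over the cube minus small balls around the points of the configuration,
  which leave at least half of the volume.\<close>

lemma polar_max_cube_upper:
  fixes s :: real
  assumes s: "s > DIM('a::euclidean_space)"
  shows "\<exists>C>0. \<forall>N\<ge>1. polar_max s (cbox (0::'a) One) N \<le> ennreal (C * real N powr (s / DIM('a)))"
proof -
  define d where "d = DIM('a)"
  have d: "d \<ge> 1" by (simp add: d_def DIM_positive Suc_leI)
  define V where "V = unit_ball_vol (real d)"
  have V: "V > 0" by (simp add: V_def unit_ball_vol_eq)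
  \<comment> \<open>Chosen so that \<open>N\<close> balls of radius
    \<open>\<rho> * N powr (- 1 / d)\<close> have total volume 1/2.\<close>
  define \<rho> where "\<rho> = (1 / (2 * V)) powr (1 / d)"
  have \<rho>: "\<rho> > 0" "V * \<rho> ^ d = 1 / 2"
    using V d by (auto simp: \<rho>_def powr_powr powr_realpow[symmetric])
  \<comment> \<open>Passing from one dyadic ball to the next multiplies the volume by
    \<open>2 ^ d\<close> and the kernel by \<open>2 powr (- s)\<close>. This ratio is below 1
    because \<open>s > d\<close>.\<close>
  define b where "b = (2::real) powr (real d - s)"
  have b: "0 < b" "b < 1" using s by (auto simp: b_def d_def powr_less_one)
  \<comment> \<open>The leading 2 compensates for averaging over half of the volume;
    \<open>2 ^ d\<close> occurs because the kernel on the scale \<open>2 ^ k * r\<close> is paired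
    with the ball of radius \<open>2 ^ Suc k * r\<close>.\<close>
  define C where "C = 2 * (V * 2 ^ d * \<rho> powr (d - s) * (1 / (1 - b)))"
  have C: "C > 0" using V \<rho> b by (simp add: C_def)
  have "polar_max s (cbox (0::'a) One) N \<le> ennreal (C * real N powr (s / d))" if N: "N \<ge> 1" for N
    unfolding polar_max_def
  proof (rule SUP_least)
    fix x :: "nat \<Rightarrow> 'a" assume x: "x \<in> configs (cbox 0 One) N"
    define T where "T = polar_config s (cbox (0::'a) One) N x"
    define r where "r = \<rho> * real N powr (- 1 / d)"
    have r: "r > 0" using \<rho> N by (simp add: r_def)
    have rd: "N * (V * r ^ d) = 1 / 2"
    proof -
      have e: "(real N powr (- 1 / d)) ^ d = real N powr (-1)" using N d by (simp add: powr_realpow[symmetric] powr_powr)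
      then have "r ^ d = \<rho> ^ d / N" 
        unfolding r_def power_mult_distrib e using N by (simp add: powr_minus_divide)
      then show ?thesis using \<rho> N by simp
    qed
    define B where "B = (\<Union>j<N. ball (x j) r)"
    define G where "G = cbox (0::'a) One - B"
    have Bs: "B \<in> sets lborel" by (auto simp: B_def)
    have "emeasure lborel B \<le> (\<Sum>j<N. emeasure lborel (ball (x j) r))"
      unfolding B_def by (rule emeasure_subadditive_finite) auto
    also have "\<dots> = (\<Sum>j<N. ennreal (V * r ^ d))"
      using r by (simp add: emeasure_ball V_def d_def unit_ball_vol_eq)
    also have "\<dots> = ennreal (N * (V * r ^ d))" using V r by (simp add: ennreal_mult' ennreal_of_nat_eq_real_of_nat)
    finally have mB: "emeasure lborel B \<le> ennreal (1 / 2)" using rd by simp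
    have "ennreal 1 = emeasure lborel (cbox (0::'a) One)" by (simp add: emeasure_lborel_cbox_eq)
    also have "\<dots> \<le> emeasure lborel (G \<union> B)" by (rule emeasure_mono) (use Bs in \<open>auto simp: G_def\<close>)
    also have "\<dots> \<le> emeasure lborel G + emeasure lborel B" by (rule emeasure_subadditive) (use Bs in \<open>auto simp: G_def\<close>)
    also have "\<dots> \<le> emeasure lborel G + ennreal (1 / 2)" using mB by (rule add_left_mono)
    finally have "ennreal (1 / 2) + ennreal (1 / 2) \<le> emeasure lborel G + ennreal (1 / 2)"
    proof -
      assume le: "ennreal 1 \<le> emeasure lborel G + ennreal (1 / 2)"
      have "ennreal (1 / 2) + ennreal (1 / 2) = ennreal (1 / 2 + 1 / 2)" by (rule ennreal_plus[symmetric]) auto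
      also have "(1 / 2 + 1 / 2 :: real) = 1" by simp
      finally show ?thesis using le by simp
    qed
    then have mG: "ennreal (1 / 2) \<le> emeasure lborel G"
      by (metis add.commute ennreal_add_left_cancel_le ennreal_neq_top infinity_ennreal_def)
    let ?h = "\<lambda>j y. \<Sum>k. ennreal ((2 ^ k * r) powr (- s)) * indicator (cball (x j) (2 ^ Suc k * r)) y"
    have hm: "(\<lambda>y. ennreal ((2 ^ k * r) powr (- s)) * indicator (cball (x j) (2 ^ Suc k * r)) y) \<in> borel_measurable lborel" for k j
      by (intro borel_measurable_times_ennreal borel_measurable_const borel_measurable_indicator) simp
    have pt: "T * indicator G y \<le> (\<Sum>j<N. ?h j y)" for y
    proof (cases "y \<in> G")
      case True
      then have "T \<le> riesz_pot s N x y" unfolding T_def by (intro polar_config_le_pot) (auto simp: G_def)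
      also have "\<dots> \<le> (\<Sum>j<N. ?h j y)"
        unfolding riesz_pot_kern
        by (intro sum_mono kern_le_dyadic) (use True r s in \<open>auto simp: G_def B_def dist_commute not_less\<close>)
      finally show ?thesis using True by simp
    qed simp
    have "T * ennreal (1 / 2) \<le> T * emeasure lborel G" by (rule mult_left_mono[OF mG]) simp
    also have "\<dots> = (\<integral>\<^sup>+y. T * indicator G y \<partial>lborel)"
      using Bs by (intro nn_integral_cmult_indicator[symmetric]) (auto simp: G_def)
    also have "\<dots> \<le> (\<integral>\<^sup>+y. (\<Sum>j<N. ?h j y) \<partial>lborel)" by (rule nn_integral_mono) (rule pt)
    also have "\<dots> = (\<Sum>j<N. \<integral>\<^sup>+y. ?h j y \<partial>lborel)"
      by (rule nn_integral_sum) (rule borel_measurable_suminf_order[OF hm])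
    also have "\<dots> = (\<Sum>j<N. \<Sum>k. ennreal ((2 ^ k * r) powr (- s)) * emeasure lborel (cball (x j) (2 ^ Suc k * r)))"
    proof (intro sum.cong refl)
      fix j
      have "(\<integral>\<^sup>+y. ?h j y \<partial>lborel) = (\<Sum>k. \<integral>\<^sup>+y. ennreal ((2 ^ k * r) powr (- s)) * indicator (cball (x j) (2 ^ Suc k * r)) y \<partial>lborel)"
        by (rule nn_integral_suminf[OF hm])
      also have "\<dots> = (\<Sum>k. ennreal ((2 ^ k * r) powr (- s)) * emeasure lborel (cball (x j) (2 ^ Suc k * r)))"
        by (intro suminf_cong nn_integral_cmult_indicator) simp
      finally show "(\<integral>\<^sup>+y. ?h j y \<partial>lborel) = (\<Sum>k. ennreal ((2 ^ k * r) powr (- s)) * emeasure lborel (cball (x j) (2 ^ Suc k * r)))" .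
    qed
    also have "\<dots> = (\<Sum>j<N. ennreal (V * 2 ^ d * r powr (d - s) * (1 / (1 - b))))"
    proof (intro sum.cong refl)
      fix j
      have t: "ennreal ((2 ^ k * r) powr (- s)) * emeasure lborel (cball (x j) (2 ^ Suc k * r)) = ennreal (V * 2 ^ d * r powr (d - s) * b ^ k)" for k
      proof -
        have "(2 ^ k * r) powr (- s) * (2 ^ Suc k * r) ^ d = 2 ^ d * ((2 ^ k * r) powr (- s) * (2 ^ k * r) ^ d)"
          by (simp add: power_mult_distrib)
        also have "(2 ^ k * r) powr (- s) * (2 ^ k * r) ^ d = (2 ^ k * r) powr (d - s)"
          using r by (simp add: powr_realpow[symmetric] powr_add[symmetric])
        also have "\<dots> = b ^ k * r powr (d - s)"
          using r by (simp add: powr_mult b_def powr_realpow[symmetric] powr_powr mult.commute)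
        finally have p: "(2 ^ k * r) powr (- s) * (V * (2 ^ Suc k * r) ^ d) = V * 2 ^ d * r powr (d - s) * b ^ k"
          by (simp add: algebra_simps)
        have q: "emeasure lborel (cball (x j) (2 ^ Suc k * r)) = ennreal (V * (2 ^ Suc k * r) ^ d)"
          using r by (subst emeasure_cball) (auto simp: V_def d_def unit_ball_vol_eq)
        show ?thesis unfolding q by (subst ennreal_mult'[symmetric]) (simp_all only: p powr_ge_zero)
      qed
      have "(\<lambda>k. V * 2 ^ d * r powr (d - s) * b ^ k) sums (V * 2 ^ d * r powr (d - s) * (1 / (1 - b)))"
        using b by (intro sums_mult geometric_sums) auto
      then show "(\<Sum>k. ennreal ((2 ^ k * r) powr (- s)) * emeasure lborel (cball (x j) (2 ^ Suc k * r))) = ennreal (V * 2 ^ d * r powr (d - s) * (1 / (1 - b)))"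
        unfolding t using V b by (intro suminf_ennreal_eq) auto
    qed
    also have "\<dots> = ennreal (N * (V * 2 ^ d * r powr (d - s) * (1 / (1 - b))))"
      by (simp only: sum_constant card_lessThan ennreal_of_nat_eq_real_of_nat) (rule ennreal_mult'[symmetric], simp)
    also have "N * (V * 2 ^ d * r powr (d - s) * (1 / (1 - b))) = C * real N powr (s / d) * (1 / 2)"
    proof -
      have "r powr (d - s) = \<rho> powr (d - s) * real N powr ((- 1 / d) * (d - s))"
        using \<rho> N by (simp add: r_def powr_mult powr_powr)
      moreover have "N * real N powr ((- 1 / d) * (d - s)) = real N powr (s / d)"
      proof -
        have "N * real N powr ((- 1 / d) * (d - s)) = real N powr (1 + (- 1 / d) * (d - s))"
          using N by (simp only: powr_add) simp
        also have "1 + (- 1 / d) * (d - s) = s / d" using d by (simp add: field_simps)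
        finally show ?thesis .
      qed
      ultimately show ?thesis by (simp add: C_def algebra_simps)
    qed
    also have "ennreal (C * real N powr (s / d) * (1 / 2)) = ennreal (C * real N powr (s / d)) * ennreal (1 / 2)"
      using C by (subst ennreal_mult) auto
    finally have le: "T * ennreal (1 / 2) \<le> ennreal (C * real N powr (s / d)) * ennreal (1 / 2)" .
    have "T * ennreal (1 / 2) * ennreal 2 \<le> ennreal (C * real N powr (s / d)) * ennreal (1 / 2) * ennreal 2"
      by (rule mult_right_mono[OF le]) simp
    moreover have "ennreal (1 / 2) * ennreal 2 = 1"
      by (subst ennreal_mult[symmetric]) auto
    ultimately show "polar_config s (cbox (0::'a) One) N x \<le> ennreal (C * real N powr (s / d))"
      unfolding T_def by (simp only: mult.assoc) simp
  qed
  then show ?thesis using C by (auto simp: d_def)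
qed

text \<open>Tiling by \<open>m ^ d\<close> copies shows that the normalized polarization along \<open>m ^ d * n\<close> is at least its value
  at \<open>n\<close>, so the limit is the supremum; this gives a bound for every \<open>n\<close> and not only an asymptotic one.\<close>

lemma polar_max_cube_limit:
  fixes s :: real
  assumes s: "s > DIM('a::euclidean_space)"
  shows "\<exists>\<sigma>>0. (\<forall>n. polar_max s (cbox (0::'a) One) n \<le> ennreal (\<sigma> * real n powr (s / DIM('a)))) \<and>
     ((\<lambda>N. polar_max s (cbox (0::'a) One) N / ennreal (real N powr (s / DIM('a)))) \<longlonglongrightarrow> ennreal \<sigma>)"
proof -
  define d where "d = DIM('a)"
  have d: "d \<ge> 1" by (simp add: d_def DIM_positive Suc_leI)
  define a where "a = s / d"
  have a: "a > 0" using s d by (simp add: a_def d_def)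
  have s0: "s > 0" using s by (smt (verit) of_nat_0_le_iff)
  have ad: "a * d = s" using d by (simp add: a_def)
  obtain C where C: "C > 0" "\<And>N. N \<ge> 1 \<Longrightarrow> polar_max s (cbox (0::'a) One) N \<le> ennreal (C * real N powr a)"
    using polar_max_cube_upper[OF s] by (auto simp: a_def d_def)
  define F where "F N = enn2real (polar_max s (cbox (0::'a) One) N)" for N
  have z: "polar_max s (cbox (0::'a) One) 0 = 0"
    by (simp add: polar_max_def polar_config_def riesz_pot_def configs_def SUP_constant box_ne_empty)
  have F: "polar_max s (cbox (0::'a) One) N = ennreal (F N)" for N
  proof (cases "N = 0")
    case False
    then have "polar_max s (cbox (0::'a) One) N < top"
      by (intro le_less_trans[OF C(2) ennreal_less_top]) simp
    then show ?thesis by (simp add: F_def)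
  qed (simp add: F_def z)
  have F0: "F N \<ge> 0" for N by (simp add: F_def)
  have FC: "F N \<le> C * real N powr a" if "N \<ge> 1" for N
    using C(2)[OF that] C(1) by (simp add: F)
  have Fmono: "F M \<le> F N" if "M \<le> N" for M N
    using polar_max_mono[of "cbox (0::'a) One" M N s] that F0 by (simp add: F box_ne_empty)
  have Fscale: "real m powr s * F n \<le> F (m ^ d * n)" if "m \<ge> 1" for m n
    using polar_max_cube_scaling[where 'a='a, of m s n] that s0 F0
    by (simp add: F d_def ennreal_mult'[symmetric])
  define \<sigma> where "\<sigma> = (SUP n\<in>{1..}. F n / real n powr a)"
  have bdd: "bdd_above ((\<lambda>n. F n / real n powr a) ` {1..})"
  proof (rule bdd_aboveI2)
    fix n :: nat assume "n \<in> {1..}"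
    then show "F n / real n powr a \<le> C" using FC[of n] by (simp add: pos_divide_le_eq)
  qed
  have up: "F n / real n powr a \<le> \<sigma>" if "n \<ge> 1" for n
    unfolding \<sigma>_def by (rule cSUP_upper[OF _ bdd]) (use that in auto)
  have F1: "F 1 > 0"
  proof -
    obtain D where D: "\<And>u::'a. u \<in> cbox 0 One \<Longrightarrow> norm u \<le> D" "D > 0"
      using bounded_cbox[of "0::'a" One] unfolding bounded_pos by auto
    have "ennreal (D powr (- s)) \<le> polar_config s (cbox (0::'a) One) 1 (\<lambda>_. 0)"
      unfolding polar_config_def
    proof (rule INF_greatest)
      fix y :: 'a assume "y \<in> cbox 0 One"
      then have "kern s D \<le> kern s (dist y 0)" using D s0 by (intro kern_antimono) auto
      then show "ennreal (D powr (- s)) \<le> riesz_pot s 1 (\<lambda>_. 0) y"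
        using D by (simp add: riesz_pot_kern kern_def[of s D])
    qed
    also have "\<dots> \<le> ennreal (F 1)" unfolding F[symmetric]
      by (rule polar_config_le_max) (auto simp: configs_def mem_box)
    finally have "D powr (- s) \<le> F 1" using F0 by simp
    moreover have "D powr (- s) > 0" using D by simp
    ultimately show ?thesis by linarith
  qed
  have \<sigma>0: "\<sigma> > 0" using up[of 1] F1 by simp
  have Fle: "F n \<le> \<sigma> * real n powr a" for n
  proof (cases "n = 0")
    case False
    then show ?thesis using up[of n] by (simp add: pos_divide_le_eq)
  qed (simp add: F_def z)
  have lim: "(\<lambda>N. F N / real N powr a) \<longlonglongrightarrow> \<sigma>"
  proof (rule LIMSEQ_I)
    fix e :: real assume e: "e > 0"
    obtain n where n: "n \<ge> 1" "\<sigma> - e / 2 < F n / real n powr a"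
    proof -
      have "\<sigma> - e / 2 < (SUP n\<in>{1..}. F n / real n powr a)" unfolding \<sigma>_def[symmetric] using e by simp
      then show thesis using less_cSUP_iff[OF _ bdd, of "\<sigma> - e / 2"] that by auto
    qed
    \<comment> \<open>The largest \<open>m\<close> with \<open>m ^ d * n \<le> N\<close>. The points
      lost by rounding cost a factor between \<open>(m / (m + 1)) powr s\<close> and 1, which tends
      to 1.\<close>
    define m where "m N = nat \<lfloor>(real N / n) powr (1 / d)\<rfloor>" for N :: nat
    have tm: "filterlim m at_top sequentially"
      unfolding m_def
    proof (rule filterlim_compose[OF filterlim_nat_sequentially])
      have "filterlim (\<lambda>N. (real N / n) powr (1 / d)) at_top sequentially"
        using n d by real_asymp
      then show "filterlim (\<lambda>N. \<lfloor>(real N / n) powr (1 / d)\<rfloor>) at_top sequentially"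
        by (rule filterlim_compose[OF filterlim_floor_sequentially])
    qed
    have "(\<lambda>k::nat. (real k / (real k + 1)) powr s * (\<sigma> - e / 2)) \<longlonglongrightarrow> 1 * (\<sigma> - e / 2)"
    proof (intro tendsto_mult tendsto_const)
      have "(\<lambda>k::nat. real k / (real k + 1)) \<longlonglongrightarrow> (1::real)" by real_asymp
      from tendsto_powr[OF this tendsto_const, of s]
      have "(\<lambda>k::nat. (real k / (real k + 1)) powr s) \<longlonglongrightarrow> (1::real) powr s" by simp
      then show "(\<lambda>k::nat. (real k / (real k + 1)) powr s) \<longlonglongrightarrow> (1::real)" by simp
    qed
    then have "(\<lambda>N. (real (m N) / (real (m N) + 1)) powr s * (\<sigma> - e / 2)) \<longlonglongrightarrow> 1 * (\<sigma> - e / 2)"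
      by (rule filterlim_compose[OF _ tm])
    then have "eventually (\<lambda>N. (real (m N) / (real (m N) + 1)) powr s * (\<sigma> - e / 2) > \<sigma> - e) sequentially"
      by (rule order_tendstoD) (use e in simp)
    moreover have "eventually (\<lambda>N. m N \<ge> 1) sequentially" using tm by (simp add: filterlim_at_top)
    moreover have "eventually (\<lambda>N. N \<ge> 1) sequentially" by (rule eventually_ge_at_top)
    ultimately have "eventually (\<lambda>N. norm (F N / real N powr a - \<sigma>) < e) sequentially"
    proof eventually_elim
      case (elim N)
      define t where "t = (real N / n) powr (1 / d)"
      have t0: "t > 0" using elim n by (simp add: t_def)
      have m: "real (m N) \<le> t" "t < real (m N) + 1" using t0 unfolding m_def t_def[symmetric] by linarith+
      have td: "t ^ d = real N / n" using elim n d t0 by (simp add: t_def powr_realpow[symmetric] powr_powr)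
      have "real (m N ^ d * n) \<le> t ^ d * n" using m n by (auto intro!: mult_right_mono power_mono)
      also have "t ^ d * n = real N" using n unfolding td by simp
      finally have le: "m N ^ d * n \<le> N" by (simp only: of_nat_le_iff)
      have ts: "t powr s = (real N / n) powr a" using ad d by (simp add: t_def powr_powr a_def)
      have "(real (m N) / (real (m N) + 1)) powr s \<le> (m N / t) powr s"
        using m t0 s0 by (intro powr_mono2 divide_left_mono) auto
      then have "(real (m N) / (real (m N) + 1)) powr s * (\<sigma> - e / 2) \<le> (m N / t) powr s * (F n / real n powr a)"
      \<comment> \<open>For large \<open>e\<close> the number \<open>\<sigma> - e / 2\<close> is
        negative, and the factors cannot be compared one by one.\<close>
      proof (cases "\<sigma> - e / 2 \<ge> 0")
        case True
        then show ?thesis using n \<open>(real (m N) / (real (m N) + 1)) powr s \<le> (m N / t) powr s\<close> by (intro mult_mono) auto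
      next
        case False
        have "(real (m N) / (real (m N) + 1)) powr s * (\<sigma> - e / 2) \<le> 0" using False by (intro mult_nonneg_nonpos) auto
        also have "0 \<le> (m N / t) powr s * (F n / real n powr a)" using F0 by simp
        finally show ?thesis .
      qed
      also have "\<dots> = real (m N) powr s * F n / real N powr a"
        using t0 n elim by (simp add: powr_divide ts)
      also have "\<dots> \<le> F N / real N powr a"
        using Fscale[OF elim(2), of n] Fmono[OF le] by (intro divide_right_mono) auto
      finally have "\<sigma> - e < F N / real N powr a" using elim by linarith
      moreover have "F N / real N powr a \<le> \<sigma>" using up elim by simp
      ultimately show ?case by (simp add: abs_if)
    qed
    then show "\<exists>no. \<forall>N\<ge>no. norm (F N / real N powr a - \<sigma>) < e" by (simp add: eventually_sequentially)
  qed
  have "(\<lambda>N. polar_max s (cbox (0::'a) One) N / ennreal (real N powr a)) \<longlonglongrightarrow> ennreal \<sigma>"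
  proof (rule Lim_transform_eventually)
    show "(\<lambda>N. ennreal (F N / real N powr a)) \<longlonglongrightarrow> ennreal \<sigma>" by (rule tendsto_ennrealI[OF lim])
    show "eventually (\<lambda>N. ennreal (F N / real N powr a) = polar_max s (cbox (0::'a) One) N / ennreal (real N powr a)) sequentially"
      using eventually_ge_at_top[of 1] by eventually_elim (use F0 in \<open>simp add: F divide_ennreal\<close>)
  qed
  then show ?thesis using \<sigma>0 Fle unfolding F a_def d_def by (auto intro!: exI[of _ \<sigma>] ennreal_leI)
qed

subsection \<open>Asymptotic bounds from coverings and packings\<close>

text \<open>The limit serves the lower estimate, where the number of points in every piece tends to
  infinity. The bound for all \<open>n\<close> serves the upper estimate, where a cell may contain
  few points.\<close>

definition cube_const :: "real \<Rightarrow> 'a::euclidean_space itself \<Rightarrow> real \<Rightarrow> bool" where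
  "cube_const s T \<sigma> \<longleftrightarrow> \<sigma> > 0 \<and>
     (\<forall>n. polar_max s (cbox (0::'a) One) n \<le> ennreal (\<sigma> * real n powr (s / DIM('a)))) \<and>
     ((\<lambda>N. polar_max s (cbox (0::'a) One) N / ennreal (real N powr (s / DIM('a)))) \<longlonglongrightarrow> ennreal \<sigma>)"

text \<open>Distribute the \<open>N\<close> points over the pieces in proportion to \<open>c i ^ d\<close>.\<close>

lemma polar_max_lower:
  fixes A :: "'b::metric_space set" and s :: real
  assumes \<sigma>: "cube_const s TYPE('a::euclidean_space) \<sigma>" and s: "s > DIM('a)"
    and I: "finite I" "I \<noteq> {}" and lp: "\<And>i. i \<in> I \<Longrightarrow> lower_piece s TYPE('a) A (E i) (c i)"
    and cov: "A \<subseteq> (\<Union>i\<in>I. E i)" and ne: "A \<noteq> {}"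
    and \<tau>: "\<tau> < \<sigma> * (\<Sum>i\<in>I. c i ^ DIM('a)) powr (- (s / DIM('a)))"
  shows "\<forall>\<^sub>F N in sequentially. ennreal (\<tau> * real N powr (s / DIM('a))) \<le> polar_max s A N"
proof -
  define d where "d = DIM('a)"
  have d: "d \<ge> 1" by (simp add: d_def DIM_positive Suc_leI)
  define a where "a = s / d"
  have s0: "s > 0" using s by (smt (verit) of_nat_0_le_iff)
  have a: "a > 0" using s0 d by (simp add: a_def)
  define S where "S = (\<Sum>i\<in>I. c i ^ d)"
  have c: "c i > 0" if "i \<in> I" for i using lp[OF that] by (simp add: lower_piece_def)
  have S: "S > 0" unfolding S_def using I c by (intro sum_pos) auto
  define p where "p i = c i ^ d / S" for i
  have p: "p i > 0" if "i \<in> I" for i using c[OF that] S by (simp add: p_def)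
  have psum: "(\<Sum>i\<in>I. p i) = 1" using S by (simp add: p_def S_def sum_divide_distrib[symmetric])
  define F where "F N = enn2real (polar_max s (cbox (0::'a) One) N)" for N
  have F0: "F N \<ge> 0" for N by (simp add: F_def)
  have F: "polar_max s (cbox (0::'a) One) N = ennreal (F N)" for N
  proof -
    have "polar_max s (cbox (0::'a) One) N < top"
      using \<sigma> unfolding cube_const_def by (meson ennreal_less_top le_less_trans)
    then show ?thesis by (simp add: F_def)
  qed
  have \<sigma>0: "\<sigma> > 0" using \<sigma> by (simp add: cube_const_def)
  have Flim: "(\<lambda>N. F N / real N powr a) \<longlonglongrightarrow> \<sigma>"
  proof -
    have "(\<lambda>N. ennreal (F N / real N powr a)) \<longlonglongrightarrow> ennreal \<sigma>"
    proof (rule Lim_transform_eventually)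
      show "(\<lambda>N. polar_max s (cbox (0::'a) One) N / ennreal (real N powr a)) \<longlonglongrightarrow> ennreal \<sigma>"
        using \<sigma> by (simp add: cube_const_def a_def d_def)
      show "\<forall>\<^sub>F N in sequentially. polar_max s (cbox (0::'a) One) N / ennreal (real N powr a) = ennreal (F N / real N powr a)"
        using eventually_ge_at_top[of 1] by eventually_elim (use F0 in \<open>simp add: F divide_ennreal\<close>)
    qed
    then show ?thesis by (rule tendsto_ennrealD) (use F0 \<sigma>0 in auto)
  qed
  define n where "n i N = nat \<lfloor>real N * p i\<rfloor>" for i and N :: nat
  have ev: "\<forall>\<^sub>F N in sequentially. \<tau> * real N powr a \<le> c i powr (- s) * F (n i N)" if i: "i \<in> I" for i
  proof -
    have pi: "p i > 0" by (rule p[OF i])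
    have nlim: "(\<lambda>N. real (n i N) / real N) \<longlonglongrightarrow> p i"
    proof (rule tendsto_sandwich[where f = "\<lambda>N. p i - 1 / real N" and h = "\<lambda>N. p i"])
      show "\<forall>\<^sub>F N in sequentially. p i - 1 / real N \<le> real (n i N) / real N"
        using eventually_ge_at_top[of 1]
      proof eventually_elim
        case (elim N)
        have "real N * p i - 1 \<le> real (n i N)" unfolding n_def by linarith
        then have "(real N * p i - 1) / real N \<le> real (n i N) / real N" by (rule divide_right_mono) simp
        then show ?case using elim by (simp add: diff_divide_distrib)
      qed
      show "\<forall>\<^sub>F N in sequentially. real (n i N) / real N \<le> p i"
        using eventually_ge_at_top[of 1]
      proof eventually_elim
        case (elim N)
        have "0 \<le> real N * p i" using pi by simp
        then have "real (n i N) \<le> real N * p i" unfolding n_def by linarith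
        then show ?case using elim by (simp add: field_simps)
      qed
      show "(\<lambda>N. p i - 1 / real N) \<longlonglongrightarrow> p i" by real_asymp
    qed auto
    have ntop: "filterlim (n i) at_top sequentially"
      unfolding n_def
    proof (rule filterlim_compose[OF filterlim_nat_sequentially])
      have "filterlim (\<lambda>N. real N * p i) at_top sequentially" using pi by real_asymp
      then show "filterlim (\<lambda>N. \<lfloor>real N * p i\<rfloor>) at_top sequentially"
        by (rule filterlim_compose[OF filterlim_floor_sequentially])
    qed
    have "(\<lambda>N. c i powr (- s) * (F (n i N) / real (n i N) powr a * (real (n i N) / real N) powr a))
        \<longlonglongrightarrow> c i powr (- s) * (\<sigma> * p i powr a)"
      by (intro tendsto_mult tendsto_const filterlim_compose[OF Flim ntop] tendsto_powr[OF nlim]) (use pi in auto)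
    \<comment> \<open>With shares proportional to \<open>c i ^ d\<close> the limiting value is the
      same for all pieces, so none of them is a bottleneck.\<close>
    also have "c i powr (- s) * (\<sigma> * p i powr a) = \<sigma> * S powr (- a)"
    proof -
      have "p i powr a = (c i ^ d) powr a / S powr a" using c[OF i] S by (simp add: p_def powr_divide)
      also have "(c i ^ d) powr a = c i powr s" using c[OF i] d by (simp add: powr_realpow[symmetric] powr_powr a_def)
      finally show ?thesis using c[OF i] by (simp add: powr_minus field_simps)
    qed
    finally have "\<forall>\<^sub>F N in sequentially. \<tau> < c i powr (- s) * (F (n i N) / real (n i N) powr a * (real (n i N) / real N) powr a)"
      by (rule order_tendstoD(1)) (use \<tau> in \<open>simp add: S_def a_def d_def\<close>)
    moreover have "\<forall>\<^sub>F N in sequentially. n i N \<ge> 1" using ntop by (simp add: filterlim_at_top)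
    moreover have "\<forall>\<^sub>F N in sequentially. N \<ge> (1::nat)" by (rule eventually_ge_at_top)
    ultimately show ?thesis
    proof eventually_elim
      case (elim N)
      then have "\<tau> < c i powr (- s) * F (n i N) / real N powr a"
        by (simp add: powr_divide)
      then show ?case using elim by (simp add: pos_less_divide_eq less_imp_le)
    qed
  qed
  have "\<forall>\<^sub>F N in sequentially. \<forall>i\<in>I. \<tau> * real N powr a \<le> c i powr (- s) * F (n i N)"
    using I(1) ev by (simp add: eventually_ball_finite)
  then show ?thesis
    unfolding d_def[symmetric] a_def[symmetric]
  proof eventually_elim
    case (elim N)
    show ?case
    proof (rule polar_max_superpose[OF I(1) lp cov ne])
      have "real (\<Sum>i\<in>I. n i N) \<le> (\<Sum>i\<in>I. real N * p i)"
        unfolding of_nat_sum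
      proof (rule sum_mono)
        fix i assume "i \<in> I"
        then have "0 \<le> real N * p i" using p by (simp add: less_imp_le)
        then show "real (n i N) \<le> real N * p i" unfolding n_def by linarith
      qed
      also have "\<dots> = real N" by (simp add: sum_distrib_left[symmetric] psum)
      finally show "(\<Sum>i\<in>I. n i N) \<le> N" by (simp only: of_nat_le_iff)
      show "ennreal (\<tau> * real N powr a) \<le> ennreal (c i powr (- s)) * polar_max s (cbox (0::'a) One) (n i N)" if "i \<in> I" for i
        using elim that by (simp add: F ennreal_mult'[symmetric] ennreal_leI)
    qed
  qed
qed

text \<open>\<open>K\<close> behaves from above like a cube of side \<open>c\<close>: the polarization is at most that of the points lying in
  \<open>K\<close>, up to a term linear in \<open>N\<close>, which is negligible because \<open>s > d\<close>.\<close>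

definition upper_cell :: "real \<Rightarrow> real \<Rightarrow> real \<Rightarrow> 'b::metric_space set \<Rightarrow> 'b set \<Rightarrow> real \<Rightarrow> bool" where
  "upper_cell s a \<sigma> A K c \<longleftrightarrow> c > 0 \<and> (\<exists>C\<ge>0. \<forall>N. \<forall>x\<in>configs A N.
     polar_config s A N x \<le> ennreal (C * real N + \<sigma> * c powr (- s) * real (card {j. j < N \<and> x j \<in> K}) powr a))"

text \<open>Evaluate on a slightly smaller cube: points outside \<open>K\<close> are at distance at least \<open>\<delta>\<close>, and projecting
  the remaining ones to the smaller cube only increases the potential there.\<close>

lemma upper_cell_chart:
  fixes g :: "'a::euclidean_space \<Rightarrow> 'b::metric_space" and s :: real
  assumes \<sigma>: "cube_const s TYPE('a) \<sigma>" and s: "s \<ge> 0"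
    and l: "l > 0" and c0: "c0 > 0" and \<delta>: "\<delta> > 0"
    and Q': "\<And>u. u \<in> cbox (0::'a) One \<Longrightarrow> q + l *\<^sub>R u \<in> B"
    and gA: "\<And>u. u \<in> cbox (0::'a) One \<Longrightarrow> g (q + l *\<^sub>R u) \<in> A"
    and g: "\<And>u v. u \<in> B \<Longrightarrow> v \<in> B \<Longrightarrow> c0 * dist u v \<le> dist (g u) (g v)"
    and K: "K \<subseteq> g ` B"
    and sep: "\<And>u y. u \<in> cbox (0::'a) One \<Longrightarrow> y \<in> A - K \<Longrightarrow> \<delta> \<le> dist (g (q + l *\<^sub>R u)) y"
  shows "upper_cell s (s / DIM('a)) \<sigma> A K (c0 * l)"
  unfolding upper_cell_def
proof (intro conjI exI[of _ "\<delta> powr (- s)"] allI ballI)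
  let ?Q = "cbox (0::'a) One"
  fix N x assume x: "x \<in> configs A N"
  define J where "J = {j. j < N \<and> x j \<in> K}"
  define n where "n = card J"
  have fJ: "finite J" by (simp add: J_def)
  then obtain h where h: "bij_betw h {..<n} J" unfolding n_def using ex_bij_betw_nat_finite by (metis atLeast0LessThan)
  define Q1 where "Q1 = (\<lambda>u. q + l *\<^sub>R u) ` ?Q"
  have Q1: "closed Q1" "convex Q1" "Q1 \<noteq> {}"
  proof -
    have "compact Q1" unfolding Q1_def by (intro compact_continuous_image continuous_intros compact_cbox)
    then show "closed Q1" by (rule compact_imp_closed)
    have "Q1 = (\<lambda>x. q + x) ` ((\<lambda>u. l *\<^sub>R u) ` ?Q)" by (auto simp: Q1_def image_image)
    then show "convex Q1" by (simp add: convex_translation convex_scaling convex_box)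
    show "Q1 \<noteq> {}" by (simp add: Q1_def box_ne_empty)
  qed
  have "\<forall>j\<in>J. \<exists>v\<in>B. x j = g v" using K by (auto simp: J_def)
  then obtain v where v: "\<And>j. j \<in> J \<Longrightarrow> v j \<in> B" "\<And>j. j \<in> J \<Longrightarrow> x j = g (v j)" by metis
  have "\<exists>u\<in>?Q. closest_point Q1 (v j) = q + l *\<^sub>R u" for j
    using closest_point_in_set[OF Q1(1,3), of "v j"] by (auto simp: Q1_def)
  then obtain w where w: "\<And>j. w j \<in> ?Q" "\<And>j. closest_point Q1 (v j) = q + l *\<^sub>R w j" by metis
  define z where "z k = w (h k)" for k
  have zc: "z \<in> configs ?Q n" using w by (simp add: z_def configs_def)
  \<comment> \<open>The nearest-point map onto a convex set does not increase distances and fixes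
    the points at which the potential is evaluated.\<close>
  have key: "c0 * l * dist u (w j) \<le> dist (g (q + l *\<^sub>R u)) (x j)" if u: "u \<in> ?Q" and j: "j \<in> J" for u j
  proof -
    have uQ: "q + l *\<^sub>R u \<in> Q1" unfolding Q1_def using u by (rule imageI)
    have "l * dist u (w j) = dist (q + l *\<^sub>R u) (q + l *\<^sub>R w j)" using l by (simp add: dist_norm flip: scaleR_diff_right)
    also have "\<dots> = dist (closest_point Q1 (q + l *\<^sub>R u)) (closest_point Q1 (v j))"
      using closest_point_self[OF uQ] w(2) by simp
    also have "\<dots> \<le> dist (q + l *\<^sub>R u) (v j)" by (rule closest_point_lipschitz[OF Q1(2,1,3)])
    finally have "c0 * (l * dist u (w j)) \<le> c0 * dist (q + l *\<^sub>R u) (v j)" using c0 by simp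
    also have "\<dots> \<le> dist (g (q + l *\<^sub>R u)) (x j)" using g[OF Q'[OF u] v(1)[OF j]] v(2)[OF j] by simp
    finally show ?thesis by (simp add: mult.assoc)
  qed
  have bd: "polar_config s A N x \<le> ennreal (\<delta> powr (- s) * real N) + ennreal ((c0 * l) powr (- s)) * riesz_pot s n z u"
    if u: "u \<in> ?Q" for u
  proof -
    let ?y = "g (q + l *\<^sub>R u)"
    have "polar_config s A N x \<le> (\<Sum>j<N. kern s (dist ?y (x j)))"
      using polar_config_le_pot[OF gA[OF u], of s N x] by (simp add: riesz_pot_kern)
    also have "{..<N} = ({..<N} - J) \<union> J" by (auto simp: J_def)
    also have "(\<Sum>j\<in>({..<N} - J) \<union> J. kern s (dist ?y (x j))) = (\<Sum>j\<in>{..<N} - J. kern s (dist ?y (x j))) + (\<Sum>j\<in>J. kern s (dist ?y (x j)))"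
      using fJ by (intro sum.union_disjoint) auto
    also have "(\<Sum>j\<in>{..<N} - J. kern s (dist ?y (x j))) \<le> (\<Sum>j\<in>{..<N} - J. ennreal (\<delta> powr (- s)))"
    proof (rule sum_mono)
      fix j assume "j \<in> {..<N} - J"
      then have "x j \<in> A - K" using x by (auto simp: J_def configs_def)
      then have "kern s (dist ?y (x j)) \<le> kern s \<delta>" using sep[OF u] \<delta> s by (intro kern_antimono) auto
      then show "kern s (dist ?y (x j)) \<le> ennreal (\<delta> powr (- s))" using \<delta> by (simp add: kern_def)
    qed
    also have "\<dots> \<le> (\<Sum>j<N. ennreal (\<delta> powr (- s)))" by (rule sum_mono2) auto
    also have "\<dots> = ennreal (\<delta> powr (- s) * real N)"
      by (simp only: sum_constant card_lessThan ennreal_of_nat_eq_real_of_nat mult.commute[of "\<delta> powr (- s)"]) (rule ennreal_mult'[symmetric], simp)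
    also have "(\<Sum>j\<in>J. kern s (dist ?y (x j))) \<le> (\<Sum>j\<in>J. ennreal ((c0 * l) powr (- s)) * kern s (dist u (w j)))"
    proof (rule sum_mono)
      fix j assume j: "j \<in> J"
      have "kern s (dist ?y (x j)) \<le> kern s (c0 * l * dist u (w j))"
        using key[OF u j] s c0 l by (intro kern_antimono) auto
      also have "\<dots> = ennreal ((c0 * l) powr (- s)) * kern s (dist u (w j))" using c0 l by (intro kern_scale) auto
      finally show "kern s (dist ?y (x j)) \<le> ennreal ((c0 * l) powr (- s)) * kern s (dist u (w j))" .
    qed
    also have "\<dots> = ennreal ((c0 * l) powr (- s)) * (\<Sum>j\<in>J. kern s (dist u (w j)))" by (simp add: sum_distrib_left)
    also have "(\<Sum>j\<in>J. kern s (dist u (w j))) = riesz_pot s n z u"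
      unfolding riesz_pot_kern z_def by (rule sum.reindex_bij_betw[OF h, symmetric])
    finally show ?thesis by (simp add: add_mono)
  qed
  let ?k = "(c0 * l) powr (- s)"
  have k: "?k > 0" using c0 l by simp
  have pz: "polar_config s ?Q n z \<le> ennreal (\<sigma> * real n powr (s / DIM('a)))"
    using polar_config_le_max[OF zc] \<sigma> unfolding cube_const_def by (meson order_trans)
  have \<sigma>0: "\<sigma> > 0" using \<sigma> by (simp add: cube_const_def)
  have "polar_config s A N x \<le> ennreal (\<delta> powr (- s) * real N + ?k * (\<sigma> * real n powr (s / DIM('a))))"
  \<comment> \<open>The infimum over the cube need not be attained, so a nearly optimal
    \<open>u\<close> is taken. The slack \<open>e / ?k\<close> becomes \<open>e\<close> after
    scaling.\<close>
  proof (rule ennreal_le_epsilon)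
    fix e :: real assume e: "e > 0"
    have "polar_config s ?Q n z < ennreal (\<sigma> * real n powr (s / DIM('a)) + e / ?k)"
      by (rule le_less_trans[OF pz]) (use e k \<sigma>0 in \<open>auto intro!: ennreal_lessI add_nonneg_pos\<close>)
    then obtain u where u: "u \<in> ?Q" "riesz_pot s n z u < ennreal (\<sigma> * real n powr (s / DIM('a)) + e / ?k)"
      unfolding polar_config_def INF_less_iff by blast
    have "polar_config s A N x \<le> ennreal (\<delta> powr (- s) * real N) + ennreal ?k * ennreal (\<sigma> * real n powr (s / DIM('a)) + e / ?k)"
      by (rule order_trans[OF bd[OF u(1)]]) (use u(2) in \<open>auto intro!: add_left_mono mult_left_mono\<close>)
    also have "\<dots> = ennreal (\<delta> powr (- s) * real N + ?k * (\<sigma> * real n powr (s / DIM('a)) + e / ?k))"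
      using k \<sigma>0 e by (subst ennreal_mult'[symmetric]) auto
    also have "\<delta> powr (- s) * real N + ?k * (\<sigma> * real n powr (s / DIM('a)) + e / ?k) = \<delta> powr (- s) * real N + ?k * (\<sigma> * real n powr (s / DIM('a))) + e"
      using k by (simp add: distrib_left)
    also have "ennreal \<dots> = ennreal (\<delta> powr (- s) * real N + ?k * (\<sigma> * real n powr (s / DIM('a)))) + ennreal e"
      using k \<sigma>0 e by (intro ennreal_plus) auto
    finally show "polar_config s A N x \<le> ennreal (\<delta> powr (- s) * real N + ?k * (\<sigma> * real n powr (s / DIM('a)))) + ennreal e" .
  qed
  then show "polar_config s A N x \<le> ennreal (\<delta> powr (- s) * real N + \<sigma> * ?k * real (card {j. j < N \<and> x j \<in> K}) powr (s / DIM('a)))"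
    by (simp add: n_def J_def mult_ac)
qed (use c0 l in auto)

text \<open>By the pigeonhole principle some cell receives at most its share of the points.\<close>

lemma polar_max_upper:
  fixes A :: "'b::metric_space set" and s a :: real and d :: nat
  assumes a: "a = s / d" "a > 1" and \<sigma>: "\<sigma> > 0"
    and I: "finite I" "I \<noteq> {}" and K: "disjoint_family_on K I"
    and uc: "\<And>i. i \<in> I \<Longrightarrow> upper_cell s a \<sigma> A (K i) (c i)"
    and \<tau>: "\<tau> > \<sigma> * (\<Sum>i\<in>I. c i ^ d) powr (- a)"
  shows "\<forall>\<^sub>F N in sequentially. polar_max s A N \<le> ennreal (\<tau> * real N powr a)"
proof -
  have d: "d > 0" using a by (cases d) auto
  define S where "S = (\<Sum>i\<in>I. c i ^ d)"
  have c: "c i > 0" if "i \<in> I" for i using uc[OF that] by (simp add: upper_cell_def)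
  have S: "S > 0" unfolding S_def using I c by (intro sum_pos) auto
  have "\<forall>i\<in>I. \<exists>C. C \<ge> 0 \<and> (\<forall>N. \<forall>x\<in>configs A N.
     polar_config s A N x \<le> ennreal (C * real N + \<sigma> * c i powr (- s) * real (card {j. j < N \<and> x j \<in> K i}) powr a))"
    using uc unfolding upper_cell_def by blast
  from bchoice[OF this] obtain C where C': "\<forall>i\<in>I. C i \<ge> 0 \<and> (\<forall>N. \<forall>x\<in>configs A N.
     polar_config s A N x \<le> ennreal (C i * real N + \<sigma> * c i powr (- s) * real (card {j. j < N \<and> x j \<in> K i}) powr a))"
    by blast
  have C: "\<And>i. i \<in> I \<Longrightarrow> C i \<ge> 0" "\<And>i N x. i \<in> I \<Longrightarrow> x \<in> configs A N \<Longrightarrow>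
     polar_config s A N x \<le> ennreal (C i * real N + \<sigma> * c i powr (- s) * real (card {j. j < N \<and> x j \<in> K i}) powr a)"
    using C' by blast+
  define D where "D = (\<Sum>i\<in>I. C i)"
  have CD: "C i \<le> D" if "i \<in> I" for i unfolding D_def by (rule member_le_sum) (use that C I in auto)
  have main: "polar_max s A N \<le> ennreal (D * real N + \<sigma> * S powr (- a) * real N powr a)" for N
    unfolding polar_max_def
  proof (rule SUP_least)
    fix x assume x: "x \<in> configs A N"
    define n where "n i = card {j. j < N \<and> x j \<in> K i}" for i
    have "\<exists>i\<in>I. real (n i) \<le> real N * (c i ^ d / S)"
    proof (rule ccontr)
      assume "\<not> ?thesis"
      then have "(\<Sum>i\<in>I. real N * (c i ^ d / S)) < (\<Sum>i\<in>I. real (n i))"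
        using I by (intro sum_strict_mono) (auto simp: not_le)
      moreover have "(\<Sum>i\<in>I. real N * (c i ^ d / S)) = real N"
        using S by (simp add: sum_distrib_left[symmetric] sum_divide_distrib[symmetric] S_def)
      moreover have "(\<Sum>i\<in>I. n i) \<le> N"
      proof -
        have "(\<Sum>i\<in>I. n i) = card (\<Union>i\<in>I. {j. j < N \<and> x j \<in> K i})"
          unfolding n_def using K I by (intro card_UN_disjoint[symmetric]) (auto simp: disjoint_family_on_def)
        also have "\<dots> \<le> card {..<N}" by (rule card_mono) auto
        finally show ?thesis by simp
      qed
      ultimately show False by (metis leD of_nat_le_iff of_nat_sum)
    qed
    then obtain i where i: "i \<in> I" "real (n i) \<le> real N * (c i ^ d / S)" by blast
    have "polar_config s A N x \<le> ennreal (C i * real N + \<sigma> * c i powr (- s) * real (n i) powr a)"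
      using C(2)[OF i(1) x] by (simp add: n_def)
    also have "\<dots> \<le> ennreal (D * real N + \<sigma> * S powr (- a) * real N powr a)"
    proof (intro ennreal_leI add_mono mult_right_mono CD[OF i(1)])
      have "real (n i) powr a \<le> (real N * (c i ^ d / S)) powr a" using i a by (intro powr_mono2) auto
      also have "\<dots> = real N powr a * (c i ^ d) powr a / S powr a" using c[OF i(1)] S by (simp add: powr_mult powr_divide)
      also have "(c i ^ d) powr a = c i powr s" using c[OF i(1)] d by (simp add: powr_realpow[symmetric] powr_powr a)
      finally have "\<sigma> * c i powr (- s) * real (n i) powr a \<le> \<sigma> * c i powr (- s) * (real N powr a * c i powr s / S powr a)"
        using \<sigma> by (intro mult_left_mono) auto
      also have "\<dots> = \<sigma> * S powr (- a) * real N powr a"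
        using c[OF i(1)] by (simp add: powr_minus field_simps)
      finally show "\<sigma> * c i powr (- s) * real (n i) powr a \<le> \<sigma> * S powr (- a) * real N powr a" .
    qed simp
    finally show "polar_config s A N x \<le> ennreal (D * real N + \<sigma> * S powr (- a) * real N powr a)" .
  qed
  \<comment> \<open>This is where \<open>a > 1\<close> enters: the contribution of distant points
    has lower order.\<close>
  have "(\<lambda>N. D * real N / real N powr a) \<longlonglongrightarrow> 0" using a by real_asymp
  then have "\<forall>\<^sub>F N in sequentially. D * real N / real N powr a < \<tau> - \<sigma> * S powr (- a)"
    by (rule order_tendstoD(2)) (use \<tau> in \<open>simp add: S_def\<close>)
  then show ?thesis using eventually_ge_at_top[of 1]
  proof eventually_elim
    case (elim N)
    then have "D * real N < (\<tau> - \<sigma> * S powr (- a)) * real N powr a"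
      using pos_divide_less_eq[of "real N powr a"] by simp
    then have "D * real N + \<sigma> * S powr (- a) * real N powr a \<le> \<tau> * real N powr a"
      by (simp add: left_diff_distrib)
    then show ?case using main[of N] by (meson ennreal_leI order_trans)
  qed
qed

text \<open>A cell holding fewer than \<open>\<eta> * N\<close> points would bound the polarization
  by \<open>C * N + w * N powr a\<close> with \<open>w < v\<close>. Optimality, however, forces it
  to be asymptotic to \<open>v * N powr a\<close>.\<close>

lemma asymp_optimal_count:
  fixes A :: "'b::metric_space set" and s a :: real and d :: nat
  assumes a: "a = s / d" "a > 1" and \<sigma>: "\<sigma> > 0" and H: "H > 0"
    and lim: "(\<lambda>N. polar_max s A N / ennreal (real N powr a)) \<longlonglongrightarrow> ennreal (\<sigma> / H powr a)"
    and opt: "asymp_optimal s A \<omega>" and uc: "upper_cell s a \<sigma> A K c"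
    and \<eta>: "\<eta> \<ge> 0" "\<eta> < c ^ d / H"
  shows "\<forall>\<^sub>F N in sequentially. \<eta> * real N \<le> real (card {j. j < N \<and> \<omega> N j \<in> K})"
proof -
  have d: "d > 0" using a by (cases d) auto
  have c: "c > 0" using uc by (simp add: upper_cell_def)
  define v where "v = \<sigma> / H powr a"
  have v: "v > 0" using \<sigma> H by (simp add: v_def)
  let ?P = "\<lambda>N. polar_config s A N (\<omega> N)" and ?M = "polar_max s A"
  have l1: "(\<lambda>N. (?P N / ?M N) * (?M N / ennreal (real N powr a))) \<longlonglongrightarrow> 1 * ennreal v"
    using opt lim unfolding v_def asymp_optimal_def by (intro tendsto_mult_ennreal) auto
  have e1: "\<forall>\<^sub>F N in sequentially. ?M N / ennreal (real N powr a) > 0"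
    by (rule order_tendstoD(1)[OF lim]) (use v in \<open>simp add: v_def\<close>)
  have e2: "\<forall>\<^sub>F N in sequentially. ?M N / ennreal (real N powr a) < top"
    by (rule order_tendstoD(2)[OF lim]) simp
  \<comment> \<open>Cancelling \<open>?M N\<close> requires that it be neither 0 nor
    \<open>top\<close>. Both hold eventually, since the limit is positive and finite.\<close>
  have ev: "\<forall>\<^sub>F N in sequentially. (?P N / ?M N) * (?M N / ennreal (real N powr a)) = ?P N / ennreal (real N powr a)"
    using e1 e2
  proof eventually_elim
    case (elim N)
    have M0: "?M N \<noteq> 0" using elim(1) by auto
    have M1: "?M N < top"
    proof (rule ccontr)
      assume "\<not> ?M N < top"
      then have "?M N = top" by (simp add: not_less top_unique)
      then show False using elim(2) by (simp add: ennreal_top_divide)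
    qed
    have "(?P N / ?M N) * (?M N / ennreal (real N powr a)) = (?P N / ?M N) * ?M N / ennreal (real N powr a)"
      by (rule ennreal_times_divide)
    also have "(?P N / ?M N) * ?M N = ?P N * (?M N / ?M N)" by (rule ennreal_divide_times)
    also have "\<dots> = ?P N" using M0 M1 by (simp add: ennreal_divide_self)
    finally show ?case .
  qed
  have Plim: "(\<lambda>N. ?P N / ennreal (real N powr a)) \<longlonglongrightarrow> ennreal v"
    using Lim_transform_eventually[OF l1 ev] by simp
  define w where "w = \<sigma> * c powr (- s) * \<eta> powr a"
  have wv: "w < v"
  proof -
    have "\<eta> powr a < (c ^ d / H) powr a" using \<eta> a by (intro powr_less_mono2) auto
    also have "\<dots> = c powr s / H powr a"
      using c H d by (simp add: powr_divide powr_realpow[symmetric] powr_powr a)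
    finally have "w < \<sigma> * c powr (- s) * (c powr s / H powr a)" using \<sigma> c unfolding w_def by (intro mult_strict_left_mono) auto
    also have "\<dots> = v" using c by (simp add: v_def powr_minus field_simps)
    finally show ?thesis .
  qed
  have w0: "w \<ge> 0" using \<sigma> by (simp add: w_def)
  obtain C where C: "C \<ge> 0" "\<And>N x. x \<in> configs A N \<Longrightarrow>
     polar_config s A N x \<le> ennreal (C * real N + \<sigma> * c powr (- s) * real (card {j. j < N \<and> x j \<in> K}) powr a)"
    using uc unfolding upper_cell_def by blast
  have "(\<lambda>N. C * real N / real N powr a) \<longlonglongrightarrow> 0" using a by real_asymp
  then have "\<forall>\<^sub>F N in sequentially. C * real N / real N powr a < (v - w) / 2"
    by (rule order_tendstoD(2)) (use wv in simp)
  moreover have "\<forall>\<^sub>F N in sequentially. ennreal ((v + w) / 2) < ?P N / ennreal (real N powr a)"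
    using Plim by (rule order_tendstoD(1)) (use wv w0 in \<open>auto intro!: ennreal_lessI\<close>)
  ultimately show ?thesis using eventually_ge_at_top[of 1]
  proof eventually_elim
    case (elim N)
    show ?case
    proof (rule ccontr)
      define n where "n = card {j. j < N \<and> \<omega> N j \<in> K}"
      assume "\<not> ?thesis"
      then have n: "real n < \<eta> * real N" by (simp add: n_def)
      have Np: "real N powr a > 0" using elim by simp
      have "?P N \<le> ennreal (C * real N + \<sigma> * c powr (- s) * real n powr a)"
        unfolding n_def using opt by (intro C(2)) (simp add: asymp_optimal_def)
      also have "\<dots> \<le> ennreal (C * real N + w * real N powr a)"
      proof (intro ennreal_leI add_left_mono)
        have "real n powr a \<le> (\<eta> * real N) powr a" using n a by (intro powr_mono2) auto
        also have "\<dots> = \<eta> powr a * real N powr a" using \<eta> by (simp add: powr_mult)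
        finally show "\<sigma> * c powr (- s) * real n powr a \<le> w * real N powr a"
          using \<sigma> by (simp add: w_def mult.assoc mult_left_mono)
      qed
      also have "\<dots> \<le> ennreal ((v + w) / 2 * real N powr a)"
      proof (rule ennreal_leI)
        have "C * real N < (v - w) / 2 * real N powr a" using elim(1) Np by (simp add: pos_divide_less_eq)
        then show "C * real N + w * real N powr a \<le> (v + w) / 2 * real N powr a" by (simp add: field_simps)
      qed
      finally have "?P N / ennreal (real N powr a) \<le> ennreal ((v + w) / 2 * real N powr a) / ennreal (real N powr a)"
        by (rule divide_right_mono_ennreal)
      also have "\<dots> = ennreal ((v + w) / 2)" using Np v w0 by (simp add: divide_ennreal)
      finally show False using elim(2) by simp
    qed
  qed
qed

subsection \<open>Almost isometric charts\<close>

text \<open>The last clause makes images of open cubes relatively open in \<open>M\<close>. Removing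
  them from the compact set \<open>A\<close> therefore leaves a compact set, and a compact part of
  such an image has positive distance from the rest of \<open>A\<close>.\<close>

definition near_chart :: "real \<Rightarrow> 'p::euclidean_space set \<Rightarrow> ('d::euclidean_space \<Rightarrow> 'p) \<Rightarrow> real \<Rightarrow> bool" where
  "near_chart \<epsilon> M g r \<longleftrightarrow> r > 0 \<and>
     (\<forall>u\<in>ball 0 r. \<forall>v\<in>ball 0 r. (1 - \<epsilon>) * dist u v \<le> dist (g u) (g v) \<and> dist (g u) (g v) \<le> (1 + \<epsilon>) * dist u v) \<and>
     (\<forall>W. open W \<longrightarrow> W \<subseteq> ball 0 r \<longrightarrow> openin (top_of_set M) (g ` W))"

text \<open>Compose a given chart with the linear map that turns its derivative at the point into an isometry.\<close>

lemma C1_manifold_near_chart: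
  fixes M :: "'p::euclidean_space set"
  assumes M: "C1_manifold TYPE('d::euclidean_space) M" and x: "x \<in> M" and \<epsilon>: "0 < \<epsilon>"
  shows "\<exists>(g :: 'd \<Rightarrow> 'p) r. near_chart \<epsilon> M g r \<and> g 0 = x"
proof -
  obtain U and V :: "'d set" and \<phi> :: "'d \<Rightarrow> 'p" and \<psi> and \<phi>' :: "'d \<Rightarrow> ('d \<Rightarrow>\<^sub>L 'p)" where
    U: "open U" "x \<in> U" and V: "open V" and hom: "homeomorphism V (M \<inter> U) \<phi> \<psi>"
    and der: "\<forall>v\<in>V. (\<phi> has_derivative blinfun_apply (\<phi>' v)) (at v)"
    and cont: "continuous_on V \<phi>'" and inj: "\<forall>v\<in>V. inj (blinfun_apply (\<phi>' v))"
    using M x unfolding C1_manifold_def by metis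
  define v0 where "v0 = \<psi> x"
  have v0: "v0 \<in> V" "\<phi> v0 = x"
    using hom x U unfolding v0_def homeomorphism_def by auto
  define L where "L = blinfun_apply (\<phi>' v0)"
  have L: "linear L" "inj L"
    using inj v0 by (auto simp: L_def blinfun.bounded_linear_right bounded_linear.linear)
  obtain L' where L': "linear L'" "L' \<circ> L = id" using linear_injective_left_inverse[OF L] by blast
  have dimR: "dim (range L) = DIM('d)" using dim_image_eq[OF L(1), of UNIV] L(2) by (simp add: dim_UNIV)
  \<comment> \<open>\<open>f\<close> identifies the parameter space isometrically with the tangent
    space \<open>range L\<close>. Reparametrizing by \<open>T\<close>, the preimage of
    \<open>f\<close> under \<open>L\<close>, turns the derivative at the centre into
    \<open>f\<close>.\<close>
  obtain f :: "'d \<Rightarrow> 'p" where f: "linear f" "f \<in> UNIV \<rightarrow> range L" "\<And>u. norm (f u) = norm u"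
  proof (rule isometry_subset_subspace[of "UNIV :: 'd set" "range L"])
    show "subspace (range L)" using linear_subspace_image[OF L(1) subspace_UNIV] .
    show "dim (UNIV :: 'd set) \<le> dim (range L)" by (simp add: dimR dim_UNIV)
  qed (use that in auto)
  define T where "T = L' \<circ> f"
  have linT: "linear T" unfolding T_def by (rule linear_compose[OF f(1) L'(1)])
  have LT: "L (T u) = f u" for u
  proof -
    obtain w where "f u = L w" using f(2) by blast
    moreover have "L' (L w) = w" using L'(2) by (metis comp_apply id_apply)
    ultimately show ?thesis by (simp add: T_def)
  qed
  have injT: "inj T"
  proof (rule injI)
    fix u v assume "T u = T v"
    then have "f u = f v" using LT by metis
    then have "f (u - v) = 0" by (simp add: linear_diff[OF f(1)])
    then show "u = v" using f(3)[of "u - v"] by simp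
  qed
  then have surjT: "surj T" using linT linear_injective_imp_surjective by blast
  obtain B where B: "B > 0" "\<And>u. norm (T u) \<le> B * norm u" using linear_bounded_pos[OF linT] by blast
  obtain \<delta>1 where \<delta>1: "\<delta>1 > 0" "ball v0 \<delta>1 \<subseteq> V" using V v0 open_contains_ball by blast
  \<comment> \<open>\<open>T\<close> stretches by at most \<open>B\<close>; dividing by
    \<open>B\<close> here yields the error \<open>\<epsilon>\<close> in the new coordinates.\<close>
  have "\<epsilon> / B > 0" using \<epsilon> B by simp
  then obtain \<delta>2 where \<delta>2: "\<delta>2 > 0" "\<And>v. v \<in> V \<Longrightarrow> dist v v0 < \<delta>2 \<Longrightarrow> dist (\<phi>' v) (\<phi>' v0) < \<epsilon> / B"
    using cont v0(1) unfolding continuous_on_iff by metis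
  define \<delta> where "\<delta> = min \<delta>1 \<delta>2"
  have \<delta>: "\<delta> > 0" "ball v0 \<delta> \<subseteq> V" using \<delta>1 \<delta>2 by (auto simp: \<delta>_def)
  define r where "r = \<delta> / B"
  have r: "r > 0" using \<delta> B by (simp add: r_def)
  define g where "g u = \<phi> (v0 + T u)" for u
  have in\<delta>: "v0 + T u \<in> ball v0 \<delta>" if "u \<in> ball 0 r" for u
  proof -
    have "norm (T u) \<le> B * norm u" by (rule B(2))
    also have "\<dots> < B * r" using that B by simp
    finally show ?thesis using B by (simp add: r_def dist_norm)
  qed
  have approx: "norm (g u - g v - f (u - v)) \<le> \<epsilon> * norm (u - v)" if uv: "u \<in> ball 0 r" "v \<in> ball 0 r" for u v
  proof -
    \<comment> \<open>Mean value inequality for \<open>\<phi> - L\<close>, whose derivative is small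
      near \<open>v0\<close> because \<open>\<phi>'\<close> is continuous.\<close>
    have "norm ((\<phi> (v0 + T u) - L (v0 + T u)) - (\<phi> (v0 + T v) - L (v0 + T v))) \<le> \<epsilon> / B * norm ((v0 + T u) - (v0 + T v))"
    proof (rule differentiable_bound[of "ball v0 \<delta>" "\<lambda>w. \<phi> w - L w" "\<lambda>w. blinfun_apply (\<phi>' w - \<phi>' v0)"])
      show "convex (ball v0 \<delta>)" by simp
      fix w assume w: "w \<in> ball v0 \<delta>"
      have "(\<phi> has_derivative blinfun_apply (\<phi>' w)) (at w within ball v0 \<delta>)"
      proof -
        have "w \<in> V" using w \<delta>(2) by blast
        then show ?thesis by (rule has_derivative_at_withinI[OF der[rule_format]])
      qed
      moreover have "(L has_derivative L) (at w within ball v0 \<delta>)"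
        unfolding L_def by (rule bounded_linear_imp_has_derivative[OF blinfun.bounded_linear_right])
      ultimately show "((\<lambda>w. \<phi> w - L w) has_derivative blinfun_apply (\<phi>' w - \<phi>' v0)) (at w within ball v0 \<delta>)"
      proof -
        assume 1: "(\<phi> has_derivative blinfun_apply (\<phi>' w)) (at w within ball v0 \<delta>)"
          and 2: "(L has_derivative L) (at w within ball v0 \<delta>)"
        have "blinfun_apply (\<phi>' w - \<phi>' v0) = (\<lambda>y. blinfun_apply (\<phi>' w) y - L y)"
          by (auto simp: L_def blinfun.diff_left)
        then show ?thesis using has_derivative_diff[OF 1 2] by simp
      qed
      have "norm (\<phi>' w - \<phi>' v0) \<le> \<epsilon> / B"
        using \<delta>2(2)[of w] w \<delta>(2) by (auto simp: \<delta>_def dist_norm dist_commute norm_minus_commute less_imp_le)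
      then show "onorm (blinfun_apply (\<phi>' w - \<phi>' v0)) \<le> \<epsilon> / B" by (simp add: norm_blinfun.rep_eq)
    qed (use in\<delta> uv in auto)
    also have "(\<phi> (v0 + T u) - L (v0 + T u)) - (\<phi> (v0 + T v) - L (v0 + T v)) = g u - g v - f (u - v)"
      by (simp add: g_def linear_add[OF L(1)] LT linear_diff[OF f(1)])
    also have "\<epsilon> / B * norm ((v0 + T u) - (v0 + T v)) \<le> \<epsilon> / B * (B * norm (u - v))"
      using B(2)[of "u - v"] B(1) \<epsilon> by (intro mult_left_mono) (auto simp: linear_diff[OF linT])
    finally show ?thesis using B by simp
  qed
  have "(1 - \<epsilon>) * dist u v \<le> dist (g u) (g v) \<and> dist (g u) (g v) \<le> (1 + \<epsilon>) * dist u v"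
    if "u \<in> ball 0 r" "v \<in> ball 0 r" for u v
  proof -
    have "norm (g u - g v) \<le> norm (f (u - v)) + norm (g u - g v - f (u - v))"
      "norm (f (u - v)) \<le> norm (g u - g v) + norm (g u - g v - f (u - v))"
      using norm_triangle_ineq[of "f (u - v)" "g u - g v - f (u - v)"]
        norm_triangle_ineq4[of "g u - g v" "g u - g v - f (u - v)"] by (simp_all add: algebra_simps)
    then show ?thesis using approx[OF that] f(3)[of "u - v"] by (simp add: dist_norm algebra_simps)
  qed
  moreover have "openin (top_of_set M) (g ` W)" if W: "open W" "W \<subseteq> ball 0 r" for W
  proof -
    have "open ((\<lambda>y. v0 + y) ` (T ` W))"
      by (intro open_translation open_surjective_linear_image[OF W(1) linT surjT])
    moreover have "(\<lambda>y. v0 + y) ` (T ` W) \<subseteq> V" using in\<delta> W(2) \<delta>(2) by blast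
    ultimately have "openin (top_of_set V) ((\<lambda>y. v0 + y) ` (T ` W))" by (simp add: open_openin_trans V)
    then have "openin (top_of_set (M \<inter> U)) (\<phi> ` ((\<lambda>y. v0 + y) ` (T ` W)))"
      by (rule homeomorphism_imp_open_map[OF hom])
    also have "\<phi> ` ((\<lambda>y. v0 + y) ` (T ` W)) = g ` W" by (simp add: image_image g_def)
    finally show ?thesis by (rule openin_trans) (use U(1) in \<open>simp add: openin_open_Int\<close>)
  qed
  moreover have "g 0 = x" using v0 linear_0[OF linT] by (simp add: g_def)
  ultimately show ?thesis using r unfolding near_chart_def by blast
qed

lemma near_chart_continuous:
  fixes g :: "'d::euclidean_space \<Rightarrow> 'p::euclidean_space"
  assumes "near_chart \<epsilon> M g r" shows "continuous_on (ball 0 r) g"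
proof -
  \<comment> \<open>No sign of \<open>\<epsilon>\<close> is assumed, while a Lipschitz constant must
    be nonnegative.\<close>
  have "(max 0 (1 + \<epsilon>))-lipschitz_on (ball 0 r) g"
  proof (rule lipschitz_onI)
    fix u v :: 'd assume "u \<in> ball 0 r" "v \<in> ball 0 r"
    then have "dist (g u) (g v) \<le> (1 + \<epsilon>) * dist u v" using assms by (simp add: near_chart_def)
    also have "\<dots> \<le> max 0 (1 + \<epsilon>) * dist u v" by (intro mult_right_mono) auto
    finally show "dist (g u) (g v) \<le> max 0 (1 + \<epsilon>) * dist u v" .
  qed simp
  then show ?thesis by (rule lipschitz_on_continuous_on)
qed

text \<open>Covering by the half-radius balls leaves room: the closed half-radius ball still lies in
  the chart domain, so compact subsets of \<open>A\<close> have compact preimages there.\<close>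

lemma finite_atlas:
  fixes M :: "'p::euclidean_space set"
  assumes M: "C1_manifold TYPE('d::euclidean_space) M" and A: "compact A" "A \<subseteq> M" and \<epsilon>: "0 < \<epsilon>"
  shows "\<exists>m (g :: nat \<Rightarrow> 'd \<Rightarrow> 'p) r. (\<forall>i<m. near_chart \<epsilon> M (g i) (r i)) \<and> A \<subseteq> (\<Union>i<m. g i ` ball 0 (r i / 2))"
proof -
  have "\<forall>x\<in>A. \<exists>(g :: 'd \<Rightarrow> 'p) r. near_chart \<epsilon> M g r \<and> g 0 = x"
    using C1_manifold_near_chart[OF M _ \<epsilon>] A(2) by blast
  then obtain g :: "'p \<Rightarrow> 'd \<Rightarrow> 'p" and r where gr: "\<And>x. x \<in> A \<Longrightarrow> near_chart \<epsilon> M (g x) (r x) \<and> g x 0 = x" by metis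
  have "\<forall>x\<in>A. \<exists>Y. open Y \<and> g x ` ball 0 (r x / 2) = M \<inter> Y"
  proof
    fix x assume x: "x \<in> A"
    have "ball 0 (r x / 2) \<subseteq> (ball 0 (r x) :: 'd set)" using gr[OF x] by (intro subset_ball) (simp add: near_chart_def)
    then have "openin (top_of_set M) (g x ` ball 0 (r x / 2))"
      using gr[OF x] unfolding near_chart_def by blast
    then show "\<exists>Y. open Y \<and> g x ` ball 0 (r x / 2) = M \<inter> Y" by (simp add: openin_open)
  qed
  then obtain W where W: "\<And>x. x \<in> A \<Longrightarrow> open (W x) \<and> g x ` ball 0 (r x / 2) = M \<inter> W x" by metis
  have "x \<in> W x" if "x \<in> A" for x
  proof -
    have "0 \<in> (ball 0 (r x / 2) :: 'd set)" using gr[OF that] by (simp add: near_chart_def)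
    then have "x \<in> g x ` ball 0 (r x / 2)" using gr[OF that] by (metis imageI)
    then show ?thesis using W[OF that] by blast
  qed
  then have "A \<subseteq> (\<Union>x\<in>A. W x)" by blast
  then obtain X where X: "X \<subseteq> A" "finite X" "A \<subseteq> (\<Union>x\<in>X. W x)"
    using compactE_image[OF A(1), of A W] W by metis
  obtain h where h: "bij_betw h {..<card X} X" using X(2) ex_bij_betw_nat_finite by (metis atLeast0LessThan)
  have hX: "h i \<in> A" if "i < card X" for i using h that X(1) by (auto simp: bij_betw_def)
  have "A \<subseteq> (\<Union>i<card X. g (h i) ` ball 0 (r (h i) / 2))"
  proof
    fix y assume y: "y \<in> A"
    then obtain x where x: "x \<in> X" "y \<in> W x" using X(3) by blast
    then obtain i where i: "i < card X" "x = h i" using h by (auto simp: bij_betw_def)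
    have "y \<in> g x ` ball 0 (r x / 2)" using W[of x] x X(1) y A(2) by blast
    then show "y \<in> (\<Union>i<card X. g (h i) ` ball 0 (r (h i) / 2))" using i by blast
  qed
  moreover have "\<forall>i<card X. near_chart \<epsilon> M (g (h i)) (r (h i))" using gr hX by blast
  ultimately show ?thesis by (intro exI[of _ "card X"] exI[of _ "\<lambda>i. g (h i)"] exI[of _ "\<lambda>i. r (h i)"]) simp
qed

section \<open>Finite systems of cubes filling open sets or covering compact ones\<close>

lemma sum_disjoint_cubes_le:
  fixes F :: "('a::euclidean_space \<times> real) set"
  assumes F: "finite F" "\<And>p. p \<in> F \<Longrightarrow> snd p > 0 \<and> ocube p \<subseteq> U" and U: "U \<in> sets borel"
    and pw: "disjoint_family_on ocube F"
  shows "ennreal (\<Sum>p\<in>F. snd p ^ DIM('a)) \<le> emeasure lborel U"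
proof -
  have "ennreal (\<Sum>p\<in>F. snd p ^ DIM('a)) = (\<Sum>p\<in>F. emeasure lborel (ocube p))"
    using F(2) by (subst sum_ennreal[symmetric]) (auto simp: emeasure_cube less_imp_le intro!: sum.cong)
  also have "\<dots> = emeasure lborel (\<Union>p\<in>F. ocube p)"
    by (rule sum_emeasure) (use F(1) pw in auto)
  also have "\<dots> \<le> emeasure lborel U" by (rule emeasure_mono) (use F(2) U in auto)
  finally show ?thesis .
qed

text \<open>A countable cover of \<open>U\<close> by nonoverlapping cubes is truncated. What is left
  decreases to the empty set and has finite volume, as \<open>U\<close> is bounded, so its volume
  tends to 0.\<close>

lemma finite_disjoint_cubes_exhaust:
  fixes U :: "'a::euclidean_space set"
  assumes U: "open U" "bounded U" and \<delta>: "\<delta> > 0" and \<eta>: "\<eta> > 0"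
  shows "\<exists>F. finite F \<and> (\<forall>p\<in>F. snd p > 0 \<and> ccube p \<subseteq> U \<and> diameter (ccube p) \<le> \<delta>) \<and>
     disjoint_family_on ocube F \<and> emeasure lborel (U - (\<Union>p\<in>F. ccube p)) \<le> ennreal \<eta>"
proof -
  have "\<exists>r>0. ball x r \<subseteq> U \<and> 2 * r \<le> \<delta>" if x: "x \<in> U" for x
  proof -
    obtain r where "r > 0" "ball x r \<subseteq> U" using U(1) x open_contains_ball by blast
    then show ?thesis using \<delta> by (intro exI[of _ "min r (\<delta> / 2)"]) (auto simp: subset_iff)
  qed
  then obtain \<rho> where \<rho>: "\<And>x. x \<in> U \<Longrightarrow> \<rho> x > 0 \<and> ball x (\<rho> x) \<subseteq> U \<and> 2 * \<rho> x \<le> \<delta>" by metis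
  obtain \<C> :: "('a \<times> real) set" where \<C>': "countable \<C> \<and> (\<forall>p\<in>\<C>. snd p > 0 \<and> (\<exists>x\<in>U. ccube p \<subseteq> ball x (\<rho> x))) \<and>
     disjoint_family_on ocube \<C> \<and> U \<subseteq> (\<Union>p\<in>\<C>. ccube p)"
    by (rule exE[OF cube_partition_gauge[OF U(2), of \<rho>, OF \<rho>[THEN conjunct1]]])
  then have \<C>: "countable \<C>" "\<And>p. p \<in> \<C> \<Longrightarrow> snd p > 0 \<and> (\<exists>x\<in>U. ccube p \<subseteq> ball x (\<rho> x))"
     "disjoint_family_on ocube \<C>" "U \<subseteq> (\<Union>p\<in>\<C>. ccube p)"
    by simp_all
  have cub: "snd p > 0 \<and> ccube p \<subseteq> U \<and> diameter (ccube p) \<le> \<delta>" if p: "p \<in> \<C>" for p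
  proof -
    obtain x where x: "x \<in> U" "ccube p \<subseteq> ball x (\<rho> x)" using \<C>(2)[OF p] by blast
    have "diameter (ccube p) \<le> diameter (ball x (\<rho> x))" by (rule diameter_subset[OF x(2)]) simp
    moreover have "ccube p \<subseteq> U" using x \<rho>[OF x(1)] by blast
    ultimately show ?thesis using x \<rho>[OF x(1)] \<C>(2)[OF p] by simp
  qed
  show ?thesis
  proof (cases "\<C> = {}")
    case True
    then have "U = {}" using \<C>(4) by auto
    then show ?thesis by (intro exI[of _ "{}"]) (auto simp: disjoint_family_on_def)
  next
    case False
    let ?f = "from_nat_into \<C>"
    define B where "B n = U - (\<Union>k\<le>n. ccube (?f k))" for n
    have "(\<lambda>n. emeasure lborel (B n)) \<longlonglongrightarrow> emeasure lborel (\<Inter>n. B n)"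
    proof (rule Lim_emeasure_decseq)
      show "range B \<subseteq> sets lborel" using U(1) by (auto simp: B_def)
      show "decseq B" by (auto simp: decseq_def B_def)
      show "emeasure lborel (B n) \<noteq> \<infinity>" for n
        using emeasure_bounded_finite[of "B n"] bounded_subset[OF U(2), of "B n"] by (auto simp: B_def)
    qed
    moreover have "(\<Inter>n. B n) = {}"
    proof -
      have "\<exists>n. x \<in> ccube (?f n)" if xU: "x \<in> U" for x
      proof -
        obtain p where "p \<in> \<C>" "x \<in> ccube p" using xU \<C>(4) by blast
        then show ?thesis using from_nat_into_surj[OF \<C>(1), of p] by auto
      qed
      then show ?thesis by (force simp: B_def)
    qed
    ultimately have "(\<lambda>n. emeasure lborel (B n)) \<longlonglongrightarrow> 0" by simp
    then have "\<forall>\<^sub>F n in sequentially. emeasure lborel (B n) < ennreal \<eta>"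
      by (rule order_tendstoD(2)) (use \<eta> in simp)
    then obtain n where n: "emeasure lborel (B n) < ennreal \<eta>" by (meson eventually_sequentially order_refl)
    have sub: "?f ` {..n} \<subseteq> \<C>" using from_nat_into[OF False] by blast
    show ?thesis
    proof (intro exI[of _ "?f ` {..n}"] conjI ballI)
      show "disjoint_family_on ocube (?f ` {..n})" using \<C>(3) sub by (rule disjoint_family_on_mono[rotated])
      show "emeasure lborel (U - (\<Union>p\<in>?f ` {..n}. ccube p)) \<le> ennreal \<eta>" using n by (simp add: B_def)
    qed (use cub sub in auto)
  qed
qed

text \<open>The cubes of a nonoverlapping cover are doubled, so that compactness leaves finitely many of them.\<close>

lemma compact_cover_cubes:
  fixes P :: "'a::euclidean_space set"
  assumes P: "compact P" "P \<subseteq> U" "open U" and \<eta>: "\<eta> > 0"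
  shows "\<exists>F. finite F \<and> (\<forall>p\<in>F. snd p > 0 \<and> ccube p \<subseteq> U) \<and> P \<subseteq> (\<Union>p\<in>F. ccube p) \<and>
     ennreal (\<Sum>p\<in>F. snd p ^ DIM('a)) \<le> ennreal (2 ^ DIM('a)) * (emeasure lborel P + ennreal \<eta>)"
proof -
  have Pb: "P \<in> sets borel" using P(1) by (simp add: borel_compact)
  then have "P \<in> sets lebesgue" by auto
  then obtain W0 where W0: "open W0" "P \<subseteq> W0" "W0 - P \<in> lmeasurable" "emeasure lebesgue (W0 - P) < ennreal \<eta>"
    by (rule sets_lebesgue_outer_open[OF _ \<eta>])
  define W where "W = W0 \<inter> U"
  have W: "open W" "P \<subseteq> W" "W \<subseteq> U" using W0 P by (auto simp: W_def)
  have mW: "emeasure lborel W \<le> emeasure lborel P + ennreal \<eta>"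
  proof -
    have "emeasure lborel W \<le> emeasure lborel (P \<union> (W0 - P))"
      by (rule emeasure_mono) (use Pb W0 in \<open>auto simp: W_def\<close>)
    also have "\<dots> \<le> emeasure lborel P + emeasure lborel (W0 - P)"
      by (rule emeasure_subadditive) (use Pb W0 in auto)
    also have "emeasure lborel (W0 - P) = emeasure lebesgue (W0 - P)"
      using Pb W0 by (simp add: emeasure_completion)
    finally show ?thesis using W0(4) by (meson add_left_mono less_imp_le order_trans)
  qed
  \<comment> \<open>A cube inside a ball of radius \<open>\<rho>\<close> has side below
    \<open>2 * \<rho>\<close>, and the doubled cube stays within \<open>DIM('a)\<close> times that
    side of it. So \<open>C * \<rho>\<close> bounds the distance from the centre.\<close>
  define C where "C = 1 + 2 * real DIM('a)"
  have C: "C > 0" by (simp add: C_def)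
  have "\<exists>r>0. ball x (C * r) \<subseteq> W" if x: "x \<in> P" for x
  proof -
    obtain r where "r > 0" "ball x r \<subseteq> W" using W x open_contains_ball by blast
    then show ?thesis using C by (intro exI[of _ "r / C"]) auto
  qed
  then obtain \<rho> where \<rho>: "\<And>x. x \<in> P \<Longrightarrow> \<rho> x > 0 \<and> ball x (C * \<rho> x) \<subseteq> W" by metis
  obtain \<C> :: "('a \<times> real) set" where \<C>': "countable \<C> \<and> (\<forall>p\<in>\<C>. snd p > 0 \<and> (\<exists>x\<in>P. ccube p \<subseteq> ball x (\<rho> x))) \<and>
     disjoint_family_on ocube \<C> \<and> P \<subseteq> (\<Union>p\<in>\<C>. ccube p)"
    by (rule exE[OF cube_partition_gauge[OF compact_imp_bounded[OF P(1)], of \<rho>, OF \<rho>[THEN conjunct1]]])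
  then have \<C>: "countable \<C>" "\<And>p. p \<in> \<C> \<Longrightarrow> snd p > 0 \<and> (\<exists>x\<in>P. ccube p \<subseteq> ball x (\<rho> x))"
     "disjoint_family_on ocube \<C>" "P \<subseteq> (\<Union>p\<in>\<C>. ccube p)"
    by simp_all
  \<comment> \<open>The concentric cube of twice the side; its interior contains the original closed
    cube.\<close>
  define h :: "'a \<times> real \<Rightarrow> 'a \<times> real" where "h p = (fst p - (snd p / 2) *\<^sub>R One, 2 * snd p)" for p
  have mem_h: "y \<in> ccube (h p) \<longleftrightarrow> (\<forall>i\<in>Basis. fst p \<bullet> i - snd p / 2 \<le> y \<bullet> i \<and> y \<bullet> i \<le> fst p \<bullet> i + 3 * snd p / 2)"
    "y \<in> ocube (h p) \<longleftrightarrow> (\<forall>i\<in>Basis. fst p \<bullet> i - snd p / 2 < y \<bullet> i \<and> y \<bullet> i < fst p \<bullet> i + 3 * snd p / 2)" for y p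
    by (auto simp: h_def ccube_def ocube_def mem_box inner_add_left inner_diff_left field_simps)
  have mem_c: "y \<in> ccube p \<longleftrightarrow> (\<forall>i\<in>Basis. fst p \<bullet> i \<le> y \<bullet> i \<and> y \<bullet> i \<le> fst p \<bullet> i + snd p)" for y p
    by (auto simp: ccube_def mem_box inner_add_left)
  have hW: "ccube p \<subseteq> W \<and> ccube (h p) \<subseteq> W \<and> ccube p \<subseteq> ocube (h p)" if p: "p \<in> \<C>" for p
  proof -
    define l where "l = snd p"
    obtain x where x: "x \<in> P" "ccube p \<subseteq> ball x (\<rho> x)" using \<C>(2)[OF p] by blast
    have l: "l > 0" using \<C>(2)[OF p] by (simp add: l_def)
    obtain b :: 'a where b: "b \<in> Basis" using nonempty_Basis by blast
    have cs: "fst p \<in> ccube p" "fst p + l *\<^sub>R b \<in> ccube p"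
      using l b by (auto simp: mem_c inner_add_left inner_Basis l_def)
    have "l = dist (fst p) (fst p + l *\<^sub>R b)" using l b by (simp add: dist_norm)
    also have "\<dots> \<le> dist x (fst p) + dist x (fst p + l *\<^sub>R b)" by (rule dist_triangle3)
    also have "\<dots> < 2 * \<rho> x"
    proof -
      have "dist x (fst p) < \<rho> x" "dist x (fst p + l *\<^sub>R b) < \<rho> x" using cs x(2) by (meson mem_ball subsetD)+
      then show ?thesis by linarith
    qed
    finally have l2: "l < 2 * \<rho> x" .
    have "ccube (h p) \<subseteq> ball x (C * \<rho> x)"
    proof
      fix z assume z: "z \<in> ccube (h p)"
      \<comment> \<open>\<open>y\<close> is \<open>z\<close> clamped into the cube coordinate by
        coordinate.\<close>
      define y where "y = (\<Sum>i\<in>Basis. (max (fst p \<bullet> i) (min (fst p \<bullet> i + l) (z \<bullet> i))) *\<^sub>R i)"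
      have yi: "y \<bullet> i = max (fst p \<bullet> i) (min (fst p \<bullet> i + l) (z \<bullet> i))" if "i \<in> Basis" for i
        using that by (simp add: y_def)
      have "y \<in> ccube p" using l by (auto simp: mem_c yi l_def)
      then have "dist x y < \<rho> x" using x(2) by (meson mem_ball subsetD)
      moreover have "dist y z \<le> DIM('a) * l"
      proof -
        have "dist y z \<le> (\<Sum>i\<in>Basis. \<bar>(y - z) \<bullet> i\<bar>)" unfolding dist_norm by (rule norm_le_l1)
        also have "\<dots> \<le> (\<Sum>i\<in>(Basis::'a set). l)"
        proof (rule sum_mono)
          fix i :: 'a assume i: "i \<in> Basis"
          have "fst p \<bullet> i - l / 2 \<le> z \<bullet> i \<and> z \<bullet> i \<le> fst p \<bullet> i + 3 * l / 2" using z i unfolding mem_h l_def by blast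
          then show "\<bar>(y - z) \<bullet> i\<bar> \<le> l" using l by (auto simp: inner_diff_left yi[OF i] max_def min_def)
        qed
        finally show ?thesis by simp
      qed
      moreover have "DIM('a) * l \<le> DIM('a) * (2 * \<rho> x)" using l2 by (intro mult_left_mono) auto
      ultimately have "dist x z < \<rho> x + DIM('a) * (2 * \<rho> x)" using dist_triangle[of x z y] by linarith
      then show "z \<in> ball x (C * \<rho> x)" by (simp add: C_def algebra_simps)
    qed
    then have 1: "ccube (h p) \<subseteq> W" using \<rho>[OF x(1)] by blast
    have 2: "ccube p \<subseteq> ocube (h p)"
    proof
      fix y assume y: "y \<in> ccube p"
      have "fst p \<bullet> i - snd p / 2 < y \<bullet> i \<and> y \<bullet> i < fst p \<bullet> i + 3 * snd p / 2" if i: "i \<in> Basis" for i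
      proof -
        have "fst p \<bullet> i \<le> y \<bullet> i" "y \<bullet> i \<le> fst p \<bullet> i + snd p" using y i unfolding mem_c by blast+
        then show ?thesis using l unfolding l_def by (intro conjI) linarith+
      qed
      then show "y \<in> ocube (h p)" unfolding mem_h by blast
    qed
    show ?thesis using 1 2 ocube_subset_ccube by blast
  qed
  have "P \<subseteq> (\<Union>p\<in>\<C>. ocube (h p))" using \<C>(4) hW by blast
  then obtain F where F: "F \<subseteq> \<C>" "finite F" "P \<subseteq> (\<Union>p\<in>F. ocube (h p))"
    using compactE_image[OF P(1), of \<C> "\<lambda>p. ocube (h p)"] by (metis open_ocube)
  have injh: "inj_on h F" by (auto simp: inj_on_def h_def prod_eq_iff)
  have "ennreal (\<Sum>p\<in>F. snd p ^ DIM('a)) \<le> emeasure lborel W"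
  proof (rule sum_disjoint_cubes_le[OF F(2)])
    show "disjoint_family_on ocube F" using \<C>(3) F(1) by (rule disjoint_family_on_mono[rotated])
    show "0 < snd p \<and> ocube p \<subseteq> W" if "p \<in> F" for p
      using that F(1) \<C>(2)[of p] hW[of p] ocube_subset_ccube[of p] by blast
  qed (use W in auto)
  also note mW
  finally have s: "ennreal (\<Sum>p\<in>F. snd p ^ DIM('a)) \<le> emeasure lborel P + ennreal \<eta>" .
  have "(\<Sum>p\<in>h ` F. snd p ^ DIM('a)) = 2 ^ DIM('a) * (\<Sum>p\<in>F. snd p ^ DIM('a))"
    unfolding sum.reindex[OF injh] comp_def by (simp add: h_def power_mult_distrib sum_distrib_left)
  then have "ennreal (\<Sum>p\<in>h ` F. snd p ^ DIM('a)) = ennreal (2 ^ DIM('a)) * ennreal (\<Sum>p\<in>F. snd p ^ DIM('a))"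
    by (simp add: ennreal_mult')
  also have "\<dots> \<le> ennreal (2 ^ DIM('a)) * (emeasure lborel P + ennreal \<eta>)" by (rule mult_left_mono[OF s]) simp
  finally have "ennreal (\<Sum>p\<in>h ` F. snd p ^ DIM('a)) \<le> ennreal (2 ^ DIM('a)) * (emeasure lborel P + ennreal \<eta>)" .
  moreover have "\<forall>p\<in>h ` F. snd p > 0 \<and> ccube p \<subseteq> U"
    using F(1) \<C>(2) hW W(3) by (fastforce simp: h_def)
  moreover have "P \<subseteq> (\<Union>p\<in>h ` F. ccube p)" 
  proof
    fix y assume "y \<in> P"
    then obtain p where p: "p \<in> F" "y \<in> ocube (h p)" using F(3) by blast
    then have "y \<in> ccube (h p)" using ocube_subset_ccube by blast
    then show "y \<in> (\<Union>p\<in>h ` F. ccube p)" using p(1) by blast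
  qed
  ultimately show ?thesis using F(2) by (intro exI[of _ "h ` F"]) auto
qed

subsection \<open>Cells and pieces of a manifold\<close>

lemma near_chart_dist:
  assumes "near_chart \<epsilon> M g r" "u \<in> ball 0 r" "v \<in> ball 0 r"
  shows "(1 - \<epsilon>) * dist u v \<le> dist (g u) (g v)" "dist (g u) (g v) \<le> (1 + \<epsilon>) * dist u v"
  using assms unfolding near_chart_def by blast+

lemma near_chart_openin:
  assumes "near_chart \<epsilon> M g r" "open W" "W \<subseteq> ball 0 r" shows "openin (top_of_set M) (g ` W)"
  using assms unfolding near_chart_def by blast

lemma near_chart_subset:
  assumes "near_chart \<epsilon> M g r" shows "g ` ball 0 r \<subseteq> M"
  using near_chart_openin[OF assms open_ball order_refl] openin_imp_subset by blast

lemma near_chart_inj: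
  assumes "near_chart \<epsilon> M g r" "\<epsilon> < 1" shows "inj_on g (ball 0 r)"
proof (rule inj_onI)
  fix u v assume "u \<in> ball 0 r" "v \<in> ball 0 r" "g u = g v"
  then have "(1 - \<epsilon>) * dist u v \<le> 0" using near_chart_dist(1)[OF assms(1)] by fastforce
  then show "u = v" using assms(2) by (simp add: mult_le_0_iff)
qed

lemma hausdorff_near_chart_le:
  fixes g :: "'d::euclidean_space \<Rightarrow> 'p::euclidean_space"
  assumes g: "near_chart \<epsilon> M g r" and \<epsilon>: "0 < \<epsilon>" and S: "S \<subseteq> ball 0 r" "S \<in> sets borel"
  shows "hausdorff_outer DIM('d) (g ` S) \<le> ennreal ((1 + \<epsilon>) ^ DIM('d)) * emeasure lborel S"
proof -
  have "hausdorff_outer DIM('d) (g ` S) \<le> ennreal ((1 + \<epsilon>) powr DIM('d)) * hausdorff_outer DIM('d) S"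
  proof (rule hausdorff_outer_lipschitz_image)
    fix x y assume "x \<in> S" "y \<in> S"
    then have "x \<in> ball 0 r" "y \<in> ball 0 r" using S(1) by blast+
    then show "dist (g x) (g y) \<le> (1 + \<epsilon>) * dist x y" by (rule near_chart_dist(2)[OF g])
  qed (use \<epsilon> in auto)
  then show ?thesis using \<epsilon> by (simp add: hausdorff_outer_eq_lborel[OF S(2)] powr_realpow)
qed

lemma lborel_le_hausdorff_near_chart:
  fixes g :: "'d::euclidean_space \<Rightarrow> 'p::euclidean_space"
  assumes g: "near_chart \<epsilon> M g r" and \<epsilon>: "\<epsilon> < 1" and S: "S \<subseteq> ball 0 r" "S \<in> sets borel"
  shows "emeasure lborel S \<le> ennreal ((1 / (1 - \<epsilon>)) ^ DIM('d)) * hausdorff_outer DIM('d) (g ` S)"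
proof -
  define h where "h = inv_into (ball 0 r) g"
  have h: "h (g u) = u" if "u \<in> ball 0 r" for u
    unfolding h_def by (rule inv_into_f_f[OF near_chart_inj[OF g \<epsilon>] that])
  have im: "h ` (g ` S) = S" using h S(1) by (force simp: image_image)
  have "hausdorff_outer DIM('d) (h ` (g ` S)) \<le> ennreal ((1 / (1 - \<epsilon>)) powr DIM('d)) * hausdorff_outer DIM('d) (g ` S)"
  proof (rule hausdorff_outer_lipschitz_image)
    fix x y assume "x \<in> g ` S" "y \<in> g ` S"
    then obtain u v where uv: "u \<in> S" "v \<in> S" "x = g u" "y = g v" by blast
    then have "u \<in> ball 0 r" "v \<in> ball 0 r" using S(1) by auto
    then show "dist (h x) (h y) \<le> 1 / (1 - \<epsilon>) * dist x y"
      using near_chart_dist(1)[OF g] h uv \<epsilon> by (simp add: field_simps)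
  qed (use \<epsilon> in auto)
  then show ?thesis unfolding im hausdorff_outer_eq_lborel[OF S(2)] using \<epsilon> by (simp add: powr_realpow)
qed

lemma chart_cells:
  fixes g :: "'d::euclidean_space \<Rightarrow> 'p::euclidean_space"
  assumes g: "near_chart \<epsilon> M g r" and \<epsilon>: "0 < \<epsilon>" "\<epsilon> < 1" and G: "openin (top_of_set M) G"
    and \<delta>: "\<delta> > 0" and \<eta>: "\<eta> > 0"
  shows "\<exists>F. finite F \<and> (\<forall>p\<in>F. snd p > 0 \<and> ccube p \<subseteq> ball 0 r \<and> g ` ccube p \<subseteq> G \<and> (\<forall>x\<in>g ` ccube p. \<forall>y\<in>g ` ccube p. dist x y \<le> \<delta>))
     \<and> disjoint_family_on ocube F \<and>
     hausdorff_outer DIM('d) (G \<inter> g ` ball 0 r - (\<Union>p\<in>F. g ` ccube p)) \<le> ennreal \<eta>"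
proof -
  obtain Y where Y: "open Y" "G = M \<inter> Y" using G by (auto simp: openin_open)
  define W where "W = ball 0 r \<inter> g -` Y"
  have W: "open W" "bounded W"
    using continuous_open_preimage[OF near_chart_continuous[OF g] open_ball Y(1)] bounded_subset[OF bounded_ball, of W 0 r]
    by (auto simp: W_def)
  have gW: "g u \<in> G" if "u \<in> W" for u using that near_chart_subset[OF g] Y by (auto simp: W_def)
  \<comment> \<open>As \<open>1 + \<epsilon> < 2\<close>, the chart at most doubles lengths and
    multiplies measure by at most \<open>2 ^ DIM('d)\<close>. The tolerances in the parameter space
    are reduced accordingly.\<close>
  have \<eta>': "\<eta> / 2 ^ DIM('d) > 0" and \<delta>': "\<delta> / 2 > 0" using \<eta> \<delta> by auto
  obtain F where F: "finite F" "\<forall>p\<in>F. snd p > 0 \<and> ccube p \<subseteq> W \<and> diameter (ccube p) \<le> \<delta> / 2"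
     "disjoint_family_on ocube F" "emeasure lborel (W - (\<Union>p\<in>F. ccube p)) \<le> ennreal (\<eta> / 2 ^ DIM('d))"
    using finite_disjoint_cubes_exhaust[OF W \<delta>' \<eta>'] by blast
  show ?thesis
  proof (intro exI[of _ F] conjI ballI F(1,3))
    fix p assume p: "p \<in> F"
    show "snd p > 0" "ccube p \<subseteq> ball 0 r" using F(2) p by (auto simp: W_def)
    show "g ` ccube p \<subseteq> G" using F(2) p gW by blast
    fix x y assume "x \<in> g ` ccube p" "y \<in> g ` ccube p"
    then obtain u v where uv: "u \<in> ccube p" "v \<in> ccube p" "x = g u" "y = g v" by blast
    have "dist u v \<le> \<delta> / 2"
      using diameter_bounded_bound[OF compact_imp_bounded[OF compact_ccube] uv(1,2)] F(2) p by fastforce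
    moreover have "dist x y \<le> (1 + \<epsilon>) * dist u v"
    proof -
      have "ccube p \<subseteq> ball 0 r" using F(2) p by (auto simp: W_def)
      then have "u \<in> ball 0 r" "v \<in> ball 0 r" using uv(1,2) by blast+
      then show ?thesis unfolding uv by (rule near_chart_dist(2)[OF g])
    qed
    moreover have "(1 + \<epsilon>) * dist u v \<le> 2 * dist u v" using \<epsilon> by (intro mult_right_mono) auto
    ultimately show "dist x y \<le> \<delta>" by linarith
  next
    have "hausdorff_outer DIM('d) (G \<inter> g ` ball 0 r - (\<Union>p\<in>F. g ` ccube p)) \<le> hausdorff_outer DIM('d) (g ` (W - (\<Union>p\<in>F. ccube p)))"
      by (rule hausdorff_outer_mono) (auto simp: W_def Y(2))
    also have "\<dots> \<le> ennreal ((1 + \<epsilon>) ^ DIM('d)) * emeasure lborel (W - (\<Union>p\<in>F. ccube p))"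
    proof (rule hausdorff_near_chart_le[OF g \<epsilon>(1)])
      have "W \<in> sets borel" using W(1) by simp
      moreover have "(\<Union>p\<in>F. ccube p) \<in> sets borel" using F(1) by (intro sets.finite_UN) auto
      ultimately show "W - (\<Union>p\<in>F. ccube p) \<in> sets borel" by (rule sets.Diff)
    qed (auto simp: W_def)
    also have "\<dots> \<le> ennreal (2 ^ DIM('d)) * ennreal (\<eta> / 2 ^ DIM('d))"
      using \<epsilon> F(4) by (intro mult_mono ennreal_leI power_mono) auto
    also have "\<dots> = ennreal \<eta>" using \<eta> by (simp add: ennreal_mult[symmetric])
    finally show "hausdorff_outer DIM('d) (G \<inter> g ` ball 0 r - (\<Union>p\<in>F. g ` ccube p)) \<le> ennreal \<eta>" .
  qed
qed

text \<open>The charts are treated one after the other, each time removing the closed cells already chosen;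
  hence overlapping charts do no harm.\<close>

lemma atlas_cells:
  fixes g :: "nat \<Rightarrow> 'd::euclidean_space \<Rightarrow> 'p::euclidean_space"
  assumes g: "\<And>i. i < m \<Longrightarrow> near_chart \<epsilon> M (g i) (r i)" and \<epsilon>: "0 < \<epsilon>" "\<epsilon> < 1" and G: "openin (top_of_set M) G"
    and \<delta>: "\<delta> > 0" and \<eta>: "\<eta> > 0"
  shows "\<exists>I. finite I \<and> (\<forall>(i, p)\<in>I. i < m \<and> snd p > 0 \<and> ccube p \<subseteq> ball 0 (r i) \<and> g i ` ccube p \<subseteq> G \<and>
         (\<forall>x\<in>g i ` ccube p. \<forall>y\<in>g i ` ccube p. dist x y \<le> \<delta>))
     \<and> disjoint_family_on (\<lambda>(i, p). g i ` ocube p) I \<and>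
     hausdorff_outer DIM('d) (G \<inter> (\<Union>i<m. g i ` ball 0 (r i)) - (\<Union>(i, p)\<in>I. g i ` ccube p)) \<le> ennreal (real m * \<eta>)"
  using g
proof (induction m)
  case 0
  show ?case by (intro exI[of _ "{}"]) (auto simp: disjoint_family_on_def)
next
  case (Suc m)
  have "\<And>i. i < m \<Longrightarrow> near_chart \<epsilon> M (g i) (r i)" using Suc.prems by simp
  from Suc.IH[OF this] obtain I where I: "finite I"
    "\<forall>(i, p)\<in>I. i < m \<and> snd p > 0 \<and> ccube p \<subseteq> ball 0 (r i) \<and> g i ` ccube p \<subseteq> G \<and>
         (\<forall>x\<in>g i ` ccube p. \<forall>y\<in>g i ` ccube p. dist x y \<le> \<delta>)"
    "disjoint_family_on (\<lambda>(i, p). g i ` ocube p) I"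
    "hausdorff_outer DIM('d) (G \<inter> (\<Union>i<m. g i ` ball 0 (r i)) - (\<Union>(i, p)\<in>I. g i ` ccube p)) \<le> ennreal (real m * \<eta>)"
    by blast
  define C where "C = (\<Union>(i, p)\<in>I. g i ` ccube p)"
  have gm: "near_chart \<epsilon> M (g m) (r m)" using Suc.prems by simp
  have "compact (g i ` ccube p)" if ip: "(i, p) \<in> I" for i p
  proof (rule compact_continuous_image[OF _ compact_ccube])
    have "i < Suc m" "ccube p \<subseteq> ball 0 (r i)" using I(2) ip by auto
    then show "continuous_on (ccube p) (g i)"
      using near_chart_continuous[OF Suc.prems[of i]] continuous_on_subset by blast
  qed
  then have "compact C" unfolding C_def using I(1) by (intro compact_UN) auto
  then have "closed C" by (rule compact_imp_closed)
  then have "openin (top_of_set M) (G - C)"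
  proof -
    obtain Y where Y: "open Y" "G = M \<inter> Y" using G by (auto simp: openin_open)
    have "G - C = M \<inter> (Y - C)" using Y by auto
    moreover have "open (Y - C)" using Y(1) \<open>closed C\<close> by (rule open_Diff)
    ultimately show ?thesis by (auto simp: openin_open)
  qed
  from chart_cells[OF gm \<epsilon> this \<delta> \<eta>] obtain F where F: "finite F"
    "\<forall>p\<in>F. snd p > 0 \<and> ccube p \<subseteq> ball 0 (r m) \<and> g m ` ccube p \<subseteq> G - C \<and> (\<forall>x\<in>g m ` ccube p. \<forall>y\<in>g m ` ccube p. dist x y \<le> \<delta>)"
    "disjoint_family_on ocube F"
    "hausdorff_outer DIM('d) ((G - C) \<inter> g m ` ball 0 (r m) - (\<Union>p\<in>F. g m ` ccube p)) \<le> ennreal \<eta>"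
    by blast
  define I' where "I' = I \<union> Pair m ` F"
  have C': "(\<Union>(i, p)\<in>I'. g i ` ccube p) = C \<union> (\<Union>p\<in>F. g m ` ccube p)" by (auto simp: I'_def C_def)
  show ?case
  proof (intro exI[of _ I'] conjI)
    show "finite I'" using I(1) F(1) by (simp add: I'_def)
    show "\<forall>(i, p)\<in>I'. i < Suc m \<and> snd p > 0 \<and> ccube p \<subseteq> ball 0 (r i) \<and> g i ` ccube p \<subseteq> G \<and>
         (\<forall>x\<in>g i ` ccube p. \<forall>y\<in>g i ` ccube p. dist x y \<le> \<delta>)"
    proof
      fix q assume "q \<in> I'"
      then consider "q \<in> I" | p where "q = (m, p)" "p \<in> F" by (auto simp: I'_def)
      then show "case q of (i, p) \<Rightarrow> i < Suc m \<and> snd p > 0 \<and> ccube p \<subseteq> ball 0 (r i) \<and> g i ` ccube p \<subseteq> G \<and>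
         (\<forall>x\<in>g i ` ccube p. \<forall>y\<in>g i ` ccube p. dist x y \<le> \<delta>)"
      proof cases
        case 1 then show ?thesis using bspec[OF I(2) 1] by (auto split: prod.splits)
      next
        case 2 then show ?thesis using bspec[OF F(2) 2(2)] by (simp, blast)
      qed
    qed
    show "disjoint_family_on (\<lambda>(i, p). g i ` ocube p) I'"
      unfolding disjoint_family_on_def
    proof (intro ballI impI)
      have old: "(case q of (i, p) \<Rightarrow> g i ` ocube p) \<subseteq> C" if "q \<in> I" for q
        using that ocube_subset_ccube unfolding C_def by (cases q) blast
      have new: "g m ` ocube p \<inter> C = {}" if "p \<in> F" for p
        using bspec[OF F(2) that] ocube_subset_ccube[of p] by blast
      fix q q' assume q: "q \<in> I'" "q' \<in> I'" "q \<noteq> q'"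
      consider "q \<in> I" "q' \<in> I" | p where "q \<in> I" "q' = (m, p)" "p \<in> F" | p where "q = (m, p)" "p \<in> F" "q' \<in> I"
        | p p' where "q = (m, p)" "q' = (m, p')" "p \<in> F" "p' \<in> F"
        using q(1,2) unfolding I'_def by blast
      then show "(case q of (i, p) \<Rightarrow> g i ` ocube p) \<inter> (case q' of (i, p) \<Rightarrow> g i ` ocube p) = {}"
      proof cases
        case 1
        then show ?thesis using I(3) q(3) unfolding disjoint_family_on_def by blast
      next
        case 2 then show ?thesis using old[OF 2(1)] new[OF 2(3)] by (simp, blast)
      next
        case 3 then show ?thesis using old[OF 3(3)] new[OF 3(2)] by (simp, blast)
      next
        case 4
        then have "ocube p \<inter> ocube p' = {}" using F(3) q(3) unfolding disjoint_family_on_def by blast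
        moreover have "ocube p \<subseteq> ball 0 (r m)" using bspec[OF F(2) 4(3)] by (intro order_trans[OF ocube_subset_ccube]) simp
        moreover have "ocube p' \<subseteq> ball 0 (r m)" using bspec[OF F(2) 4(4)] by (intro order_trans[OF ocube_subset_ccube]) simp
        ultimately show ?thesis using inj_on_image_Int[OF near_chart_inj[OF gm \<epsilon>(2)], of "ocube p" "ocube p'"] 4(1,2)
          by (metis (mono_tags, lifting) case_prod_conv image_empty)
      qed
    qed
    have "hausdorff_outer DIM('d) (G \<inter> (\<Union>i<Suc m. g i ` ball 0 (r i)) - (\<Union>(i, p)\<in>I'. g i ` ccube p))
       \<le> hausdorff_outer DIM('d) ((G \<inter> (\<Union>i<m. g i ` ball 0 (r i)) - C) \<union> ((G - C) \<inter> g m ` ball 0 (r m) - (\<Union>p\<in>F. g m ` ccube p)))"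
      unfolding C' by (rule hausdorff_outer_mono) (simp only: lessThan_Suc, blast)
    also have "\<dots> \<le> ennreal (real m * \<eta>) + ennreal \<eta>"
      by (rule order_trans[OF hausdorff_outer_Un]) (use I(4) F(4) in \<open>auto simp: C_def intro!: add_mono\<close>)
    also have "\<dots> = ennreal (real (Suc m) * \<eta>)" using \<eta> by (simp add: ennreal_plus[symmetric] algebra_simps del: ennreal_plus)
    finally show "hausdorff_outer DIM('d) (G \<inter> (\<Union>i<Suc m. g i ` ball 0 (r i)) - (\<Union>(i, p)\<in>I'. g i ` ccube p)) \<le> ennreal (real (Suc m) * \<eta>)" .
  qed
qed

text \<open>\<open>R\<close> is pulled back to a compact set \<open>P\<close> of the closed
  half-radius ball and covered there. One factor \<open>2 ^ DIM('d)\<close> comes from comparing the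
  volume of \<open>P\<close> with the measure of \<open>R\<close>, another from the doubled cubes;
  hence the 4.\<close>

lemma chart_remainder:
  fixes g :: "'d::euclidean_space \<Rightarrow> 'p::euclidean_space"
  assumes g: "near_chart \<epsilon> M g r" and \<epsilon>: "0 < \<epsilon>" "\<epsilon> \<le> 1 / 2" and R: "compact R" and \<eta>: "\<eta> > 0"
  shows "\<exists>F. finite F \<and> (\<forall>p\<in>F. snd p > 0 \<and> ccube p \<subseteq> ball 0 r) \<and> R \<inter> g ` ball 0 (r / 2) \<subseteq> (\<Union>p\<in>F. g ` ccube p) \<and>
     ennreal (\<Sum>p\<in>F. snd p ^ DIM('d)) \<le> ennreal (4 ^ DIM('d)) * (hausdorff_outer DIM('d) R + ennreal \<eta>)"
proof -
  have r: "r > 0" using g by (simp add: near_chart_def)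
  have sub: "cball 0 (r / 2) \<subseteq> (ball 0 r :: 'd set)" using r by (auto simp: cball_subset_ball_iff)
  define P where "P = cball 0 (r / 2) \<inter> g -` R"
  have "closed P"
    unfolding P_def using continuous_on_subset[OF near_chart_continuous[OF g] sub] closed_cball compact_imp_closed[OF R]
    by (rule continuous_closed_preimage)
  moreover have "bounded P" by (rule bounded_subset[OF bounded_cball, of _ 0 "r / 2"]) (auto simp: P_def)
  ultimately have P: "compact P" by (simp add: compact_eq_bounded_closed)
  have Pb: "P \<subseteq> ball 0 r" using sub by (auto simp: P_def)
  obtain F where F: "finite F" "\<forall>p\<in>F. snd p > 0 \<and> ccube p \<subseteq> ball 0 r" "P \<subseteq> (\<Union>p\<in>F. ccube p)"
    "ennreal (\<Sum>p\<in>F. snd p ^ DIM('d)) \<le> ennreal (2 ^ DIM('d)) * (emeasure lborel P + ennreal \<eta>)"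
    using compact_cover_cubes[OF P Pb open_ball \<eta>] by blast
  have "emeasure lborel P \<le> ennreal ((1 / (1 - \<epsilon>)) ^ DIM('d)) * hausdorff_outer DIM('d) (g ` P)"
    by (rule lborel_le_hausdorff_near_chart[OF g _ Pb]) (use \<epsilon> P in \<open>auto simp: borel_compact\<close>)
  also have "\<dots> \<le> ennreal (2 ^ DIM('d)) * hausdorff_outer DIM('d) R"
  proof (rule mult_mono)
    have "1 / (1 - \<epsilon>) \<le> 2" using \<epsilon> by (simp add: field_simps)
    then show "ennreal ((1 / (1 - \<epsilon>)) ^ DIM('d)) \<le> ennreal (2 ^ DIM('d))" using \<epsilon> by (intro ennreal_leI power_mono) auto
    show "hausdorff_outer DIM('d) (g ` P) \<le> hausdorff_outer DIM('d) R" by (rule hausdorff_outer_mono) (auto simp: P_def)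
  qed auto
  finally have eP: "emeasure lborel P \<le> ennreal (2 ^ DIM('d)) * hausdorff_outer DIM('d) R" .
  have e\<eta>: "ennreal \<eta> \<le> ennreal (2 ^ DIM('d)) * ennreal \<eta>"
    using \<eta> by (subst ennreal_mult[symmetric]) (auto intro!: ennreal_leI)
  have "ennreal (2 ^ DIM('d)) * (emeasure lborel P + ennreal \<eta>) \<le>
      ennreal (2 ^ DIM('d)) * (ennreal (2 ^ DIM('d)) * hausdorff_outer DIM('d) R + ennreal (2 ^ DIM('d)) * ennreal \<eta>)"
    by (intro mult_left_mono add_mono eP e\<eta>) simp
  also have "\<dots> = (ennreal (2 ^ DIM('d)) * ennreal (2 ^ DIM('d))) * (hausdorff_outer DIM('d) R + ennreal \<eta>)"
    by (simp add: distrib_left mult.assoc)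
  also have "ennreal (2 ^ DIM('d)) * ennreal (2 ^ DIM('d)) = ennreal (4 ^ DIM('d))"
    by (subst ennreal_mult[symmetric]) (auto simp: power_mult_distrib[symmetric])
  finally have bound: "ennreal (\<Sum>p\<in>F. snd p ^ DIM('d)) \<le> ennreal (4 ^ DIM('d)) * (hausdorff_outer DIM('d) R + ennreal \<eta>)"
    using F(4) by (rule order_trans[rotated])
  have "R \<inter> g ` ball 0 (r / 2) \<subseteq> (\<Union>p\<in>F. g ` ccube p)"
  proof
    fix x assume "x \<in> R \<inter> g ` ball 0 (r / 2)"
    then obtain u where "u \<in> ball 0 (r / 2)" "x = g u" "x \<in> R" by blast
    then have "u \<in> P" by (simp add: P_def)
    then show "x \<in> (\<Union>p\<in>F. g ` ccube p)" using F(3) \<open>x = g u\<close> by blast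
  qed
  then show ?thesis using F(1,2) bound by blast
qed

text \<open>The first form is for cells inside \<open>A\<close>. The second lets the image leave
  \<open>A\<close>, at the price of a projection.\<close>

lemma lower_piece_cube:
  fixes g :: "'d::euclidean_space \<Rightarrow> 'p::euclidean_space"
  assumes g: "near_chart \<epsilon> M g r" and \<epsilon>: "0 < \<epsilon>" and p: "snd p > 0" "ccube p \<subseteq> ball 0 r" and s: "s \<ge> 0"
  shows "g ` ccube p \<subseteq> A \<Longrightarrow> lower_piece s TYPE('d) A (g ` ccube p) ((1 + \<epsilon>) * snd p)"
    "closed A \<Longrightarrow> A \<noteq> {} \<Longrightarrow> lower_piece s TYPE('d) A (g ` ccube p \<inter> A) (2 * ((1 + \<epsilon>) * snd p))"
proof -
  define h where "h u = fst p + snd p *\<^sub>R u" for u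
  have h: "ccube p = h ` cbox 0 One"
    using ccube_image[of "snd p" "fst p"] p by (simp add: h_def)
  have L: "(1 + \<epsilon>) * snd p > 0" using \<epsilon> p by simp
  have lip: "dist (g (h u)) (g (h v)) \<le> (1 + \<epsilon>) * snd p * dist u v" if "u \<in> cbox 0 One" "v \<in> cbox 0 One" for u v
  proof -
    have "h u \<in> ball 0 r" "h v \<in> ball 0 r" using that p(2) unfolding h by blast+
    then have "dist (g (h u)) (g (h v)) \<le> (1 + \<epsilon>) * dist (h u) (h v)" by (rule near_chart_dist(2)[OF g])
    also have "dist (h u) (h v) = snd p * dist u v" using p by (simp add: h_def dist_norm flip: scaleR_diff_right)
    finally show ?thesis by simp
  qed
  have im: "g ` ccube p = (\<lambda>u. g (h u)) ` cbox 0 One" by (simp add: h image_image)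
  show "lower_piece s TYPE('d) A (g ` ccube p) ((1 + \<epsilon>) * snd p)" if "g ` ccube p \<subseteq> A"
    by (rule lower_piece_lipschitz[OF L s lip]) (use that im in auto)
  show "lower_piece s TYPE('d) A (g ` ccube p \<inter> A) (2 * ((1 + \<epsilon>) * snd p))" if "closed A" "A \<noteq> {}"
    by (rule lower_piece_lipschitz_proj[OF L s lip]) (use that im in auto)
qed

text \<open>A concentric smaller cube has compact image, and \<open>A\<close> without the relatively
  open cell is closed; the two are disjoint and so have positive distance. One factor
  \<open>1 - \<epsilon>\<close> is due to the shrinking, the other to the lower distance bound of
  the chart.\<close>

lemma upper_cell_cube:
  fixes g :: "'d::euclidean_space \<Rightarrow> 'p::euclidean_space" and s :: real
  assumes g: "near_chart \<epsilon> M g r" and \<epsilon>: "0 < \<epsilon>" "\<epsilon> < 1" and p: "snd p > 0" "ccube p \<subseteq> ball 0 r" and s: "s \<ge> 0"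
    and A: "compact A" "A \<subseteq> M" "g ` ccube p \<subseteq> A" and \<sigma>: "cube_const s TYPE('d) \<sigma>"
  shows "upper_cell s (s / DIM('d)) \<sigma> A (g ` ocube p) ((1 - \<epsilon>) * ((1 - \<epsilon>) * snd p))"
proof -
  define l where "l = snd p"
  have l: "l > 0" using p by (simp add: l_def)
  \<comment> \<open>Corner of the concentric cube of side \<open>(1 - \<epsilon>) * l\<close>: the
    margin on each side is half of \<open>\<epsilon> * l\<close>.\<close>
  define q where "q = fst p + (\<epsilon> * l / 2) *\<^sub>R One"
  define h where "h u = q + ((1 - \<epsilon>) * l) *\<^sub>R u" for u :: 'd
  have hQ: "h u \<in> ocube p" if u: "u \<in> cbox 0 One" for u
    unfolding ocube_def mem_box
  proof (intro ballI)
    fix i :: 'd assume i: "i \<in> Basis"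
    have "0 \<le> u \<bullet> i" "u \<bullet> i \<le> 1" using u i by (auto simp: mem_box)
    then have "0 \<le> (1 - \<epsilon>) * l * (u \<bullet> i)" "(1 - \<epsilon>) * l * (u \<bullet> i) \<le> (1 - \<epsilon>) * l * 1"
      using \<epsilon> l by (auto intro!: mult_left_mono)
    moreover have "\<epsilon> * l > 0" using \<epsilon> l by simp
    moreover have "h u \<bullet> i = fst p \<bullet> i + \<epsilon> * l / 2 + (1 - \<epsilon>) * l * (u \<bullet> i)" using i by (simp add: h_def q_def inner_add_left)
    moreover have "(1 - \<epsilon>) * l = l - \<epsilon> * l" by (simp add: algebra_simps)
    ultimately show "fst p \<bullet> i < h u \<bullet> i \<and> h u \<bullet> i < (fst p + snd p *\<^sub>R One) \<bullet> i"
      using i by (simp add: inner_add_left l_def[symmetric])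
  qed
  define Q1 where "Q1 = (\<lambda>u. g (h u)) ` cbox 0 One"
  have ob: "ocube p \<subseteq> ball 0 r" using p ocube_subset_ccube by blast
  have "compact (h ` cbox 0 One)" unfolding h_def by (intro compact_continuous_image continuous_intros compact_cbox)
  moreover have "h ` cbox 0 One \<subseteq> ball 0 r" using hQ ob by blast
  ultimately have "compact (g ` (h ` cbox 0 One))"
    by (rule compact_continuous_image[OF continuous_on_subset[OF near_chart_continuous[OF g]], rotated])
  then have Q1: "compact Q1" by (simp add: Q1_def image_image)
  obtain Y where Y: "open Y" "g ` ocube p = M \<inter> Y"
    using near_chart_openin[OF g open_ocube ob] by (auto simp: openin_open)
  have "A - g ` ocube p = A - Y" using Y A(2) by blast
  then have cl: "closed (A - g ` ocube p)" using compact_imp_closed[OF A(1)] Y(1) by (simp add: closed_Diff)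
  have "Q1 \<inter> (A - g ` ocube p) = {}" using hQ by (auto simp: Q1_def)
  then obtain \<delta> where \<delta>: "\<delta> > 0" "\<And>x y. x \<in> Q1 \<Longrightarrow> y \<in> A - g ` ocube p \<Longrightarrow> \<delta> \<le> dist x y"
    using separate_compact_closed[OF Q1 cl] by blast
  have "upper_cell s (s / DIM('d)) \<sigma> A (g ` ocube p) ((1 - \<epsilon>) * ((1 - \<epsilon>) * l))"
  proof (rule upper_cell_chart[OF \<sigma> s _ _ \<delta>(1)])
    show "(1 - \<epsilon>) * l > 0" "1 - \<epsilon> > 0" using \<epsilon> l by auto
    show "q + ((1 - \<epsilon>) * l) *\<^sub>R u \<in> ocube p" if "u \<in> cbox 0 One" for u using hQ[OF that] by (simp add: h_def)
    show "g (q + ((1 - \<epsilon>) * l) *\<^sub>R u) \<in> A" if "u \<in> cbox 0 One" for u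
      using hQ[OF that] A(3) ocube_subset_ccube[of p] by (auto simp: h_def)
    show "(1 - \<epsilon>) * dist u v \<le> dist (g u) (g v)" if "u \<in> ocube p" "v \<in> ocube p" for u v
      by (rule near_chart_dist(1)[OF g]) (use that ob in auto)
    show "\<delta> \<le> dist (g (q + ((1 - \<epsilon>) * l) *\<^sub>R u)) y" if "u \<in> cbox 0 One" "y \<in> A - g ` ocube p" for u y
      by (rule \<delta>(2)) (use that in \<open>auto simp: Q1_def h_def\<close>)
  qed auto
  then show ?thesis by (simp add: l_def)
qed

section \<open>Packings and covers of A\<close>

lemma hausdorff_outer_finite_UN:
  "finite I \<Longrightarrow> hausdorff_outer d (\<Union>i\<in>I. E i) \<le> (\<Sum>i\<in>I. hausdorff_outer d (E i))"
proof (induction I rule: finite_induct)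
  case (insert i I)
  have "hausdorff_outer d (\<Union>i\<in>insert i I. E i) \<le> hausdorff_outer d (E i) + hausdorff_outer d (\<Union>i\<in>I. E i)"
    using hausdorff_outer_Un[of d "E i" "\<Union>i\<in>I. E i"] by simp
  also have "\<dots> \<le> hausdorff_outer d (E i) + (\<Sum>i\<in>I. hausdorff_outer d (E i))"
    by (rule add_left_mono[OF insert.IH])
  finally show ?case using insert by simp
qed simp

text \<open>The last condition, with disjointness and Borel measurability, keeps the sum of the
  \<open>c i ^ d\<close> below the measure of \<open>A\<close>. The diameter bound
  \<open>\<delta>\<close> makes a continuous function nearly constant on each cell in the weak
  limit.\<close>

definition packing :: "real \<Rightarrow> real \<Rightarrow> nat \<Rightarrow> 'p::euclidean_space set \<Rightarrow> real \<Rightarrow> 'i set \<Rightarrow> ('i \<Rightarrow> 'p set) \<Rightarrow> ('i \<Rightarrow> real) \<Rightarrow> bool" where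
  "packing s \<sigma> d A \<delta> I K c \<longleftrightarrow> finite I \<and> disjoint_family_on K I \<and>
    (\<forall>i\<in>I. K i \<subseteq> A \<and> K i \<in> sets borel \<and> upper_cell s (s / d) \<sigma> A (K i) (c i) \<and>
      (\<forall>x\<in>K i. \<forall>y\<in>K i. dist x y \<le> \<delta>) \<and> ennreal (c i ^ d) \<le> hausdorff_outer d (K i))"

lemma packing_mono:
  assumes pk: "packing s \<sigma> d A \<delta> I K c" and le: "\<delta> \<le> \<delta>'" shows "packing s \<sigma> d A \<delta>' I K c"
proof -
  have "dist x y \<le> \<delta>'" if "i \<in> I" "x \<in> K i" "y \<in> K i" for i x y
  proof -
    have "dist x y \<le> \<delta>" using pk that unfolding packing_def by blast
    then show ?thesis using le by simp
  qed
  then show ?thesis using pk unfolding packing_def by blast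
qed

definition piece_cover :: "real \<Rightarrow> 'd::euclidean_space itself \<Rightarrow> 'p::metric_space set \<Rightarrow> 'j set \<Rightarrow> ('j \<Rightarrow> 'p set) \<Rightarrow> ('j \<Rightarrow> real) \<Rightarrow> bool" where
  "piece_cover s T A J E e \<longleftrightarrow> finite J \<and> (\<forall>j\<in>J. lower_piece s T A (E j) (e j)) \<and> A \<subseteq> (\<Union>j\<in>J. E j)"

text \<open>All that the limit theorems use about \<open>A\<close>; \<open>H\<close> stands for its
  measure. A formula cannot quantify over types, so the index types are concrete: a chart number
  with a cube, and for covers a sum type separating cells from cubes of the remainder.\<close>

definition decomposable :: "real \<Rightarrow> real \<Rightarrow> 'd::euclidean_space itself \<Rightarrow> 'p::euclidean_space set \<Rightarrow> real \<Rightarrow> bool" where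
  "decomposable s \<sigma> T A H \<longleftrightarrow> (\<forall>\<epsilon>>0.
    (\<exists>(I :: (nat \<times> 'd \<times> real) set) K c. packing s \<sigma> DIM('d) A \<epsilon> I K c \<and> H - \<epsilon> \<le> (\<Sum>i\<in>I. c i ^ DIM('d))) \<and>
    (\<exists>(J :: ((nat \<times> 'd \<times> real) + (nat \<times> 'd \<times> real)) set) E e. piece_cover s T A J E e \<and> (\<Sum>j\<in>J. e j ^ DIM('d)) \<le> H + \<epsilon>))"

text \<open>The packing consists of images of open cubes inside the relative interior of \<open>A\<close>. What they leave
  uncovered is compact and has small measure, so it is covered by images of cubes of small total volume;
  as those may stick out of \<open>A\<close>, points are moved to their nearest points in \<open>A\<close>, at the cost of a factor 2.\<close>

lemma manifold_decomposition:
  fixes A M :: "'p::euclidean_space set" and s \<sigma> :: real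
  assumes M: "C1_manifold TYPE('d::euclidean_space) M" and A: "compact A" "A \<subseteq> M" "A \<noteq> {}"
    and fr: "hausdorff_outer DIM('d) ((top_of_set M) frontier_of A) = 0"
    and \<sigma>: "cube_const s TYPE('d) \<sigma>" and s: "s \<ge> 0" and \<epsilon>: "0 < \<epsilon>" "\<epsilon> \<le> 1 / 2" and \<kappa>: "\<kappa> > 0"
  shows "\<exists>(I :: (nat \<times> 'd \<times> real) set) K E c (J :: (nat \<times> 'd \<times> real) set) E' e. packing s \<sigma> DIM('d) A \<kappa> I K c \<and> finite J \<and>
    (\<forall>i\<in>I. K i \<subseteq> E i \<and> lower_piece s TYPE('d) A (E i) ((1 + \<epsilon>) / (1 - \<epsilon>)\<^sup>2 * c i) \<and>
      hausdorff_outer DIM('d) (E i) \<le> ennreal (((1 + \<epsilon>) / (1 - \<epsilon>)\<^sup>2 * c i) ^ DIM('d))) \<and>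
    (\<forall>j\<in>J. lower_piece s TYPE('d) A (E' j) (e j)) \<and>
    A \<subseteq> (\<Union>i\<in>I. E i) \<union> (\<Union>j\<in>J. E' j) \<and> (\<Sum>j\<in>J. e j ^ DIM('d)) \<le> \<kappa> \<and>
    hausdorff_outer DIM('d) (A - (\<Union>i\<in>I. K i)) \<le> ennreal \<kappa>"
proof -
  define d where "d = DIM('d)"
  let ?H = "hausdorff_outer (real d) :: 'p set \<Rightarrow> ennreal"
  have \<epsilon>1: "\<epsilon> < 1" using \<epsilon> by simp
  obtain m and g :: "nat \<Rightarrow> 'd \<Rightarrow> 'p" and r where
    g: "\<forall>i<m. near_chart \<epsilon> M (g i) (r i)" and cov: "A \<subseteq> (\<Union>i<m. g i ` ball 0 (r i / 2))"
    using finite_atlas[OF M A(1,2) \<epsilon>(1)] by blast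
  define G where "G = (top_of_set M) interior_of A"
  have G: "openin (top_of_set M) G" "G \<subseteq> A" by (simp_all add: G_def interior_of_subset)
  have AG: "A \<subseteq> G \<union> (top_of_set M) frontier_of A"
    using closure_of_subset[of A "top_of_set M"] A(2) by (auto simp: frontier_of_def G_def)
  \<comment> \<open>\<open>16 ^ d\<close> collects \<open>4 ^ d\<close> from
    \<open>chart_remainder\<close> and \<open>4 ^ d\<close> from the sides
    \<open>2 * (1 + \<epsilon>) * l \<le> 4 * l\<close>. The square pays for \<open>m\<close>
    charts, each with an error of at most \<open>(m + 1) * \<eta>\<close>.\<close>
  define \<eta> where "\<eta> = \<kappa> / (16 ^ d * (real m + 1)\<^sup>2)"
  have \<eta>: "\<eta> > 0" using \<kappa> by (simp add: \<eta>_def)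
  have \<eta>\<kappa>: "16 ^ d * (real m * (real m * \<eta> + \<eta>)) \<le> \<kappa>" "real m * \<eta> \<le> \<kappa>"
  proof -
    have e: "16 ^ d * ((real m + 1)\<^sup>2 * \<eta>) = \<kappa>" by (simp add: \<eta>_def)
    have "real m * (real m * \<eta> + \<eta>) = real m * (real m + 1) * \<eta>" by (simp add: algebra_simps)
    also have "\<dots> \<le> (real m + 1)\<^sup>2 * \<eta>" using \<eta> by (intro mult_right_mono) (auto simp: power2_eq_square algebra_simps)
    finally have 1: "real m * (real m * \<eta> + \<eta>) \<le> (real m + 1)\<^sup>2 * \<eta>" .
    then have "16 ^ d * (real m * (real m * \<eta> + \<eta>)) \<le> 16 ^ d * ((real m + 1)\<^sup>2 * \<eta>)" by (rule mult_left_mono) simp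
    then show "16 ^ d * (real m * (real m * \<eta> + \<eta>)) \<le> \<kappa>" using e by simp
    have "real m * \<eta> \<le> (real m + 1)\<^sup>2 * \<eta>" using \<eta> by (intro mult_right_mono) (auto simp: power2_eq_square algebra_simps)
    also have "\<dots> \<le> 16 ^ d * ((real m + 1)\<^sup>2 * \<eta>)" 
      using mult_right_mono[OF one_le_power[of "16::real" d], of "(real m + 1)\<^sup>2 * \<eta>"] \<eta> by simp
    finally show "real m * \<eta> \<le> \<kappa>" using e by simp
  qed
  have gi: "\<And>i. i < m \<Longrightarrow> near_chart \<epsilon> M (g i) (r i)" using g by blast
  obtain I where Iall: "finite I \<and> (\<forall>(i, p)\<in>I. i < m \<and> snd p > 0 \<and> ccube p \<subseteq> ball 0 (r i) \<and> g i ` ccube p \<subseteq> G \<and>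
         (\<forall>x\<in>g i ` ccube p. \<forall>y\<in>g i ` ccube p. dist x y \<le> \<kappa>))
     \<and> disjoint_family_on (\<lambda>(i, p). g i ` ocube p) I \<and>
     hausdorff_outer DIM('d) (G \<inter> (\<Union>i<m. g i ` ball 0 (r i)) - (\<Union>(i, p)\<in>I. g i ` ccube p)) \<le> ennreal (real m * \<eta>)"
    by (rule exE[OF atlas_cells[OF gi \<epsilon>(1) \<epsilon>1 G(1) \<kappa> \<eta>]])
  have I: "finite I" by (rule conjunct1[OF Iall])
  have I2: "\<forall>(i, p)\<in>I. i < m \<and> snd p > 0 \<and> ccube p \<subseteq> ball 0 (r i) \<and> g i ` ccube p \<subseteq> G \<and>
         (\<forall>x\<in>g i ` ccube p. \<forall>y\<in>g i ` ccube p. dist x y \<le> \<kappa>)"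
    by (rule conjunct1[OF conjunct2[OF Iall]])
  have I3: "disjoint_family_on (\<lambda>(i, p). g i ` ocube p) I"
    by (rule conjunct1[OF conjunct2[OF conjunct2[OF Iall]]])
  have I4: "?H (G \<inter> (\<Union>i<m. g i ` ball 0 (r i)) - (\<Union>(i, p)\<in>I. g i ` ccube p)) \<le> ennreal (real m * \<eta>)"
    unfolding d_def by (rule conjunct2[OF conjunct2[OF conjunct2[OF Iall]]])
  define K where "K q = g (fst q) ` ocube (snd q)" for q
  define E where "E q = g (fst q) ` ccube (snd q)" for q
  define c where "c q = (1 - \<epsilon>) * ((1 - \<epsilon>) * snd (snd q))" for q :: "nat \<times> 'd \<times> real"
  have q: "fst q < m" "snd (snd q) > 0" "ccube (snd q) \<subseteq> ball 0 (r (fst q))" "E q \<subseteq> G"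
      "\<And>x y. x \<in> E q \<Longrightarrow> y \<in> E q \<Longrightarrow> dist x y \<le> \<kappa>" if "q \<in> I" for q
    using bspec[OF I2 that] by (auto simp: E_def split: prod.splits)
  have KE: "K q \<subseteq> E q" for q unfolding K_def E_def using ocube_subset_ccube by blast
  have ob: "ocube (snd q) \<subseteq> ball 0 (r (fst q))" if "q \<in> I" for q
    using q(3)[OF that] ocube_subset_ccube by (rule order_trans[rotated])
  have Kop: "openin (top_of_set M) (K q)" if "q \<in> I" for q
    unfolding K_def by (rule near_chart_openin[OF gi[OF q(1)[OF that]] open_ocube ob[OF that]])
  \<comment> \<open>A cube of side \<open>l\<close> counts as \<open>(1 + \<epsilon>) * l\<close> in
    the cover and as \<open>(1 - \<epsilon>)^2 * l\<close> in the packing. The quotient tends to 1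
    with \<open>\<epsilon>\<close>.\<close>
  have cl: "(1 + \<epsilon>) / (1 - \<epsilon>)\<^sup>2 * c q = (1 + \<epsilon>) * snd (snd q)" for q
    using \<epsilon>1 by (simp add: c_def power2_eq_square)
  have disj: "disjoint_family_on K I" 
  proof -
    have "K = (\<lambda>(i, p). g i ` ocube p)" by (auto simp: K_def fun_eq_iff)
    then show ?thesis using I3 by simp
  qed
  \<comment> \<open>Only the images of open cubes are removed, which makes \<open>R\<close> compact.
    It consists of boundary points, of what the cubes failed to exhaust, and of faces
    \<open>E q - K q\<close>, which are null.\<close>
  define R where "R = A - (\<Union>q\<in>I. K q)"
  have "openin (top_of_set M) (\<Union>q\<in>I. K q)" using Kop by blast
  then obtain Y where Y: "open Y" "(\<Union>q\<in>I. K q) = M \<inter> Y" by (auto simp: openin_open)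
  have "R = A - Y" using A(2) Y(2) by (auto simp: R_def)
  then have Rc: "compact R" using A(1) Y(1) by (simp add: compact_diff)
  have null: "?H (E q - K q) = 0" if qI: "q \<in> I" for q
  proof -
    let ?p = "snd q"
    have "emeasure lborel (ccube ?p - ocube ?p) = emeasure lborel (ccube ?p) - emeasure lborel (ocube ?p)"
      using q(2)[OF qI] by (intro emeasure_Diff) (auto simp: emeasure_cube ocube_subset_ccube less_imp_le)
    also have "\<dots> = 0" using q(2)[OF qI] by (simp add: emeasure_cube less_imp_le)
    finally have z: "emeasure lborel (ccube ?p - ocube ?p) = 0" .
    have "?H (E q - K q) \<le> ?H (g (fst q) ` (ccube ?p - ocube ?p))"
      by (rule hausdorff_outer_mono) (auto simp: E_def K_def)
    also have "\<dots> \<le> ennreal ((1 + \<epsilon>) ^ d) * emeasure lborel (ccube ?p - ocube ?p)"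
      unfolding d_def by (rule hausdorff_near_chart_le[OF gi[OF q(1)[OF qI]] \<epsilon>(1)]) (use q(3)[OF qI] in auto)
    finally show ?thesis by (simp add: z)
  qed
  have RH: "?H R \<le> ennreal (real m * \<eta>)"
  proof -
    let ?F = "(top_of_set M) frontier_of A"
    let ?L = "G \<inter> (\<Union>i<m. g i ` ball 0 (r i)) - (\<Union>q\<in>I. E q)"
    let ?N = "\<Union>q\<in>I. (E q - K q)"
    have big: "A \<subseteq> (\<Union>i<m. g i ` ball 0 (r i))"
    proof
      fix x assume "x \<in> A"
      then obtain i u where iu: "i < m" "u \<in> ball 0 (r i / 2)" "x = g i u" using cov by blast
      then have "u \<in> ball 0 (r i)" using gi[OF iu(1)] by (auto simp: near_chart_def)
      then show "x \<in> (\<Union>i<m. g i ` ball 0 (r i))" using iu by blast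
    qed
    have "R \<subseteq> ?F \<union> (?L \<union> ?N)"
    proof
      fix x assume x: "x \<in> R"
      then have "x \<in> A" "x \<notin> (\<Union>q\<in>I. K q)" by (auto simp: R_def)
      then show "x \<in> ?F \<union> (?L \<union> ?N)" using AG big by blast
    qed
    then have "?H R \<le> ?H (?F \<union> (?L \<union> ?N))" by (rule hausdorff_outer_mono)
    also have "\<dots> \<le> ?H ?F + (?H ?L + ?H ?N)"
      by (intro order_trans[OF hausdorff_outer_Un] add_left_mono hausdorff_outer_Un)
    also have "?H ?F = 0" using fr by (simp add: d_def)
    also have "?H ?N \<le> (\<Sum>q\<in>I. ?H (E q - K q))" by (rule hausdorff_outer_finite_UN[OF I])
    also have "\<dots> = 0" using null by simp
    also have "?H ?L \<le> ennreal (real m * \<eta>)" using I4 by (simp add: E_def case_prod_beta')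
    finally show ?thesis by (simp add: add_mono)
  qed
  have "\<forall>i\<in>{..<m}. \<exists>F. finite F \<and> (\<forall>p\<in>F. snd p > 0 \<and> ccube p \<subseteq> ball 0 (r i)) \<and> R \<inter> g i ` ball 0 (r i / 2) \<subseteq> (\<Union>p\<in>F. g i ` ccube p) \<and>
     ennreal (\<Sum>p\<in>F. snd p ^ d) \<le> ennreal (4 ^ d) * (?H R + ennreal \<eta>)"
    using chart_remainder[OF gi \<epsilon> Rc \<eta>] unfolding d_def by blast
  from bchoice[OF this] obtain F where F': "\<forall>i\<in>{..<m}. finite (F i) \<and> (\<forall>p\<in>F i. snd p > 0 \<and> ccube p \<subseteq> ball 0 (r i)) \<and> R \<inter> g i ` ball 0 (r i / 2) \<subseteq> (\<Union>p\<in>F i. g i ` ccube p) \<and>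
     ennreal (\<Sum>p\<in>F i. snd p ^ d) \<le> ennreal (4 ^ d) * (?H R + ennreal \<eta>)" by (rule exE)
  have F: "\<And>i. i < m \<Longrightarrow> finite (F i)"
    "\<And>i p. i < m \<Longrightarrow> p \<in> F i \<Longrightarrow> snd p > 0 \<and> ccube p \<subseteq> ball 0 (r i)"
    "\<And>i. i < m \<Longrightarrow> R \<inter> g i ` ball 0 (r i / 2) \<subseteq> (\<Union>p\<in>F i. g i ` ccube p)"
    "\<And>i. i < m \<Longrightarrow> ennreal (\<Sum>p\<in>F i. snd p ^ d) \<le> ennreal (4 ^ d) * (?H R + ennreal \<eta>)"
    using F' by (simp_all only: lessThan_iff Ball_def)
  define J where "J = Sigma {..<m} F"
  define E' where "E' q = g (fst q) ` ccube (snd q) \<inter> A" for q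
  define e where "e q = 2 * ((1 + \<epsilon>) * snd (snd q))" for q :: "nat \<times> 'd \<times> real"
  have J: "finite J" using F(1) by (auto simp: J_def)
  have esum: "(\<Sum>q\<in>J. e q ^ d) \<le> \<kappa>"
  proof -
    have Fi: "(\<Sum>p\<in>F i. snd p ^ d) \<le> 4 ^ d * (real m * \<eta> + \<eta>)" if i: "i < m" for i
    proof -
      have "ennreal (\<Sum>p\<in>F i. snd p ^ d) \<le> ennreal (4 ^ d) * (ennreal (real m * \<eta>) + ennreal \<eta>)"
        by (rule order_trans[OF F(4)[OF i]]) (intro mult_left_mono add_right_mono RH, simp)
      also have "\<dots> = ennreal (4 ^ d * (real m * \<eta> + \<eta>))"
        using \<eta> by (simp add: ennreal_mult' ennreal_plus)
      finally show ?thesis using \<eta> by (subst (asm) ennreal_le_iff) auto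
    qed
    have pos: "0 < snd p" if "i < m" "p \<in> F i" for i p using F(2)[OF that] by blast
    have "(\<Sum>q\<in>J. e q ^ d) = (\<Sum>i<m. \<Sum>p\<in>F i. (2 * ((1 + \<epsilon>) * snd p)) ^ d)"
      unfolding J_def e_def using F(1) by (subst sum.Sigma) (auto simp: case_prod_beta)
    also have "\<dots> \<le> (\<Sum>i<m. \<Sum>p\<in>F i. 4 ^ d * snd p ^ d)"
    proof (intro sum_mono)
      fix i p assume ip: "i \<in> {..<m}" "p \<in> F i"
      have "2 * ((1 + \<epsilon>) * snd p) \<le> 4 * snd p" using pos ip \<epsilon> by simp
      then have "(2 * ((1 + \<epsilon>) * snd p)) ^ d \<le> (4 * snd p) ^ d" using pos[of i p] ip \<epsilon> by (intro power_mono) auto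
      then show "(2 * ((1 + \<epsilon>) * snd p)) ^ d \<le> 4 ^ d * snd p ^ d" by (simp add: power_mult_distrib)
    qed
    also have "\<dots> = (\<Sum>i<m. 4 ^ d * (\<Sum>p\<in>F i. snd p ^ d))" by (simp add: sum_distrib_left)
    also have "\<dots> \<le> (\<Sum>i<m. 4 ^ d * (4 ^ d * (real m * \<eta> + \<eta>)))"
      by (intro sum_mono mult_left_mono Fi) auto
    also have "\<dots> = (4 ^ d * 4 ^ d) * (real m * (real m * \<eta> + \<eta>))" by simp
    also have "(4::real) ^ d * 4 ^ d = 16 ^ d" by (simp flip: power_mult_distrib)
    also note \<eta>\<kappa>(1)
    finally show ?thesis .
  qed
  have EA: "E i \<subseteq> A" if "i \<in> I" for i using q(4)[OF that] G(2) by blast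
  have cells1: "K i \<subseteq> E i \<and> lower_piece s TYPE('d) A (E i) ((1 + \<epsilon>) / (1 - \<epsilon>)\<^sup>2 * c i) \<and>
      ?H (E i) \<le> ennreal (((1 + \<epsilon>) / (1 - \<epsilon>)\<^sup>2 * c i) ^ d)" if iI: "i \<in> I" for i
  proof (intro conjI)
    note gi' = gi[OF q(1)[OF iI]] and l = q(2)[OF iI] and cc = q(3)[OF iI]
    show "K i \<subseteq> E i" by (rule KE)
    show "lower_piece s TYPE('d) A (E i) ((1 + \<epsilon>) / (1 - \<epsilon>)\<^sup>2 * c i)"
      unfolding cl unfolding E_def
      by (rule lower_piece_cube(1)[OF gi' \<epsilon>(1) l cc s]) (use EA[OF iI] in \<open>simp add: E_def\<close>)
    have "?H (E i) \<le> ennreal ((1 + \<epsilon>) ^ d) * emeasure lborel (ccube (snd i))"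
      unfolding E_def d_def by (rule hausdorff_near_chart_le[OF gi' \<epsilon>(1) cc]) simp
    also have "\<dots> = ennreal (((1 + \<epsilon>) * snd (snd i)) ^ d)"
      using l \<epsilon> by (simp add: emeasure_cube d_def power_mult_distrib ennreal_mult')
    finally show "?H (E i) \<le> ennreal (((1 + \<epsilon>) / (1 - \<epsilon>)\<^sup>2 * c i) ^ d)" unfolding cl .
  qed
  have cells2: "K i \<subseteq> A \<and> K i \<in> sets borel \<and> upper_cell s (s / d) \<sigma> A (K i) (c i) \<and>
      (\<forall>x\<in>K i. \<forall>y\<in>K i. dist x y \<le> \<kappa>) \<and> ennreal (c i ^ d) \<le> ?H (K i)" if iI: "i \<in> I" for i
  proof (intro conjI)
    note gi' = gi[OF q(1)[OF iI]] and l = q(2)[OF iI] and cc = q(3)[OF iI]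
    show "K i \<subseteq> A" using KE[of i] EA[OF iI] by blast
    \<comment> \<open>\<open>M\<close> itself need not be Borel, so the cell is rewritten as an open
      part of the compact set \<open>A\<close>.\<close>
    obtain Z where "open Z" "K i = M \<inter> Z" using Kop[OF iI] by (auto simp: openin_open)
    then have "open Z" "K i = A \<inter> Z" using KE[of i] EA[OF iI] A(2) by auto
    then show "K i \<in> sets borel" using sets.Int[OF borel_compact[OF A(1)] borel_open] by simp
    show "upper_cell s (s / d) \<sigma> A (K i) (c i)"
      unfolding K_def c_def d_def
      by (rule upper_cell_cube[OF gi' \<epsilon>(1) \<epsilon>1 l cc s A(1,2) _ \<sigma>]) (use EA[OF iI] in \<open>simp add: E_def\<close>)
    have c0: "c i > 0" using l \<epsilon>1 by (simp add: c_def)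
    show "\<forall>x\<in>K i. \<forall>y\<in>K i. dist x y \<le> \<kappa>" using q(5)[OF iI] KE[of i] by blast
    show "ennreal (c i ^ d) \<le> ?H (K i)"
    proof -
      let ?l = "snd (snd i)"
      have "ennreal (?l ^ d) \<le> ennreal ((1 / (1 - \<epsilon>)) ^ d) * ?H (K i)"
        using lborel_le_hausdorff_near_chart[OF gi' \<epsilon>1 ob[OF iI]] l by (simp add: emeasure_cube d_def K_def)
      then have "ennreal ((1 - \<epsilon>) ^ d) * ennreal (?l ^ d) \<le> ennreal ((1 - \<epsilon>) ^ d) * (ennreal ((1 / (1 - \<epsilon>)) ^ d) * ?H (K i))"
        by (rule mult_left_mono) simp
      also have "\<dots> = ennreal ((1 - \<epsilon>) ^ d * (1 / (1 - \<epsilon>)) ^ d) * ?H (K i)"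
        using \<epsilon>1 by (simp only: mult.assoc[symmetric]) (subst ennreal_mult, auto)
      also have "(1 - \<epsilon>) ^ d * (1 / (1 - \<epsilon>)) ^ d = 1" using \<epsilon>1 by (simp add: power_mult_distrib[symmetric])
      finally have "ennreal ((1 - \<epsilon>) ^ d) * ennreal (?l ^ d) \<le> ?H (K i)" by simp
      moreover have "ennreal (c i ^ d) \<le> ennreal ((1 - \<epsilon>) ^ d) * ennreal (?l ^ d)"
      proof -
        have "c i \<le> (1 - \<epsilon>) * ?l" using l \<epsilon> by (simp add: c_def mult_left_le_one_le)
        then have "c i ^ d \<le> ((1 - \<epsilon>) * ?l) ^ d" using c0 by (intro power_mono) auto
        then show ?thesis using l \<epsilon>1 by (subst ennreal_mult[symmetric]) (auto simp: power_mult_distrib intro!: ennreal_leI)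
      qed
      ultimately show ?thesis by (rule order_trans[rotated])
    qed
  qed
  have lowJ: "lower_piece s TYPE('d) A (E' j) (e j)" if "j \<in> J" for j
  proof -
    have j: "fst j < m" "snd j \<in> F (fst j)" using that by (auto simp: J_def)
    show ?thesis unfolding E'_def e_def
      by (rule lower_piece_cube(2)[OF gi[OF j(1)] \<epsilon>(1) _ _ s compact_imp_closed[OF A(1)] A(3)]) (use F(2)[OF j] in auto)
  qed
  have covA: "A \<subseteq> (\<Union>i\<in>I. E i) \<union> (\<Union>j\<in>J. E' j)"
  proof
    fix x assume x: "x \<in> A"
    show "x \<in> (\<Union>i\<in>I. E i) \<union> (\<Union>j\<in>J. E' j)"
    proof (cases "x \<in> R")
      case True
      obtain i where i: "i < m" "x \<in> g i ` ball 0 (r i / 2)" using cov x by blast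
      then obtain p where "p \<in> F i" "x \<in> g i ` ccube p" using F(3)[OF i(1)] True by blast
      then have "(i, p) \<in> J" "x \<in> E' (i, p)" using i x by (auto simp: J_def E'_def)
      then show ?thesis by blast
    next
      case False
      then show ?thesis using x KE unfolding R_def by blast
    qed
  qed
  have RK: "?H (A - (\<Union>i\<in>I. K i)) \<le> ennreal \<kappa>"
    using RH \<eta>\<kappa>(2) unfolding R_def by (meson ennreal_leI order_trans)
  have "packing s \<sigma> d A \<kappa> I K c" unfolding packing_def using I disj cells2 by blast
  then show ?thesis
    unfolding d_def[symmetric]
    by (intro exI[of _ I] exI[of _ K] exI[of _ E] exI[of _ c] exI[of _ J] exI[of _ E'] exI[of _ e] conjI J covA esum RK ballI cells1 lowJ)
qed

text \<open>Write S for the sum of the \<open>c i ^ d\<close>. Disjointness gives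
  \<open>S \<le> H\<close>, covering gives \<open>H \<le> \<rho> t ^ d * S + \<epsilon> / 2\<close>,
  and the cover has sum at most the same right-hand side. As \<open>\<rho> t\<close> tends to 1 with
  \<open>t\<close>, packing and cover both come within \<open>\<epsilon>\<close> of
  \<open>H\<close>.\<close>

lemma good_decomposition:
  fixes A M :: "'p::euclidean_space set" and s \<sigma> :: real
  assumes M: "C1_manifold TYPE('d::euclidean_space) M" and A: "compact A" "A \<subseteq> M" "A \<noteq> {}"
    and fr: "hausdorff_outer DIM('d) ((top_of_set M) frontier_of A) = 0"
    and \<sigma>: "cube_const s TYPE('d) \<sigma>" and s: "s \<ge> 0"
  shows "\<exists>H\<ge>0. hausdorff_outer DIM('d) A = ennreal H \<and> decomposable s \<sigma> TYPE('d) A H"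
proof -
  define d where "d = DIM('d)"
  let ?H = "hausdorff_outer (real d) :: 'p set \<Rightarrow> ennreal"
  define \<rho> where "\<rho> \<epsilon> = (1 + \<epsilon>) / (1 - \<epsilon>)\<^sup>2" for \<epsilon> :: real
  have Ab: "A \<in> sets borel" using A(1) by (rule borel_compact)
  have dec: "\<exists>(I :: (nat \<times> 'd \<times> real) set) K c (J :: ((nat \<times> 'd \<times> real) + (nat \<times> 'd \<times> real)) set) E e.
      packing s \<sigma> d A \<kappa> I K c \<and> piece_cover s TYPE('d) A J E e \<and>
      (\<Sum>j\<in>J. e j ^ d) \<le> \<rho> \<epsilon> ^ d * (\<Sum>i\<in>I. c i ^ d) + \<kappa> \<and> 0 \<le> (\<Sum>i\<in>I. c i ^ d) \<and>
      ?H A \<le> ennreal (\<rho> \<epsilon> ^ d * (\<Sum>i\<in>I. c i ^ d) + \<kappa>)" if \<epsilon>: "0 < \<epsilon>" "\<epsilon> \<le> 1 / 2" and \<kappa>: "\<kappa> > 0" for \<epsilon> \<kappa>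
  proof -
    obtain I :: "(nat \<times> 'd \<times> real) set" and K E c and J :: "(nat \<times> 'd \<times> real) set" and E' e where
      pk: "packing s \<sigma> d A \<kappa> I K c" and finJ: "finite J" and
      cells: "\<forall>i\<in>I. K i \<subseteq> E i \<and> lower_piece s TYPE('d) A (E i) (\<rho> \<epsilon> * c i) \<and> ?H (E i) \<le> ennreal ((\<rho> \<epsilon> * c i) ^ d)" and
      low: "\<forall>j\<in>J. lower_piece s TYPE('d) A (E' j) (e j)" and
      cov: "A \<subseteq> (\<Union>i\<in>I. E i) \<union> (\<Union>j\<in>J. E' j)" and es: "(\<Sum>j\<in>J. e j ^ d) \<le> \<kappa>" and
      rest: "?H (A - (\<Union>i\<in>I. K i)) \<le> ennreal \<kappa>"
      using manifold_decomposition[OF M A fr \<sigma> s \<epsilon> \<kappa>] unfolding d_def \<rho>_def by auto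
    have finI: "finite I" using pk by (simp add: packing_def)
    have c: "c i > 0" if "i \<in> I" for i using pk that by (auto simp: packing_def upper_cell_def)
    have \<rho>: "\<rho> \<epsilon> > 0" using \<epsilon> by (simp add: \<rho>_def)
    define S where "S = (\<Sum>i\<in>I. c i ^ d)"
    have S0: "S \<ge> 0" unfolding S_def using c by (intro sum_nonneg) (simp add: less_imp_le)
    have \<rho>S: "(\<Sum>i\<in>I. (\<rho> \<epsilon> * c i) ^ d) = \<rho> \<epsilon> ^ d * S"
      by (simp add: S_def power_mult_distrib sum_distrib_left)
    have "?H A \<le> ?H ((\<Union>i\<in>I. E i) \<union> (A - (\<Union>i\<in>I. K i)))"
      by (rule hausdorff_outer_mono) (use cells in blast)
    also have "\<dots> \<le> (\<Sum>i\<in>I. ?H (E i)) + ennreal \<kappa>"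
      by (intro order_trans[OF hausdorff_outer_Un] add_mono hausdorff_outer_finite_UN finI rest)
    also have "\<dots> \<le> (\<Sum>i\<in>I. ennreal ((\<rho> \<epsilon> * c i) ^ d)) + ennreal \<kappa>"
      using cells by (intro add_right_mono sum_mono) blast
    also have "(\<Sum>i\<in>I. ennreal ((\<rho> \<epsilon> * c i) ^ d)) = ennreal (\<rho> \<epsilon> ^ d * S)"
      unfolding \<rho>S[symmetric] using c \<rho> by (intro sum_ennreal) (simp add: less_imp_le)
    also have "ennreal (\<rho> \<epsilon> ^ d * S) + ennreal \<kappa> = ennreal (\<rho> \<epsilon> ^ d * S + \<kappa>)"
      by (rule ennreal_plus[symmetric]) (use S0 \<rho> \<kappa> in simp_all)
    finally have HA: "?H A \<le> ennreal (\<rho> \<epsilon> ^ d * S + \<kappa>)" .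
    let ?E = "\<lambda>j. case j of Inl i \<Rightarrow> E i | Inr j \<Rightarrow> E' j" and ?e = "\<lambda>j. case j of Inl i \<Rightarrow> \<rho> \<epsilon> * c i | Inr j \<Rightarrow> e j"
    have pc: "piece_cover s TYPE('d) A (I <+> J) ?E ?e"
      unfolding piece_cover_def
    proof (intro conjI)
      show "finite (I <+> J)" using finI finJ by simp
      show "\<forall>j\<in>I <+> J. lower_piece s TYPE('d) A (?E j) (?e j)" using cells low by auto
      show "A \<subseteq> (\<Union>j\<in>I <+> J. ?E j)"
      proof
        fix x assume "x \<in> A"
        then consider i where "i \<in> I" "x \<in> E i" | j where "j \<in> J" "x \<in> E' j" using cov by blast
        then show "x \<in> (\<Union>j\<in>I <+> J. ?E j)"
        proof cases
          case 1 then show ?thesis by (intro UN_I[of "Inl i"]) auto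
        next
          case 2 then show ?thesis by (intro UN_I[of "Inr j"]) auto
        qed
      qed
    qed
    have "(\<Sum>j\<in>I <+> J. ?e j ^ d) = \<rho> \<epsilon> ^ d * S + (\<Sum>j\<in>J. e j ^ d)"
      using finI finJ by (simp add: sum.Plus \<rho>S)
    then have "(\<Sum>j\<in>I <+> J. ?e j ^ d) \<le> \<rho> \<epsilon> ^ d * S + \<kappa>" using es by linarith
    then show ?thesis using pk pc S0 HA unfolding S_def by blast
  qed
  \<comment> \<open>One decomposition with crude parameters shows finiteness. The value
    \<open>H\<close> must be known before \<open>t\<close> can be chosen in terms of it.\<close>
  have "?H A < top"
  proof -
    have "\<exists>x. ?H A \<le> ennreal x" using dec[of "1 / 2" 1] by auto
    then show ?thesis by (auto intro: le_less_trans)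
  qed
  then obtain H where H: "H \<ge> 0" "?H A = ennreal H" by (cases "?H A") auto
  have "(\<exists>(I :: (nat \<times> 'd \<times> real) set) K c. packing s \<sigma> d A \<epsilon> I K c \<and> H - \<epsilon> \<le> (\<Sum>i\<in>I. c i ^ d)) \<and>
    (\<exists>(J :: ((nat \<times> 'd \<times> real) + (nat \<times> 'd \<times> real)) set) E e. piece_cover s TYPE('d) A J E e \<and> (\<Sum>j\<in>J. e j ^ d) \<le> H + \<epsilon>)"
    if \<epsilon>: "\<epsilon> > 0" for \<epsilon>
  proof -
    have "((\<lambda>t. (\<rho> t ^ d - 1) * H) \<longlongrightarrow> (\<rho> 0 ^ d - 1) * H) (at_right 0)"
      unfolding \<rho>_def by (intro tendsto_intros) auto
    then have "((\<lambda>t. (\<rho> t ^ d - 1) * H) \<longlongrightarrow> 0) (at_right 0)" by (simp add: \<rho>_def)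
    then have "\<forall>\<^sub>F t in at_right 0. (\<rho> t ^ d - 1) * H < \<epsilon> / 2"
      by (rule order_tendstoD(2)) (use \<epsilon> in simp)
    then obtain b where b: "b > 0" "\<And>t. 0 < t \<Longrightarrow> t < b \<Longrightarrow> (\<rho> t ^ d - 1) * H < \<epsilon> / 2"
      unfolding eventually_at_right_field by auto
    define t where "t = min (b / 2) (1 / 2)"
    have t: "0 < t" "t \<le> 1 / 2" "t < b" using b(1) by (auto simp: t_def)
    have \<rho>H: "(\<rho> t ^ d - 1) * H < \<epsilon> / 2" using b(2) t by simp
    have \<rho>1: "\<rho> t \<ge> 1"
    proof -
      have "(1 - t)\<^sup>2 \<le> 1" using t by (intro power_le_one) auto
      then show ?thesis using t by (simp add: \<rho>_def le_divide_eq)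
    qed
    have \<epsilon>2: "\<epsilon> / 2 > 0" using \<epsilon> by simp
    obtain I :: "(nat \<times> 'd \<times> real) set" and K c and J :: "((nat \<times> 'd \<times> real) + (nat \<times> 'd \<times> real)) set" and E e where
      pk: "packing s \<sigma> d A (\<epsilon> / 2) I K c" and pc: "piece_cover s TYPE('d) A J E e" and
      es: "(\<Sum>j\<in>J. e j ^ d) \<le> \<rho> t ^ d * (\<Sum>i\<in>I. c i ^ d) + \<epsilon> / 2" and S0': "0 \<le> (\<Sum>i\<in>I. c i ^ d)" and
      HA: "?H A \<le> ennreal (\<rho> t ^ d * (\<Sum>i\<in>I. c i ^ d) + \<epsilon> / 2)"
      using dec[OF t(1,2) \<epsilon>2] by auto
    define S where "S = (\<Sum>i\<in>I. c i ^ d)"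
    have S0: "S \<ge> 0" using S0' by (simp add: S_def)
    have c: "c i > 0" if "i \<in> I" for i using pk that by (auto simp: packing_def upper_cell_def)
    have SH: "S \<le> H"
    proof -
      have "ennreal S = (\<Sum>i\<in>I. ennreal (c i ^ d))"
        unfolding S_def using c by (intro sum_ennreal[symmetric]) (simp add: less_imp_le)
      also have "\<dots> \<le> (\<Sum>i\<in>I. emeasure (hausdorff_measure d) (K i))"
        using pk by (intro sum_mono) (simp add: packing_def emeasure_hausdorff_measure)
      also have "\<dots> = emeasure (hausdorff_measure d) (\<Union>i\<in>I. K i)"
        by (rule sum_emeasure) (use pk in \<open>auto simp: packing_def\<close>)
      also have "\<dots> \<le> emeasure (hausdorff_measure d) A"
      proof (rule emeasure_mono)
        show "(\<Union>i\<in>I. K i) \<subseteq> A" using pk unfolding packing_def by blast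
      qed (use Ab in simp)
      also have "\<dots> = ennreal H" using Ab H by (simp add: emeasure_hausdorff_measure)
      finally show ?thesis using H by simp
    qed
    have HS: "H \<le> \<rho> t ^ d * S + \<epsilon> / 2"
      using HA S0 \<rho>1 \<epsilon> unfolding H(2) S_def[symmetric] by (subst (asm) ennreal_le_iff) auto
    have \<rho>S: "(\<rho> t ^ d - 1) * S \<le> (\<rho> t ^ d - 1) * H"
      using SH \<rho>1 by (intro mult_left_mono) auto
    then have "H - \<epsilon> \<le> S" using HS \<rho>H by (simp add: algebra_simps)
    moreover have "(\<Sum>j\<in>J. e j ^ d) \<le> H + \<epsilon>" using es \<rho>S \<rho>H SH by (simp add: S_def[symmetric] algebra_simps)
    moreover have "packing s \<sigma> d A \<epsilon> I K c"
      by (rule packing_mono[OF pk]) (use \<epsilon> in simp)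
    ultimately show ?thesis using pc unfolding S_def by blast
  qed
  then show ?thesis using H unfolding decomposable_def d_def by blast
qed

lemma ennreal_le_divide_real:
  assumes "ennreal (\<tau> * x) \<le> y" "x > 0" shows "ennreal \<tau> \<le> y / ennreal x"
proof (cases "\<tau> \<ge> 0")
  case True
  have "ennreal \<tau> = ennreal (\<tau> * x) / ennreal x" using assms(2) True by (simp add: divide_ennreal)
  also have "\<dots> \<le> y / ennreal x" by (rule divide_right_mono_ennreal[OF assms(1)])
  finally show ?thesis .
qed (simp add: ennreal_neg)

lemma ennreal_divide_real_le:
  assumes "y \<le> ennreal (\<tau> * x)" "x > 0" "\<tau> \<ge> 0" shows "y / ennreal x \<le> ennreal \<tau>"
proof -
  have "y / ennreal x \<le> ennreal (\<tau> * x) / ennreal x" by (rule divide_right_mono_ennreal[OF assms(1)])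
  also have "\<dots> = ennreal \<tau>" using assms(2,3) by (simp add: divide_ennreal)
  finally show ?thesis .
qed

subsection \<open>The limits\<close>

text \<open>Covers of sum at most \<open>H + \<epsilon>\<close> give the lower bound and packings of
  sum at least \<open>H - \<epsilon>\<close> the upper one; both constants converge as
  \<open>\<epsilon>\<close> tends to 0. For \<open>H = 0\<close> the lower bound alone
  diverges.\<close>

lemma polar_max_limit:
  fixes A :: "'p::euclidean_space set" and s H :: real
  assumes \<sigma>: "cube_const s TYPE('d::euclidean_space) \<sigma>" and s: "s > DIM('d)" and ne: "A \<noteq> {}" and H0: "H \<ge> 0"
    and dec: "decomposable s \<sigma> TYPE('d) A H"
  shows "H > 0 \<Longrightarrow> (\<lambda>N. polar_max s A N / ennreal (real N powr (s / DIM('d)))) \<longlonglongrightarrow> ennreal (\<sigma> / H powr (s / DIM('d)))"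
    and "H = 0 \<Longrightarrow> (\<lambda>N. polar_max s A N / ennreal (real N powr (s / DIM('d)))) \<longlonglongrightarrow> top"
proof -
  define a where "a = s / DIM('d)"
  have a: "a > 1" using s by (simp add: a_def)
  have \<sigma>0: "\<sigma> > 0" using \<sigma> by (simp add: cube_const_def)
  let ?q = "\<lambda>N. polar_max s A N / ennreal (real N powr a)"
  have lower: "\<forall>\<^sub>F N in sequentially. ennreal \<tau> \<le> ?q N" if \<epsilon>: "\<epsilon> > 0" and \<tau>: "\<tau> < \<sigma> * (H + \<epsilon>) powr (- a)" for \<epsilon> \<tau>
  proof -
    obtain J :: "((nat \<times> 'd \<times> real) + (nat \<times> 'd \<times> real)) set" and E e where J': "piece_cover s TYPE('d) A J E e" "(\<Sum>j\<in>J. e j ^ DIM('d)) \<le> H + \<epsilon>"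
      using dec \<epsilon> unfolding decomposable_def by blast
    then have J: "finite J" "\<forall>j\<in>J. lower_piece s TYPE('d) A (E j) (e j)" "A \<subseteq> (\<Union>j\<in>J. E j)" "(\<Sum>j\<in>J. e j ^ DIM('d)) \<le> H + \<epsilon>"
      by (simp_all add: piece_cover_def)
    have J0: "J \<noteq> {}" using ne J(3) by auto
    have e: "e j > 0" if "j \<in> J" for j using J(2) that by (simp add: lower_piece_def)
    have S: "(\<Sum>j\<in>J. e j ^ DIM('d)) > 0" using J(1) J0 e by (intro sum_pos) auto
    have "(H + \<epsilon>) powr (- a) \<le> (\<Sum>j\<in>J. e j ^ DIM('d)) powr (- a)"
      using S J(4) a by (intro powr_mono2') auto
    then have "\<sigma> * (H + \<epsilon>) powr (- a) \<le> \<sigma> * (\<Sum>j\<in>J. e j ^ DIM('d)) powr (- a)"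
      using \<sigma>0 by (intro mult_left_mono) auto
    then have "\<tau> < \<sigma> * (\<Sum>j\<in>J. e j ^ DIM('d)) powr (- a)" using \<tau> by linarith
    then have "\<forall>\<^sub>F N in sequentially. ennreal (\<tau> * real N powr a) \<le> polar_max s A N"
      using polar_max_lower[OF \<sigma> s J(1) J0 _ J(3) ne, of e \<tau>] J(2) unfolding a_def by blast
    then show ?thesis using eventually_ge_at_top[of 1]
      by eventually_elim (intro ennreal_le_divide_real, auto)
  qed
  show "H > 0 \<Longrightarrow> (\<lambda>N. polar_max s A N / ennreal (real N powr (s / DIM('d)))) \<longlonglongrightarrow> ennreal (\<sigma> / H powr (s / DIM('d)))"
    unfolding a_def[symmetric]
  proof (rule order_tendstoI)
    assume H: "H > 0"
    define v where "v = \<sigma> / H powr a"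
    have v: "v > 0" using H \<sigma>0 by (simp add: v_def)
    have v': "\<sigma> * H powr (- a) = v" by (simp add: v_def powr_minus divide_inverse)
    {
      fix l assume l: "l < ennreal (\<sigma> / H powr a)"
      then obtain l' where l': "l = ennreal l'" "0 \<le> l'" by (cases l) auto
      then have lv: "l' < v" using l v by (simp add: v_def[symmetric] ennreal_less_iff)
      have "((\<lambda>\<epsilon>. \<sigma> * (H + \<epsilon>) powr (- a)) \<longlongrightarrow> \<sigma> * (H + 0) powr (- a)) (at_right 0)"
        by (intro tendsto_intros) (use H in auto)
      then have "\<forall>\<^sub>F \<epsilon> in at_right 0. (l' + v) / 2 < \<sigma> * (H + \<epsilon>) powr (- a)"
        by (rule order_tendstoD(1)) (use lv v' in simp)
      then obtain b where b: "b > 0" "\<And>\<epsilon>. 0 < \<epsilon> \<Longrightarrow> \<epsilon> < b \<Longrightarrow> (l' + v) / 2 < \<sigma> * (H + \<epsilon>) powr (- a)"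
        unfolding eventually_at_right_field by auto
      have ev: "\<forall>\<^sub>F N in sequentially. ennreal ((l' + v) / 2) \<le> ?q N"
        by (rule lower[of "b / 2"]) (use b in auto)
      have lt: "l < ennreal ((l' + v) / 2)" using l' lv by (simp add: ennreal_less_iff)
      show "\<forall>\<^sub>F N in sequentially. l < ?q N"
        by (rule eventually_mono[OF ev]) (rule less_le_trans[OF lt])
    }
    {
      fix u assume u: "ennreal (\<sigma> / H powr a) < u"
      obtain \<tau> where \<tau>: "v < \<tau>" "ennreal \<tau> < u"
      proof (cases u)
        case (real u')
        then have "v < u'" using u v by (simp add: v_def[symmetric] ennreal_less_iff)
        then show thesis using real v by (intro that[of "(v + u') / 2"]) (auto simp: ennreal_less_iff)
      next
        case top
        then show thesis by (intro that[of "v + 1"]) auto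
      qed
      have "((\<lambda>\<epsilon>. \<sigma> * (H - \<epsilon>) powr (- a)) \<longlongrightarrow> \<sigma> * (H - 0) powr (- a)) (at_right 0)"
        by (intro tendsto_intros) (use H in auto)
      then have "\<forall>\<^sub>F \<epsilon> in at_right 0. \<sigma> * (H - \<epsilon>) powr (- a) < \<tau>"
        by (rule order_tendstoD(2)) (use \<tau> v' in simp)
      then obtain b where b: "b > 0" "\<And>\<epsilon>. 0 < \<epsilon> \<Longrightarrow> \<epsilon> < b \<Longrightarrow> \<sigma> * (H - \<epsilon>) powr (- a) < \<tau>"
        unfolding eventually_at_right_field by auto
      define \<epsilon> where "\<epsilon> = min (b / 2) (H / 2)"
      have \<epsilon>: "\<epsilon> > 0" "\<epsilon> < b" "\<epsilon> < H" using b H by (auto simp: \<epsilon>_def)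
      obtain I :: "(nat \<times> 'd \<times> real) set" and K c where pk: "packing s \<sigma> DIM('d) A \<epsilon> I K c" and csum: "H - \<epsilon> \<le> (\<Sum>i\<in>I. c i ^ DIM('d))"
        using dec \<epsilon>(1) unfolding decomposable_def by blast
      then have I: "finite I" "disjoint_family_on K I" "\<forall>i\<in>I. upper_cell s a \<sigma> A (K i) (c i)" "H - \<epsilon> \<le> (\<Sum>i\<in>I. c i ^ DIM('d))"
        by (simp_all add: packing_def a_def)
      have I0: "I \<noteq> {}" using I(4) \<epsilon> by auto
      have "(\<Sum>i\<in>I. c i ^ DIM('d)) powr (- a) \<le> (H - \<epsilon>) powr (- a)"
        using I(4) \<epsilon> a by (intro powr_mono2') auto
      then have "\<sigma> * (\<Sum>i\<in>I. c i ^ DIM('d)) powr (- a) \<le> \<sigma> * (H - \<epsilon>) powr (- a)"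
        using \<sigma>0 by (intro mult_left_mono) auto
      also have "\<dots> < \<tau>" using b(2) \<epsilon> by simp
      finally have "\<forall>\<^sub>F N in sequentially. polar_max s A N \<le> ennreal (\<tau> * real N powr a)"
        using polar_max_upper[OF a_def a \<sigma>0 I(1) I0 I(2)] I(3) by blast
      then show "\<forall>\<^sub>F N in sequentially. ?q N < u" using eventually_ge_at_top[of 1]
      proof eventually_elim
        case (elim N)
        then have "?q N \<le> ennreal \<tau>" using \<tau> v by (intro ennreal_divide_real_le) auto
        then show ?case using \<tau>(2) by (rule le_less_trans)
      qed
    }
  qed
  show "H = 0 \<Longrightarrow> (\<lambda>N. polar_max s A N / ennreal (real N powr (s / DIM('d)))) \<longlonglongrightarrow> top"
    unfolding a_def[symmetric] tendsto_top_iff_ennreal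
  proof (intro allI impI)
    fix l :: real assume H: "H = 0" and l: "0 \<le> l"
    \<comment> \<open>Solves \<open>\<sigma> * \<epsilon> powr (- a) = l + 2\<close>, which leaves
      room for two strict inequalities.\<close>
    define \<epsilon> where "\<epsilon> = (\<sigma> / (l + 2)) powr (1 / a)"
    have \<epsilon>: "\<epsilon> > 0" using \<sigma>0 l by (simp add: \<epsilon>_def)
    have "\<epsilon> powr a = \<sigma> / (l + 2)" using \<sigma>0 l a by (simp add: \<epsilon>_def powr_powr)
    then have "\<sigma> * \<epsilon> powr (- a) = l + 2" using \<sigma>0 l by (simp add: powr_minus)
    then have ev: "\<forall>\<^sub>F N in sequentially. ennreal (l + 1) \<le> ?q N" using \<epsilon> H by (intro lower[of \<epsilon>]) auto
    have lt: "ennreal l < ennreal (l + 1)" using l by (simp add: ennreal_less_iff)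
    show "\<forall>\<^sub>F N in sequentially. ennreal l < ?q N"
      by (rule eventually_mono[OF ev]) (rule less_le_trans[OF lt])
  qed
qed

section \<open>Weak-star convergence of the counting measures\<close>

lemma integrable_hausdorff_compact:
  fixes A :: "'p::euclidean_space set" and f :: "'p \<Rightarrow> real"
  assumes A: "compact A" "hausdorff_outer d A < top" and f: "continuous_on A f"
  shows "set_integrable (hausdorff_measure d) A f"
proof -
  have Ab: "A \<in> sets borel" using A(1) by (rule borel_compact)
  obtain B where B: "\<And>x. x \<in> A \<Longrightarrow> norm (f x) \<le> B"
    using compact_imp_bounded[OF compact_continuous_image[OF f A(1)]] unfolding bounded_iff by blast
  have m: "(\<lambda>x. indicator A x *\<^sub>R f x) \<in> borel_measurable (hausdorff_measure d)"
    using borel_measurable_continuous_on_indicator[OF Ab f] by (simp cong: measurable_cong_sets)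
  have i: "integrable (hausdorff_measure d) (\<lambda>x. B *\<^sub>R indicator A x :: real)"
    using A(2) Ab by (intro integrable_scaleR_right integrable_real_indicator) (auto simp: emeasure_hausdorff_measure)
  show ?thesis
    unfolding set_integrable_def
    by (rule Bochner_Integration.integrable_bound[OF i m])
       (use B in \<open>auto simp: indicator_def intro!: AE_I2 order_trans[OF _ abs_ge_self]\<close>)
qed

text \<open>An optimal configuration puts asymptotically at least the fraction \<open>c i ^ d / H\<close> of its points into each
  cell, which bounds averages of nonnegative functions from below. Applying this to \<open>f + B\<close> and \<open>B - f\<close>
  gives weak convergence.\<close>

lemma weak_limit_lower:
  fixes A :: "'p::euclidean_space set" and s H :: real and f :: "'p \<Rightarrow> real"
  assumes \<sigma>: "cube_const s TYPE('d::euclidean_space) \<sigma>" and s: "s > DIM('d)"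
    and H: "H > 0" and A: "compact A" "A \<noteq> {}" "hausdorff_outer DIM('d) A = ennreal H"
    and dec: "decomposable s \<sigma> TYPE('d) A H" and opt: "asymp_optimal s A \<omega>"
    and f: "continuous_on A f" "\<And>x. x \<in> A \<Longrightarrow> f x \<ge> 0" and t: "t > 0"
  shows "\<forall>\<^sub>F N in sequentially. (LINT x:A|hausdorff_measure DIM('d). f x) / H - t \<le> (\<Sum>j<N. f (\<omega> N j)) / real N"
proof -
  define d where "d = DIM('d)"
  define a where "a = s / d"
  have a: "a > 1" using s by (simp add: a_def d_def)
  have \<sigma>0: "\<sigma> > 0" using \<sigma> by (simp add: cube_const_def)
  have HA: "hausdorff_outer d A = ennreal H" using A(3) by (simp add: d_def)
  have lim: "(\<lambda>N. polar_max s A N / ennreal (real N powr a)) \<longlonglongrightarrow> ennreal (\<sigma> / H powr a)"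
    using polar_max_limit(1)[OF \<sigma> s A(2) _ dec H] H by (simp add: a_def d_def)
  let ?\<nu> = "hausdorff_measure d :: 'p measure"
  have Ab: "A \<in> sets borel" using A(1) by (rule borel_compact)
  obtain B0 where "\<And>x. x \<in> A \<Longrightarrow> norm (f x) \<le> B0"
    using compact_imp_bounded[OF compact_continuous_image[OF f(1) A(1)]] unfolding bounded_iff by blast
  then have B: "\<And>x. x \<in> A \<Longrightarrow> f x \<le> \<bar>B0\<bar> + 1" by fastforce
  define B where "B = \<bar>B0\<bar> + 1"
  have B1: "B > 0" "\<And>x. x \<in> A \<Longrightarrow> f x \<le> B" using B by (auto simp: B_def)
  define w where "w = t / 8"
  have w: "w > 0" using t by (simp add: w_def)
  have "uniformly_continuous_on A f" by (rule compact_uniformly_continuous[OF f(1) A(1)])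
  then have "\<exists>\<delta>>0. \<forall>x\<in>A. \<forall>y\<in>A. dist y x < \<delta> \<longrightarrow> dist (f y) (f x) < w"
    using w by (simp add: uniformly_continuous_on_def)
  then obtain \<delta> where \<delta>: "\<delta> > 0" "\<And>x y. x \<in> A \<Longrightarrow> y \<in> A \<Longrightarrow> dist y x < \<delta> \<Longrightarrow> dist (f y) (f x) < w"
    by blast
  \<comment> \<open>The minimum makes the oscillation of \<open>f\<close> on a cell small, keeps
    \<open>1 - \<epsilon>\<close> positive and bounds by \<open>t / 2\<close> the two errors
    \<open>B / H * \<epsilon>\<close> (measure missed by the packing) and
    \<open>B * \<epsilon>\<close> (points missed by the count). The oscillation adds
    \<open>2 * w = t / 4\<close>.\<close>
  define \<epsilon> where "\<epsilon> = min (min (\<delta> / 2) (1 / 2)) (t / (2 * (B / H + B)))"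
  have BH: "B / H + B > 0" using B1 H by (intro add_pos_pos) auto
  have \<epsilon>: "\<epsilon> > 0" "\<epsilon> < \<delta>" "\<epsilon> < 1" using \<delta>(1) t BH by (auto simp: \<epsilon>_def)
  have \<epsilon>B: "\<epsilon> * (B / H + B) \<le> t / 2"
  proof -
    have "\<epsilon> \<le> t / (2 * (B / H + B))" by (simp add: \<epsilon>_def)
    then have "\<epsilon> * (B / H + B) \<le> t / (2 * (B / H + B)) * (B / H + B)" using BH by (intro mult_right_mono) auto
    also have "\<dots> = t / 2"
    proof -
      have "t / (2 * k) * k = t / 2" if "k > 0" for k :: real using that by simp
      then show ?thesis using BH by blast
    qed
    finally show ?thesis .
  qed
  obtain I :: "(nat \<times> 'd \<times> real) set" and K c where pk: "packing s \<sigma> d A \<epsilon> I K c" and csum: "H - \<epsilon> \<le> (\<Sum>i\<in>I. c i ^ d)"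
    using dec \<epsilon>(1) unfolding decomposable_def d_def by blast
  have I: "finite I" "disjoint_family_on K I" using pk by (auto simp: packing_def)
  have KA: "K i \<subseteq> A" "K i \<in> sets borel" "c i > 0" "upper_cell s a \<sigma> A (K i) (c i)"
    and Kd: "\<And>x y. x \<in> K i \<Longrightarrow> y \<in> K i \<Longrightarrow> dist x y \<le> \<epsilon>"
    and Kc: "ennreal (c i ^ d) \<le> hausdorff_outer d (K i)" if "i \<in> I" for i
    using pk that by (auto simp: packing_def upper_cell_def a_def)
  have fm: "S \<in> fmeasurable ?\<nu>" if "S \<subseteq> A" "S \<in> sets borel" for S
  proof -
    have "hausdorff_outer d S \<le> ennreal H" using hausdorff_outer_mono[OF that(1)] HA by metis
    then have "hausdorff_outer d S < top" by (rule le_less_trans) simp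
    then show ?thesis using that(2) by (simp add: fmeasurable_def emeasure_hausdorff_measure)
  qed
  define m where "m i = measure ?\<nu> (K i)" for i
  have mc: "c i ^ d \<le> m i" if i: "i \<in> I" for i
  proof -
    have "ennreal (c i ^ d) \<le> emeasure ?\<nu> (K i)" using Kc[OF i] KA(2)[OF i] by (simp add: emeasure_hausdorff_measure)
    also have "\<dots> = ennreal (m i)" using fm[OF KA(1,2)[OF i]] by (simp add: m_def emeasure_eq_measure2)
    finally show ?thesis by (simp add: m_def)
  qed
  define R where "R = A - (\<Union>i\<in>I. K i)"
  have Kb: "(\<Union>i\<in>I. K i) \<in> sets borel" using I(1) KA by (intro sets.finite_UN) auto
  have Rb: "R \<in> sets borel" "R \<subseteq> A" using Ab Kb by (auto simp: R_def)
  have mA: "measure ?\<nu> A = H" using HA Ab H by (simp add: measure_def emeasure_hausdorff_measure)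
  have mtot: "(\<Sum>i\<in>I. m i) + measure ?\<nu> R = H"
  proof -
    have "measure ?\<nu> (\<Union>i\<in>I. K i) = (\<Sum>i\<in>I. m i)"
      unfolding m_def
    proof (rule measure_finite_Union)
      show "K ` I \<subseteq> sets ?\<nu>" using KA(2) by auto
      show "emeasure ?\<nu> (K i) \<noteq> \<infinity>" if "i \<in> I" for i
        using fmeasurableD2[OF fm[OF KA(1,2)[OF that]]] by simp
    qed (use I in auto)
    moreover have "measure ?\<nu> ((\<Union>i\<in>I. K i) \<union> R) = measure ?\<nu> (\<Union>i\<in>I. K i) + measure ?\<nu> R"
      by (rule measure_disjoint_Un) (use Kb Rb KA(1) in \<open>auto intro!: fm simp: R_def\<close>)
    moreover have "(\<Union>i\<in>I. K i) \<union> R = A" using KA(1) by (auto simp: R_def)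
    ultimately show ?thesis using mA by simp
  qed
  have "\<exists>b. 0 \<le> b \<and> b \<le> B \<and> (\<forall>x\<in>K i. b \<le> f x \<and> f x \<le> b + 2 * w)" if i: "i \<in> I" for i
  proof -
    have "K i \<noteq> {}"
    proof
      assume "K i = {}"
      then have "c i ^ d \<le> 0" using mc[OF i] by (simp add: m_def)
      then show False using zero_less_power[OF KA(3)[OF i], of d] by linarith
    qed
    then obtain x0 where x0: "x0 \<in> K i" by blast
    have "\<bar>f x - f x0\<bar> < w" if x: "x \<in> K i" for x
    proof -
      have "dist x x0 \<le> \<epsilon>" by (rule Kd[OF i x x0])
      then have "dist (f x) (f x0) < w" using \<delta>(2)[of x0 x] KA(1)[OF i] x x0 \<epsilon> by auto
      then show ?thesis by (simp add: dist_real_def)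
    qed
    then have *: "f x0 - w \<le> f x \<and> f x \<le> f x0 + w" if "x \<in> K i" for x using that by (force simp: abs_less_iff)
    have "x0 \<in> A" using x0 KA(1)[OF i] by blast
    then have "0 \<le> f x0" "f x0 \<le> B" using f(2) B1(2) by auto
    have f0: "0 \<le> f x" if "x \<in> K i" for x using that KA(1)[OF i] f(2) by blast
    show ?thesis
    proof (intro exI[of _ "max 0 (f x0 - w)"] conjI ballI)
      fix x assume x: "x \<in> K i"
      show "max 0 (f x0 - w) \<le> f x" using *[OF x] f0[OF x] by simp
      show "f x \<le> max 0 (f x0 - w) + 2 * w" using *[OF x] by linarith
    qed (use \<open>f x0 \<le> B\<close> w B1 in auto)
  qed
  then obtain b where b: "\<And>i. i \<in> I \<Longrightarrow> 0 \<le> b i" "\<And>i. i \<in> I \<Longrightarrow> b i \<le> B"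
    "\<And>i x. i \<in> I \<Longrightarrow> x \<in> K i \<Longrightarrow> b i \<le> f x" "\<And>i x. i \<in> I \<Longrightarrow> x \<in> K i \<Longrightarrow> f x \<le> b i + 2 * w"
    by metis
  \<comment> \<open>A lower sum for the integral with weights \<open>c i ^ d\<close> in place of the
    measures of the cells, as the point counts are controlled through these weights. The uncovered
    part and the excess of the measures together amount to at most
    \<open>\<epsilon>\<close>.\<close>
  define X where "X = (\<Sum>i\<in>I. b i * c i ^ d)"
  have cm: "(\<Sum>i\<in>I. c i ^ d) \<le> H"
  proof -
    have "(\<Sum>i\<in>I. c i ^ d) \<le> (\<Sum>i\<in>I. m i)" by (rule sum_mono) (rule mc)
    then show ?thesis using mtot measure_nonneg[of ?\<nu> R] by linarith
  qed
  have int: "(LINT x:A|?\<nu>. f x) \<le> X + B * \<epsilon> + 2 * w * H"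
  proof -
    define h where "h x = (\<Sum>i\<in>I. (b i + 2 * w) * indicator (K i) x) + B * indicator R x" for x
    have ii: "integrable ?\<nu> (\<lambda>x. k * indicator S x :: real)" if "S \<subseteq> A" "S \<in> sets borel" for S k
      using fm[OF that] by (intro integrable_mult_right integrable_real_indicator) (auto simp: fmeasurable_def)
    have ih: "integrable ?\<nu> h"
      unfolding h_def by (intro Bochner_Integration.integrable_add Bochner_Integration.integrable_sum ii) (use KA Rb in auto)
    have "(LINT x:A|?\<nu>. f x) \<le> (\<integral>x. h x \<partial>?\<nu>)"
      unfolding set_lebesgue_integral_def
    proof (rule integral_mono[OF _ ih])
      show "integrable ?\<nu> (\<lambda>x. indicator A x *\<^sub>R f x)"
        using integrable_hausdorff_compact[OF A(1) _ f(1), of d] HA by (simp add: set_integrable_def)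
      fix x
      have nn: "0 \<le> (\<Sum>i\<in>I. (b i + 2 * w) * indicator (K i) x)"
        using b(1) w by (intro sum_nonneg mult_nonneg_nonneg) auto
      show "indicator A x *\<^sub>R f x \<le> h x"
      proof (cases "x \<in> A")
        case True
        show ?thesis
        proof (cases "x \<in> R")
          case True
          then show ?thesis using nn B1(2)[of x] Rb(2) by (auto simp: h_def)
        next
          case False
          then obtain i where i: "i \<in> I" "x \<in> K i" using True by (auto simp: R_def)
          have "f x \<le> (b i + 2 * w) * indicator (K i) x" using b(4)[OF i] i by simp
          also have "\<dots> \<le> (\<Sum>i\<in>I. (b i + 2 * w) * indicator (K i) x)"
            using b(1) w I(1) i(1) by (intro member_le_sum) auto
          finally show ?thesis using True False by (simp add: h_def)
        qed
      next
        case False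
        then show ?thesis using nn B1(1) Rb(2) by (auto simp: h_def)
      qed
    qed
    also have "(\<integral>x. h x \<partial>?\<nu>) = (\<Sum>i\<in>I. (b i + 2 * w) * m i) + B * measure ?\<nu> R"
      unfolding h_def using KA Rb
      by (subst Bochner_Integration.integral_add, (intro Bochner_Integration.integrable_sum ii; blast), (intro ii; blast),
          subst Bochner_Integration.integral_sum, (intro ii; blast)) (simp add: m_def)
    also have "(\<Sum>i\<in>I. (b i + 2 * w) * m i) \<le> (\<Sum>i\<in>I. b i * c i ^ d + B * (m i - c i ^ d) + 2 * w * m i)"
    proof (rule sum_mono)
      fix i assume i: "i \<in> I"
      have "b i * (m i - c i ^ d) \<le> B * (m i - c i ^ d)" using b(2)[OF i] mc[OF i] by (intro mult_right_mono) auto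
      then show "(b i + 2 * w) * m i \<le> b i * c i ^ d + B * (m i - c i ^ d) + 2 * w * m i" by (simp add: algebra_simps)
    qed
    also have "\<dots> = X + B * ((\<Sum>i\<in>I. m i) - (\<Sum>i\<in>I. c i ^ d)) + 2 * w * (\<Sum>i\<in>I. m i)"
      by (simp add: X_def sum.distrib sum_distrib_left sum_subtractf right_diff_distrib)
    finally have "(LINT x:A|?\<nu>. f x) \<le> X + B * ((\<Sum>i\<in>I. m i) - (\<Sum>i\<in>I. c i ^ d)) + 2 * w * (\<Sum>i\<in>I. m i) + B * measure ?\<nu> R"
      by simp
    also have "\<dots> = X + B * (H - (\<Sum>i\<in>I. c i ^ d)) + 2 * w * (\<Sum>i\<in>I. m i)"
      using mtot[symmetric] by (simp add: algebra_simps)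
    also have "\<dots> \<le> X + B * \<epsilon> + 2 * w * H"
      using B1(1) csum w mtot measure_nonneg[of ?\<nu> R] by (intro add_mono mult_left_mono) auto
    finally show ?thesis .
  qed
  have XB: "X \<le> B * H"
  proof -
    have "X \<le> (\<Sum>i\<in>I. B * c i ^ d)"
      unfolding X_def using b(2) KA(3) by (intro sum_mono mult_right_mono) (auto simp: less_imp_le)
    also have "\<dots> = B * (\<Sum>i\<in>I. c i ^ d)" by (simp add: sum_distrib_left)
    also have "\<dots> \<le> B * H" using cm B1 by (intro mult_left_mono) auto
    finally show ?thesis .
  qed
  define n where "n N i = card {j. j < N \<and> \<omega> N j \<in> K i}" for N i
  \<comment> \<open>The factor \<open>1 - \<epsilon>\<close> supplies the strict inequality that
    \<open>asymp_optimal_count\<close> requires.\<close>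
  have "\<forall>\<^sub>F N in sequentially. (1 - \<epsilon>) * c i ^ d / H * real N \<le> real (n N i)" if i: "i \<in> I" for i
    unfolding n_def
  proof (rule asymp_optimal_count[OF a_def a \<sigma>0 H lim opt])
    show "upper_cell s a \<sigma> A (K i) (c i)" by (rule KA(4)[OF i])
    have "c i ^ d > 0" using KA(3)[OF i] by simp
    then have "(1 - \<epsilon>) * c i ^ d < 1 * c i ^ d" using \<epsilon> by (intro mult_strict_right_mono) auto
    then show "(1 - \<epsilon>) * c i ^ d / H < c i ^ d / H" using H by (simp add: divide_strict_right_mono)
    show "0 \<le> (1 - \<epsilon>) * c i ^ d / H" using H \<epsilon> \<open>c i ^ d > 0\<close> by simp
  qed
  then have "\<forall>\<^sub>F N in sequentially. \<forall>i\<in>I. (1 - \<epsilon>) * c i ^ d / H * real N \<le> real (n N i)"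
    using I(1) by (simp add: eventually_ball_finite)
  then show ?thesis using eventually_ge_at_top[of 1]
    unfolding d_def[symmetric]
  proof eventually_elim
    case (elim N)
    have \<omega>A: "\<omega> N j \<in> A" if "j < N" for j using opt that by (auto simp: asymp_optimal_def configs_def)
    have "(1 - \<epsilon>) * X / H * real N = (\<Sum>i\<in>I. b i * ((1 - \<epsilon>) * c i ^ d / H * real N))"
      by (simp add: X_def sum_distrib_left sum_distrib_right sum_divide_distrib mult_ac)
    also have "\<dots> \<le> (\<Sum>i\<in>I. b i * real (n N i))"
      using elim(1) b(1) by (intro sum_mono mult_left_mono) auto
    also have "\<dots> = (\<Sum>i\<in>I. \<Sum>j\<in>{j. j < N \<and> \<omega> N j \<in> K i}. b i)" by (simp add: n_def mult.commute)
    also have "\<dots> \<le> (\<Sum>i\<in>I. \<Sum>j\<in>{j. j < N \<and> \<omega> N j \<in> K i}. f (\<omega> N j))"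
      using b(3) by (intro sum_mono) auto
    also have "\<dots> = (\<Sum>j\<in>(\<Union>i\<in>I. {j. j < N \<and> \<omega> N j \<in> K i}). f (\<omega> N j))"
    proof (rule sum.UNION_disjoint[symmetric])
      show "\<forall>i\<in>I. \<forall>k\<in>I. i \<noteq> k \<longrightarrow> {j. j < N \<and> \<omega> N j \<in> K i} \<inter> {j. j < N \<and> \<omega> N j \<in> K k} = {}"
        using I(2) unfolding disjoint_family_on_def by blast
    qed (use I(1) in auto)
    also have "\<dots> \<le> (\<Sum>j<N. f (\<omega> N j))"
      using \<omega>A f(2) by (intro sum_mono2) auto
    finally have "(1 - \<epsilon>) * X / H \<le> (\<Sum>j<N. f (\<omega> N j)) / real N" using elim(2) by (simp add: le_divide_eq)
    moreover have "(1 - \<epsilon>) * X / H \<ge> X / H - \<epsilon> * B"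
    proof -
      have "\<epsilon> * X / H \<le> \<epsilon> * (B * H) / H" using XB \<epsilon> H by (intro divide_right_mono mult_left_mono) auto
      then show ?thesis using H by (simp add: left_diff_distrib diff_divide_distrib)
    qed
    moreover have "(LINT x:A|?\<nu>. f x) / H \<le> X / H + B / H * \<epsilon> + 2 * w"
    proof -
      have "(LINT x:A|?\<nu>. f x) / H \<le> (X + B * \<epsilon> + 2 * w * H) / H" using int H by (intro divide_right_mono) auto
      then show ?thesis using H by (simp add: add_divide_distrib)
    qed
    moreover have "B / H * \<epsilon> + \<epsilon> * B \<le> t / 2" using \<epsilon>B by (simp add: algebra_simps)
    ultimately show ?case using t by (simp add: w_def)
  qed
qed

text \<open>A one-sided bound for nonnegative functions is enough: the two sides have equal total
  mass, so the constant \<open>B\<close> contributes the same to both, and \<open>B - f\<close>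
  yields the missing direction.\<close>

lemma weak_limit:
  fixes A :: "'p::euclidean_space set" and s H :: real and f :: "'p \<Rightarrow> real"
  assumes \<sigma>: "cube_const s TYPE('d::euclidean_space) \<sigma>" and s: "s > DIM('d)"
    and H: "H > 0" and A: "compact A" "A \<noteq> {}" "hausdorff_outer DIM('d) A = ennreal H"
    and dec: "decomposable s \<sigma> TYPE('d) A H" and opt: "asymp_optimal s A \<omega>"
    and f: "continuous_on A f"
  shows "(\<lambda>N. (\<Sum>j<N. f (\<omega> N j)) / real N) \<longlonglongrightarrow> (LINT x:A|hausdorff_measure DIM('d). f x) / H"
proof (rule tendstoI)
  fix t :: real assume t: "t > 0"
  let ?\<nu> = "hausdorff_measure DIM('d) :: 'p measure"
  have Ab: "A \<in> sets borel" using A(1) by (rule borel_compact)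
  have mA: "measure ?\<nu> A = H" using A(3) Ab H by (simp add: measure_def emeasure_hausdorff_measure)
  have fin: "hausdorff_outer DIM('d) A < top" using A(3) by simp
  obtain B where B: "\<And>x. x \<in> A \<Longrightarrow> norm (f x) \<le> B"
    using compact_imp_bounded[OF compact_continuous_image[OF f A(1)]] unfolding bounded_iff by blast
  have ic: "set_integrable ?\<nu> A (\<lambda>x. B)" by (rule integrable_hausdorff_compact[OF A(1) fin continuous_on_const])
  have if': "set_integrable ?\<nu> A f" by (rule integrable_hausdorff_compact[OF A(1) fin f])
  have cB: "(LINT x:A|?\<nu>. B) = B * H"
    using Ab mA by (simp add: set_lebesgue_integral_def)
  note low = weak_limit_lower[OF \<sigma> s H A dec opt]
  have 1: "\<forall>\<^sub>F N in sequentially. (LINT x:A|?\<nu>. f x + B) / H - t / 2 \<le> (\<Sum>j<N. f (\<omega> N j) + B) / real N"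
    by (rule low) (use B t in \<open>auto intro!: continuous_intros f simp: abs_le_iff\<close>, fastforce simp: abs_le_iff)
  have 2: "\<forall>\<^sub>F N in sequentially. (LINT x:A|?\<nu>. B - f x) / H - t / 2 \<le> (\<Sum>j<N. B - f (\<omega> N j)) / real N"
    by (rule low) (use B t in \<open>auto intro!: continuous_intros f simp: abs_le_iff\<close>)
  have i1: "(LINT x:A|?\<nu>. f x + B) = (LINT x:A|?\<nu>. f x) + B * H"
    using set_integral_add(2)[OF if' ic] cB by simp
  have i2: "(LINT x:A|?\<nu>. B - f x) = B * H - (LINT x:A|?\<nu>. f x)"
    using set_integral_diff(2)[OF ic if'] cB by simp
  show "\<forall>\<^sub>F N in sequentially. dist ((\<Sum>j<N. f (\<omega> N j)) / real N) ((LINT x:A|?\<nu>. f x) / H) < t"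
    using 1 2 eventually_ge_at_top[of 1]
  proof eventually_elim
    case (elim N)
    have s1: "(\<Sum>j<N. f (\<omega> N j) + B) / real N = (\<Sum>j<N. f (\<omega> N j)) / real N + B"
      using elim(3) by (simp add: sum.distrib add_divide_distrib)
    have s2: "(\<Sum>j<N. B - f (\<omega> N j)) / real N = B - (\<Sum>j<N. f (\<omega> N j)) / real N"
      using elim(3) by (simp add: sum_subtractf diff_divide_distrib)
    have j1: "(LINT x:A|?\<nu>. f x + B) / H = (LINT x:A|?\<nu>. f x) / H + B"
      unfolding i1 using H by (simp add: add_divide_distrib)
    have j2: "(LINT x:A|?\<nu>. B - f x) / H = B - (LINT x:A|?\<nu>. f x) / H"
      unfolding i2 using H by (simp add: diff_divide_distrib)
    show ?case using elim(1,2) t unfolding s1 s2 j1 j2 dist_real_def by linarith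
  qed
qed

text \<open>The limit \<open>top\<close> for measure 0 is stated separately because the quotient
  would evaluate to \<open>\<sigma> / 0 = 0\<close>. The \<open>\<sigma>\<close> of the second part
  is pinned down by its own limit on the cube of dimension \<open>CARD('d)\<close>. An empty
  \<open>A\<close> has no configurations for \<open>N \<ge> 1\<close>, which would make the limit 0.
  Weak-star convergence is tested on functions continuous on the compact set
  \<open>A\<close>.\<close>

theorem theorem1:
  shows
  "(\<forall>s > real CARD('p). \<exists>\<sigma>::real. 0 < \<sigma> \<and>
      ((\<lambda>N. polar_max s (cbox (0::real^'p) One) N / ennreal (real N powr (s / real CARD('p))))
         \<longlongrightarrow> ennreal \<sigma>) sequentially)
   \<and>
   (\<forall>s > real CARD('d). \<forall>(M :: (real^'p) set) A.
      CARD('d) \<le> CARD('p) \<and> C1_manifold TYPE(real^'d) M \<and> compact A \<and> A \<subseteq> M \<and> A \<noteq> {} \<and>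
      hausdorff_outer (real CARD('d)) ((subtopology euclidean M) frontier_of A) = 0
      \<longrightarrow>
      (\<exists>\<sigma>::real. 0 < \<sigma> \<and>
         ((\<lambda>N. polar_max s (cbox (0::real^'d) One) N / ennreal (real N powr (s / real CARD('d))))
            \<longlongrightarrow> ennreal \<sigma>) sequentially \<and>
         (hausdorff_outer (real CARD('d)) A > 0 \<longrightarrow>
            ((\<lambda>N. polar_max s A N / ennreal (real N powr (s / real CARD('d))))
               \<longlongrightarrow> ennreal (\<sigma> / enn2real (hausdorff_outer (real CARD('d)) A) powr (s / real CARD('d))))
              sequentially) \<and>
         (hausdorff_outer (real CARD('d)) A = 0 \<longrightarrow>
            ((\<lambda>N. polar_max s A N / ennreal (real N powr (s / real CARD('d)))) \<longlongrightarrow> top)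
              sequentially)) \<and>
      (hausdorff_outer (real CARD('d)) A > 0 \<longrightarrow>
         (\<forall>\<omega>. asymp_optimal s A \<omega> \<longrightarrow>
            (\<forall>f :: real^'p \<Rightarrow> real. continuous_on A f \<longrightarrow>
               ((\<lambda>N. (\<Sum>j<N. f (\<omega> N j)) / real N) \<longlongrightarrow>
                  (LINT x:A|hausdorff_measure (real CARD('d)). f x)
                    / enn2real (hausdorff_outer (real CARD('d)) A)) sequentially))))"
proof (intro conjI allI impI)
  fix s :: real assume "s > real CARD('p)"
  then show "\<exists>\<sigma>::real. 0 < \<sigma> \<and>
      ((\<lambda>N. polar_max s (cbox (0::real^'p) One) N / ennreal (real N powr (s / real CARD('p))))
         \<longlongrightarrow> ennreal \<sigma>) sequentially"
    using polar_max_cube_limit[where 'a = "real^'p", of s] by auto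
next
  fix s :: real and M A :: "(real^'p) set"
  assume s: "s > real CARD('d)"
  assume hyp: "CARD('d) \<le> CARD('p) \<and> C1_manifold TYPE(real^'d) M \<and> compact A \<and> A \<subseteq> M \<and> A \<noteq> {} \<and>
      hausdorff_outer (real CARD('d)) ((subtopology euclidean M) frontier_of A) = 0"
  define d where "d = CARD('d)"
  have D: "DIM(real^'d) = d" by (simp add: d_def)
  have sD: "s > real DIM(real^'d)" using s by simp
  have s0: "s \<ge> 0" using s by (smt (verit) of_nat_0_le_iff)
  obtain \<sigma> where \<sigma>: "cube_const s TYPE(real^'d) \<sigma>"
    using polar_max_cube_limit[where 'a = "real^'d", OF sD] unfolding cube_const_def by blast
  have \<sigma>0: "\<sigma> > 0" using \<sigma> by (simp add: cube_const_def)
  have \<sigma>lim: "(\<lambda>N. polar_max s (cbox (0::real^'d) One) N / ennreal (real N powr (s / d))) \<longlonglongrightarrow> ennreal \<sigma>"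
    using \<sigma> unfolding cube_const_def D by blast
  have M: "C1_manifold TYPE(real^'d) M" and A: "compact A" "A \<subseteq> M" "A \<noteq> {}"
    and fr: "hausdorff_outer DIM(real^'d) ((top_of_set M) frontier_of A) = 0"
    using hyp by auto
  obtain H where H: "H \<ge> 0" "hausdorff_outer d A = ennreal H" and dec: "decomposable s \<sigma> TYPE(real^'d) A H"
    using good_decomposition[OF M A fr \<sigma> s0] unfolding D by blast
  have limpos: "(\<lambda>N. polar_max s A N / ennreal (real N powr (s / d))) \<longlonglongrightarrow> ennreal (\<sigma> / H powr (s / d))" if "H > 0"
    using polar_max_limit(1)[OF \<sigma> sD A(3) H(1) dec that] unfolding D .
  have lim0: "(\<lambda>N. polar_max s A N / ennreal (real N powr (s / d))) \<longlonglongrightarrow> top" if "H = 0"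
    using polar_max_limit(2)[OF \<sigma> sD A(3) H(1) dec that] unfolding D .
  have eH: "enn2real (hausdorff_outer d A) = H" using H by simp
  have posH: "H > 0" if "hausdorff_outer d A > 0" using that H by simp
  show "\<exists>\<sigma>::real. 0 < \<sigma> \<and>
         ((\<lambda>N. polar_max s (cbox (0::real^'d) One) N / ennreal (real N powr (s / real CARD('d))))
            \<longlongrightarrow> ennreal \<sigma>) sequentially \<and>
         (hausdorff_outer (real CARD('d)) A > 0 \<longrightarrow>
            ((\<lambda>N. polar_max s A N / ennreal (real N powr (s / real CARD('d))))
               \<longlongrightarrow> ennreal (\<sigma> / enn2real (hausdorff_outer (real CARD('d)) A) powr (s / real CARD('d))))
              sequentially) \<and>
         (hausdorff_outer (real CARD('d)) A = 0 \<longrightarrow>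
            ((\<lambda>N. polar_max s A N / ennreal (real N powr (s / real CARD('d)))) \<longlongrightarrow> top)
              sequentially)"
    unfolding d_def[symmetric] eH
  proof (intro exI[of _ \<sigma>] conjI impI \<sigma>0 \<sigma>lim)
    assume "hausdorff_outer d A > 0"
    then show "(\<lambda>N. polar_max s A N / ennreal (real N powr (s / d))) \<longlonglongrightarrow> ennreal (\<sigma> / H powr (s / d))"
      by (intro limpos posH)
  next
    assume "hausdorff_outer d A = 0"
    then have "H = 0" using H by simp
    then show "(\<lambda>N. polar_max s A N / ennreal (real N powr (s / d))) \<longlonglongrightarrow> top" by (rule lim0)
  qed
  fix \<omega> and f :: "real^'p \<Rightarrow> real"
  assume pos: "hausdorff_outer (real CARD('d)) A > 0" and opt: "asymp_optimal s A \<omega>" and f: "continuous_on A f"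
  have Hp: "H > 0" using pos by (intro posH) (simp add: d_def)
  show "((\<lambda>N. (\<Sum>j<N. f (\<omega> N j)) / real N) \<longlongrightarrow>
                  (LINT x:A|hausdorff_measure (real CARD('d)). f x)
                    / enn2real (hausdorff_outer (real CARD('d)) A)) sequentially"
    using weak_limit[OF \<sigma> sD Hp A(1,3) _ dec opt f] H(2) unfolding D d_def[symmetric] eH by blast
qed

end
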